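(* Let $\alpha\in(0,2]$, $\beta\in(0,1)$, $\nu>0$, let $d\ge 1$ be an integer with $d<\min\{2,\beta^{-1}\}\alpha$, and let $u_0:\mathbb{R}^d\to\mathbb{R}$ be measurable and bounded. Suppose $\sigma:\mathbb{R}\times\mathbb{R}^d\to\mathbb{R}$ is such that there exist a non-negative function $J$ on $\mathbb{R}^d$ and finite positive constants $Lip_\sigma$, $K$ with $\sigma(0,h)=0$ and $|\sigma(x,h)-\sigma(y,h)|\le J(h)\,Lip_\sigma\,|x-y|$ for all $x,y\in\mathbb{R}$, $h\in\mathbb{R}^d$, and $\int_{\mathbb{R}^d}J(h)^2\mu(dh)\le K$. Then there exists a unique random field solution to $$\frac{\partial^\beta u}{\partial t^\beta}+\nu(-\Delta)^{\alpha/2}u=I_t^{1-\beta}\Big[\int_{\mathbb{R}^d}\sigma(u(t,x),h)\,\dot{\tilde N}(t,x,h)\Big]$$ with initial condition $u_0$.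
   Context: Noise: $\mu$ is a Lévy measure on $\mathbb{R}^d$, i.e. $\int_{\mathbb{R}^d}(1\wedge|h|^2)\mu(dh)<\infty$. $N$ is a Poisson random measure on $\mathbb{R}_+\times\mathbb{R}^d\times\mathbb{R}^d$ with intensity $dt\,dx\,\mu(dh)$, and $\tilde N(ds\,dx\,dh)=N(ds\,dx\,dh)-ds\,dx\,\mu(dh)$. Predictability is with respect to the filtration generated by $N$. For predictable $X$ with $\int_0^T\int\int \mathbb{E}|X(s,x,h)|^2\,ds\,dx\,\mu(dh)<\infty$, the integral $\int_0^T\int\int X\,d\tilde N$ is defined and satisfies $\mathbb{E}|\int X\,d\tilde N|^2=\int_0^T\int\int\mathbb{E}X^2\,ds\,dx\,\mu(dh)$. The function $\sigma$ is jointly measurable. Kernel: $G_t(x)=G(t,x)=\int_0^\infty p_{X(s)}(x)f_{E_t}(s)\,ds$, where $p_{X(s)}$ is the density with Fourier transform $\widehat{p_{X(s)}}(\xi)=e^{-s\nu|\xi|^\alpha}$ (isotropic $\alpha$-stable process on $\mathbb{R}^d$) and $f_{E_t}(s)=t\beta^{-1}s^{-1-1/\beta}g_\beta(ts^{-1/\beta})$ is the density of the inverse $\beta$-stable subordinator $E_t$, $g_\beta$ being the density of $D_1$ for the $\beta$-stable subordinator $D$ with $\mathbb{E}e^{-\lambda D_1}=e^{-\lambda^\beta}$. It is the fundamental solution of $\partial_t^\beta G_t=-\nu(-\Delta)^{\alpha/2}G_t$ (Caputo derivative). The equation is interpreted in the mild sense. A (predictable) random field $\{u(t,x)\}_{t>0,x\in\mathbb{R}^d}$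 is a mild solution with initial condition $u_0$ if, for all $t,x$, a.s., $$u(t,x)=\int_{\mathbb{R}^d}G(t,x-y)u_0(y)\,dy+\int_0^t\int_{\mathbb{R}^d}\int_{\mathbb{R}^d}G(t-s,x-y)\sigma(u(s,y),h)\,\tilde N(ds\,dy\,dh).$$ It is a random field solution if moreover $\sup_{0\le t\le T}\sup_{x\in\mathbb{R}^d}\mathbb{E}|u(t,x)|^2<\infty$ for all $T>0$. Uniqueness is up to modification. *)

theory Defs
  imports "HOL-Probability.Probability"
begin

section \<open>The noise\<close>

text \<open>Sigma-finiteness only excludes an infinite atom at the origin (the integrability
  condition says nothing about the mass at 0); it is what makes the product intensity below
  meaningful. The common convention that there is no mass at 0 is a special case.\<close>

definition levy_measure :: "'a::euclidean_space measure \<Rightarrow> bool" where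
  "levy_measure \<mu> \<longleftrightarrow>
     sets \<mu> = sets borel \<and> sigma_finite_measure \<mu> \<and>
     (\<integral>\<^sup>+h. ennreal (min 1 ((norm h)\<^sup>2)) \<partial>\<mu>) < \<infinity>"

definition intensity :: "'a::euclidean_space measure \<Rightarrow> (real \<times> 'a \<times> 'a) measure" where
  "intensity \<mu> = restrict_space lborel {0..} \<Otimes>\<^sub>M (lborel \<Otimes>\<^sub>M \<mu>)"

definition poisson_random_measure ::
  "'w measure \<Rightarrow> 'e measure \<Rightarrow> ('w \<Rightarrow> 'e measure) \<Rightarrow> bool" where
  "poisson_random_measure M \<Lambda> N \<longleftrightarrow>
     (\<forall>\<omega>\<in>space M. sets (N \<omega>) = sets \<Lambda>) \<and>
     (\<forall>A\<in>sets \<Lambda>. (\<lambda>\<omega>. emeasure (N \<omega>) A) \<in> borel_measurable M) \<and>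
     (\<forall>A\<in>sets \<Lambda>. emeasure \<Lambda> A < \<infinity> \<longrightarrow>
        (\<forall>k::nat. measure M {\<omega>\<in>space M. emeasure (N \<omega>) A = of_nat k} =
                  exp (- measure \<Lambda> A) * measure \<Lambda> A ^ k / fact k)) \<and>
     (\<forall>A\<in>sets \<Lambda>. emeasure \<Lambda> A = \<infinity> \<longrightarrow> (AE \<omega> in M. emeasure (N \<omega>) A = \<infinity>)) \<and>
     (\<forall>(A :: nat \<Rightarrow> 'e set) n. A ` {..<n} \<subseteq> sets \<Lambda> \<and> disjoint_family_on A {..<n} \<longrightarrow>
        prob_space.indep_vars M (\<lambda>_. borel) (\<lambda>i \<omega>. emeasure (N \<omega>) (A i)) {..<n})"

text \<open>The (uncompleted) filtration generated by the noise.\<close>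

definition noise_filtration ::
  "'w measure \<Rightarrow> 'a::euclidean_space measure \<Rightarrow> ('w \<Rightarrow> (real \<times> 'a \<times> 'a) measure) \<Rightarrow> real \<Rightarrow> 'w measure"
where
  "noise_filtration M \<mu> N t =
     sigma (space M)
       {(\<lambda>\<omega>. emeasure (N \<omega>) A) -` B \<inter> space M | A B.
          A \<in> sets (intensity \<mu>) \<and> A \<subseteq> {0..t} \<times> UNIV \<and> B \<in> sets borel}"

text \<open>The mark space \<open>'e\<close> is \<open>\<real>\<^sup>d\<close> (position) for random fields and \<open>\<real>\<^sup>d \<times> \<real>\<^sup>d\<close> (position and
  jump) for integrands.\<close>

definition predictable_sigma ::
  "'w measure \<Rightarrow> (real \<Rightarrow> 'w measure) \<Rightarrow> ('w \<times> real \<times> 'e::topological_space) measure" where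
  "predictable_sigma M \<F> =
     sigma (space M \<times> {0<..} \<times> UNIV)
       {F \<times> {a<..b} \<times> B | F a b B. 0 \<le> a \<and> a < b \<and> F \<in> sets (\<F> a) \<and> B \<in> sets borel}"


section \<open>The stochastic integral with respect to the compensated Poisson random measure\<close>

text \<open>An elementary process is a finite sum of terms
  \<open>Y(\<omega>) 1\<^bsub>(a,b]\<^esub>(s) 1\<^bsub>B\<^esub>(x,h)\<close> with \<open>Y\<close> bounded and measurable at time \<open>a\<close> and \<open>B\<close> of finite
  measure; it is represented by the list of its terms \<open>(Y,a,b,B)\<close>.\<close>

type_synonym ('w, 'a) elementary = "(('w \<Rightarrow> real) \<times> real \<times> real \<times> ('a \<times> 'a) set) list"

definition elementary ::
  "'w measure \<Rightarrow> 'a::euclidean_space measure \<Rightarrow> ('w \<Rightarrow> (real \<times> 'a \<times> 'a) measure) \<Rightarrow>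
   ('w, 'a) elementary \<Rightarrow> bool" where
  "elementary M \<mu> N es \<longleftrightarrow>
     (\<forall>(Y, a, b, B)\<in>set es.
        0 \<le> a \<and> a < b \<and> Y \<in> borel_measurable (noise_filtration M \<mu> N a) \<and>
        bounded (Y ` space M) \<and>
        B \<in> sets (lborel \<Otimes>\<^sub>M \<mu>) \<and> emeasure (lborel \<Otimes>\<^sub>M \<mu>) B < \<infinity>)"

definition elementary_process ::
  "('w, 'a) elementary \<Rightarrow> real \<Rightarrow> 'a \<Rightarrow> 'a \<Rightarrow> 'w \<Rightarrow> real" where
  "elementary_process es s x h \<omega> =
     (\<Sum>(Y, a, b, B)\<leftarrow>es. Y \<omega> * indicator {a<..b} s * indicator B (x, h))"

definition elementary_integral ::
  "'a::euclidean_space measure \<Rightarrow> ('w \<Rightarrow> (real \<times> 'a \<times> 'a) measure) \<Rightarrow>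
   ('w, 'a) elementary \<Rightarrow> 'w \<Rightarrow> real" where
  "elementary_integral \<mu> N es \<omega> =
     (\<Sum>(Y, a, b, B)\<leftarrow>es.
        Y \<omega> * (measure (N \<omega>) ({a<..b} \<times> B) - measure (intensity \<mu>) ({a<..b} \<times> B)))"

text \<open>\<open>I\<close> is a version of the integral of \<open>X\<close> over \<open>[0,T] \<times> \<real>\<^sup>d \<times> \<real>\<^sup>d\<close>: the image of \<open>X\<close> under the
  \<open>L\<^sup>2\<close>-isometric extension of the integral from elementary to all predictable
  square-integrable processes.\<close>

definition has_compensated_integral ::
  "'w measure \<Rightarrow> 'a::euclidean_space measure \<Rightarrow> ('w \<Rightarrow> (real \<times> 'a \<times> 'a) measure) \<Rightarrow> real \<Rightarrow>
   (real \<Rightarrow> 'a \<Rightarrow> 'a \<Rightarrow> 'w \<Rightarrow> real) \<Rightarrow> ('w \<Rightarrow> real) \<Rightarrow> bool" where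
  "has_compensated_integral M \<mu> N T X I \<longleftrightarrow>
     (let XT = (\<lambda>s x h \<omega>. indicator {0<..T} s * X s x h \<omega>) in
      (\<lambda>(\<omega>, s, x, h). XT s x h \<omega>)
         \<in> borel_measurable (predictable_sigma M (noise_filtration M \<mu> N)) \<and>
      (\<integral>\<^sup>+(s, x, h). (\<integral>\<^sup>+\<omega>. ennreal ((XT s x h \<omega>)\<^sup>2) \<partial>M) \<partial>intensity \<mu>) < \<infinity> \<and>
      I \<in> borel_measurable M \<and>
      (\<exists>es. (\<forall>n. elementary M \<mu> N (es n)) \<and>
         (\<lambda>n. \<integral>\<^sup>+(s, x, h). (\<integral>\<^sup>+\<omega>. ennreal ((XT s x h \<omega> - elementary_process (es n) s x h \<omega>)\<^sup>2) \<partial>M)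
                \<partial>intensity \<mu>) \<longlonglongrightarrow> 0 \<and>
         (\<lambda>n. \<integral>\<^sup>+\<omega>. ennreal ((I \<omega> - elementary_integral \<mu> N (es n) \<omega>)\<^sup>2) \<partial>M) \<longlonglongrightarrow> 0))"


section \<open>The kernel\<close>

text \<open>\<open>p s\<close> is the density of the isotropic \<open>\<alpha>\<close>-stable process \<open>X(s)\<close>. Densities are determined
  almost everywhere only; any jointly measurable version is admitted.\<close>

definition isotropic_stable_density ::
  "real \<Rightarrow> real \<Rightarrow> (real \<Rightarrow> 'a::euclidean_space \<Rightarrow> real) \<Rightarrow> bool" where
  "isotropic_stable_density \<alpha> \<nu> p \<longleftrightarrow>
     (\<lambda>(s, x). p s x) \<in> borel_measurable (restrict_space borel {0<..} \<Otimes>\<^sub>M borel) \<and>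
     (\<forall>s>0. (\<forall>x. 0 \<le> p s x) \<and> integrable lborel (p s) \<and>
        (\<forall>\<xi>. (CLINT x|lborel. complex_of_real (p s x) * iexp (\<xi> \<bullet> x)) =
             complex_of_real (exp (- s * \<nu> * norm \<xi> powr \<alpha>))))"

text \<open>\<open>g\<close> is the density of \<open>D\<^sub>1\<close> for the \<open>\<beta>\<close>-stable subordinator \<open>D\<close>.\<close>

definition stable_subordinator_density :: "real \<Rightarrow> (real \<Rightarrow> real) \<Rightarrow> bool" where
  "stable_subordinator_density \<beta> g \<longleftrightarrow>
     (\<forall>z. 0 \<le> g z) \<and> (\<forall>z<0. g z = 0) \<and> integrable lborel g \<and>
     (\<forall>l\<ge>0. (LINT z|lborel. exp (- l * z) * g z) = exp (- (l powr \<beta>)))"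

definition inverse_subordinator_density :: "real \<Rightarrow> (real \<Rightarrow> real) \<Rightarrow> real \<Rightarrow> real \<Rightarrow> real" where
  "inverse_subordinator_density \<beta> g t s =
     t * inverse \<beta> * s powr (- 1 - 1 / \<beta>) * g (t * s powr (- 1 / \<beta>))"

definition fundamental_solution ::
  "real \<Rightarrow> (real \<Rightarrow> real) \<Rightarrow> (real \<Rightarrow> 'a \<Rightarrow> real) \<Rightarrow> real \<Rightarrow> 'a::euclidean_space \<Rightarrow> real" where
  "fundamental_solution \<beta> g p t x = (LINT s:{0<..}|lborel. p s x * inverse_subordinator_density \<beta> g t s)"


section \<open>Solutions\<close>

text \<open>Random fields are written \<open>u t x \<omega>\<close>; only the values for \<open>t > 0\<close> are relevant.\<close>

definition mild_solution ::
  "'w measure \<Rightarrow> 'a::euclidean_space measure \<Rightarrow> ('w \<Rightarrow> (real \<times> 'a \<times> 'a) measure) \<Rightarrow>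
   (real \<Rightarrow> 'a \<Rightarrow> real) \<Rightarrow> (real \<Rightarrow> 'a \<Rightarrow> real) \<Rightarrow> ('a \<Rightarrow> real) \<Rightarrow>
   (real \<Rightarrow> 'a \<Rightarrow> 'w \<Rightarrow> real) \<Rightarrow> bool" where
  "mild_solution M \<mu> N G \<sigma> u0 u \<longleftrightarrow>
     (\<lambda>(\<omega>, t, x). u t x \<omega>) \<in> borel_measurable (predictable_sigma M (noise_filtration M \<mu> N)) \<and>
     (\<forall>t>0. \<forall>x. \<exists>I.
        has_compensated_integral M \<mu> N t (\<lambda>s y h \<omega>. G (t - s) (x - y) * \<sigma> (u s y \<omega>) h) I \<and>
        (AE \<omega> in M. u t x \<omega> = (LINT y|lborel. G t (x - y) * u0 y) + I \<omega>))"

definition random_field_solution ::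
  "'w measure \<Rightarrow> 'a::euclidean_space measure \<Rightarrow> ('w \<Rightarrow> (real \<times> 'a \<times> 'a) measure) \<Rightarrow>
   (real \<Rightarrow> 'a \<Rightarrow> real) \<Rightarrow> (real \<Rightarrow> 'a \<Rightarrow> real) \<Rightarrow> ('a \<Rightarrow> real) \<Rightarrow>
   (real \<Rightarrow> 'a \<Rightarrow> 'w \<Rightarrow> real) \<Rightarrow> bool" where
  "random_field_solution M \<mu> N G \<sigma> u0 u \<longleftrightarrow>
     mild_solution M \<mu> N G \<sigma> u0 u \<and>
     (\<forall>T>0. (SUP t\<in>{0<..T}. SUP x. \<integral>\<^sup>+\<omega>. ennreal ((u t x \<omega>)\<^sup>2) \<partial>M) < \<infinity>)"

definition modification ::
  "'w measure \<Rightarrow> (real \<Rightarrow> 'a \<Rightarrow> 'w \<Rightarrow> real) \<Rightarrow> (real \<Rightarrow> 'a \<Rightarrow> 'w \<Rightarrow> real) \<Rightarrow> bool" where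
  "modification M u v \<longleftrightarrow> (\<forall>t>0. \<forall>x. AE \<omega> in M. u t x \<omega> = v t x \<omega>)"

end

theory Submission
  imports Defs
begin

text \<open>The solution is the fixed point of the mild map, found by Picard iteration in the norm
  \<open>sup\<^bsub>t, x\<^esub> exp (- l * t) * E |u(t, x)|\<^sup>2\<close>. By the isometry of the stochastic integral the mild map is a
  contraction as soon as the integral of \<open>exp (- l * t) * G(t, x)\<^sup>2\<close> over space-time is small, which
  holds for large \<open>l\<close> because the integral of \<open>G(t, x)\<^sup>2\<close> over \<open>x\<close> is at most \<open>C * t powr (- \<beta> * d / \<alpha>)\<close> with
  \<open>\<beta> * d / \<alpha> < 1\<close>: Fourier inversion bounds the stable densities, and \<open>d < 2 * \<alpha>\<close> makes the required moment of
  the subordinator finite. The stochastic convolution has a predictable version because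
  translations are continuous in \<open>L\<^sup>2\<close> of space-time, so that it is mean square continuous.\<close>

section \<open>Mean square convergence\<close>

text \<open>Mean square estimates stay in \<open>ennreal\<close> without square roots, so the
  triangle inequality reads \<open>2 * a + 2 * b\<close>, and the isometry reaches general
  integrands only as an inequality with factor 16. Hence the constants: the weight of the kernel is
  made at most \<open>1 / (256 * Lip\<^sup>2 * K)\<close>, where one 16 pays for that inequality and
  the other is the contraction. A ratio of 1/16 survives the doublings and also gives almost sure
  convergence.

  Two obstacles shape the rest. The densities \<open>p s\<close> and \<open>g\<close> are arbitrary
  versions known through their transforms, so bounds on \<open>p s\<close> come from averages over
  balls and hold almost everywhere, and the kernel, a Bochner integral with default value 0, is only
  bounded from above. The filtration is not completed, so a mean square limit is represented by a
  pointwise \<open>lim\<close> of adapted variables in order to stay adapted; and since each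
  integral is determined only up to a null set depending on (t, x), a jointly predictable choice has
  to be constructed.\<close>

abbreviation square_dist :: "'a measure \<Rightarrow> ('a \<Rightarrow> real) \<Rightarrow> ('a \<Rightarrow> real) \<Rightarrow> ennreal" where
  "square_dist M f g \<equiv> (\<integral>\<^sup>+x. ennreal ((f x - g x)\<^sup>2) \<partial>M)"

lemma square_add_le: "(a + b)\<^sup>2 \<le> 2 * a\<^sup>2 + 2 * (b::real)\<^sup>2"
  using zero_le_power2[of "a - b"] by (simp add: power2_eq_square algebra_simps)

lemma nn_integral_square_triangle:
  fixes f g h :: "'a \<Rightarrow> real"
  assumes [measurable]: "f \<in> borel_measurable M" "g \<in> borel_measurable M" "h \<in> borel_measurable M"
  shows "square_dist M f h \<le> 2 * square_dist M f g + 2 * square_dist M g h"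
proof -
  have "square_dist M f h \<le> (\<integral>\<^sup>+x. 2 * ennreal ((f x - g x)\<^sup>2) + 2 * ennreal ((g x - h x)\<^sup>2) \<partial>M)"
  proof (rule nn_integral_mono)
    fix x
    have "ennreal ((f x - h x)\<^sup>2) \<le> ennreal (2 * (f x - g x)\<^sup>2 + 2 * (g x - h x)\<^sup>2)"
      using square_add_le[of "f x - g x" "g x - h x"] by (intro ennreal_leI) simp
    also have "\<dots> = 2 * ennreal ((f x - g x)\<^sup>2) + 2 * ennreal ((g x - h x)\<^sup>2)"
      by (simp add: ennreal_plus ennreal_mult)
    finally show "ennreal ((f x - h x)\<^sup>2) \<le> 2 * ennreal ((f x - g x)\<^sup>2) + 2 * ennreal ((g x - h x)\<^sup>2)" .
  qed
  also have "\<dots> = 2 * square_dist M f g + 2 * square_dist M g h"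
    by (simp add: nn_integral_add nn_integral_cmult)
  finally show ?thesis .
qed

lemma nn_integral_square_commute:
  fixes f g :: "'a \<Rightarrow> real"
  shows "square_dist M f g = square_dist M g f"
  by (simp add: power2_commute)

text \<open>The first step is split off, not the last: the tail from \<open>Suc n\<close> then
  carries a factor 1/16, which beats the doubling. The constant 4 closes the induction because 2 *
  4/16 + 2 = 5/2 \<le> 4.\<close>

lemma geometric_square_cauchy:
  fixes f :: "nat \<Rightarrow> 'a \<Rightarrow> real"
  assumes [measurable]: "\<And>n. f n \<in> borel_measurable M"
    and le: "\<And>n. square_dist M (f (Suc n)) (f n) \<le> ennreal (C * (1/16)^n)" and C: "0 \<le> C"
  shows "square_dist M (\<lambda>x. f (n + k) x) (f n) \<le> ennreal (4 * C * (1/16)^n)"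
proof (induction k arbitrary: n)
  case 0
  show ?case using C by simp
next
  case (Suc k)
  have "square_dist M (\<lambda>x. f (n + Suc k) x) (f n)
     \<le> 2 * square_dist M (\<lambda>x. f (Suc n + k) x) (f (Suc n)) + 2 * square_dist M (f (Suc n)) (f n)"
    using nn_integral_square_triangle[of "f (n + Suc k)" M "f (Suc n)" "f n"] by simp
  also have "\<dots> \<le> 2 * ennreal (4 * C * (1/16)^Suc n) + 2 * ennreal (C * (1/16)^n)"
    by (intro add_mono mult_left_mono Suc le) auto
  also have "\<dots> = ennreal (2 * (4 * C * (1/16)^Suc n) + 2 * (C * (1/16)^n))"
  proof -
    have "2 * ennreal a + 2 * ennreal b = ennreal (2 * a + 2 * b)" if "0 \<le> a" "0 \<le> b" for a b
      using that by (simp add: ennreal_plus ennreal_mult)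
    then show ?thesis using C by (simp only: mult_nonneg_nonneg zero_le_numeral zero_le_power zero_le_divide_iff zero_le_one simp_thms)
  qed
  also have "\<dots> \<le> ennreal (4 * C * (1/16)^n)"
    using C by (intro ennreal_leI) (simp add: field_simps)
  finally show ?case .
qed

text \<open>The weights \<open>4^n\<close> leave terms of order \<open>(1/4)^n\<close> in the mean,
  so almost surely \<open>4^n\<close> times the n-th squared increment stays below a finite c and
  the increment is at most \<open>sqrt c * (1/2)^n\<close>, which is summable. Fatou's lemma then
  carries the Cauchy bound over to the limit.\<close>

lemma geometric_square_limit:
  fixes f :: "nat \<Rightarrow> 'a \<Rightarrow> real"
  assumes m [measurable]: "\<And>n. f n \<in> borel_measurable M"
    and le: "\<And>n. square_dist M (f (Suc n)) (f n) \<le> ennreal (C * (1/16)^n)" and C: "0 \<le> C"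
  shows "AE x in M. (\<lambda>n. f n x) \<longlonglongrightarrow> lim (\<lambda>n. f n x)" (is ?A)
    and "square_dist M (\<lambda>x. lim (\<lambda>n. f n x)) (f n) \<le> ennreal (4 * C * (1/16)^n)" (is ?B)
proof -
  have "(\<integral>\<^sup>+x. (\<Sum>n. ennreal (4^n * (f (Suc n) x - f n x)\<^sup>2)) \<partial>M) = (\<Sum>n. \<integral>\<^sup>+x. ennreal (4^n * (f (Suc n) x - f n x)\<^sup>2) \<partial>M)"
    by (rule nn_integral_suminf) simp
  also have "\<dots> \<le> (\<Sum>n. ennreal (C * (1/4)^n))"
  proof (intro suminf_le allI)
    fix n
    have "(\<integral>\<^sup>+x. ennreal (4^n * (f (Suc n) x - f n x)\<^sup>2) \<partial>M) = ennreal (4^n) * square_dist M (f (Suc n)) (f n)"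
      by (subst nn_integral_cmult[symmetric]) (auto simp: ennreal_mult)
    also have "\<dots> \<le> ennreal (4^n) * ennreal (C * (1/16)^n)" by (intro mult_left_mono le) auto
    also have "\<dots> = ennreal (C * (1/4)^n)"
    proof -
      have "(4::real)^n * (C * (1/16)^n) = C * (4 * (1/16))^n" unfolding power_mult_distrib by simp
      then show ?thesis using C by (simp add: ennreal_mult[symmetric])
    qed
    finally show "(\<integral>\<^sup>+x. ennreal (4^n * (f (Suc n) x - f n x)\<^sup>2) \<partial>M) \<le> ennreal (C * (1/4)^n)" .
  qed auto
  also have "\<dots> < \<infinity>"
  proof -
    have "summable (\<lambda>n. C * (1/4::real)^n)" by (intro summable_mult summable_geometric) simp
    then show ?thesis using C by (simp add: suminf_ennreal2)
  qed
  finally have fin: "(\<integral>\<^sup>+x. (\<Sum>n. ennreal (4^n * (f (Suc n) x - f n x)\<^sup>2)) \<partial>M) \<noteq> \<infinity>" by simp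
  have "AE x in M. (\<Sum>n. ennreal (4^n * (f (Suc n) x - f n x)\<^sup>2)) \<noteq> \<infinity>"
    by (rule nn_integral_noteq_infinite[OF _ fin]) simp
  then show A: ?A
  proof eventually_elim
    fix x assume x: "(\<Sum>n. ennreal (4^n * (f (Suc n) x - f n x)\<^sup>2)) \<noteq> \<infinity>"
    have "\<exists>c\<ge>0. S = ennreal c" if "S \<noteq> \<infinity>" for S
      using that by (cases S rule: ennreal_cases) auto
    from this[OF x] obtain c where c: "0 \<le> c" "(\<Sum>n. ennreal (4^n * (f (Suc n) x - f n x)\<^sup>2)) = ennreal c"
      by blast
    have b: "\<bar>f (Suc n) x - f n x\<bar> \<le> sqrt c * (1/2)^n" for n
    proof -
      have "sum (\<lambda>k. ennreal (4^k * (f (Suc k) x - f k x)\<^sup>2)) {n} \<le> (\<Sum>n. ennreal (4^n * (f (Suc n) x - f n x)\<^sup>2))"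
        by (intro sum_le_suminf) auto
      then have "4^n * (f (Suc n) x - f n x)\<^sup>2 \<le> c" unfolding c(2) using c(1) by simp
      moreover have "4^n * (f (Suc n) x - f n x)\<^sup>2 = (2^n * (f (Suc n) x - f n x))\<^sup>2"
      proof -
        have "(2^n)\<^sup>2 = (4::real)^n" by (simp add: power2_eq_square flip: power_mult_distrib)
        then show ?thesis by (simp only: power_mult_distrib)
      qed
      ultimately have "\<bar>2^n * (f (Suc n) x - f n x)\<bar> \<le> sqrt c" by (simp add: real_le_rsqrt)
      then have "2^n * \<bar>f (Suc n) x - f n x\<bar> \<le> sqrt c" by (simp only: abs_mult power_abs abs_numeral)
      then show ?thesis by (simp add: field_simps power_one_over)
    qed
    have "summable (\<lambda>n. f (Suc n) x - f n x)"
    proof (rule summable_comparison_test)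
      show "\<exists>N. \<forall>n\<ge>N. norm (f (Suc n) x - f n x) \<le> sqrt c * (1/2)^n" using b by auto
      show "summable (\<lambda>n. sqrt c * (1/2::real)^n)" by (intro summable_mult summable_geometric) simp
    qed
    then have "convergent (\<lambda>n. \<Sum>k<n. f (Suc k) x - f k x)" by (simp add: summable_iff_convergent)
    then have "convergent (\<lambda>n. f n x - f 0 x)"
      by (simp add: sum_lessThan_telescope[of "\<lambda>k. f k x"])
    then show "(\<lambda>n. f n x) \<longlonglongrightarrow> lim (\<lambda>n. f n x)"
      by (simp only: convergent_LIMSEQ_iff[symmetric] convergent_diff_const_right_iff)
  qed
  show ?B
  proof -
    have "square_dist M (\<lambda>x. lim (\<lambda>n. f n x)) (f n) = (\<integral>\<^sup>+x. liminf (\<lambda>k. ennreal ((f (n + k) x - f n x)\<^sup>2)) \<partial>M)"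
    proof (rule nn_integral_cong_AE)
      show "AE x in M. ennreal ((lim (\<lambda>n. f n x) - f n x)\<^sup>2) = liminf (\<lambda>k. ennreal ((f (n + k) x - f n x)\<^sup>2))"
        using A
      proof eventually_elim
        fix x assume "(\<lambda>n. f n x) \<longlonglongrightarrow> lim (\<lambda>n. f n x)"
        then have "(\<lambda>k. f (k + n) x) \<longlonglongrightarrow> lim (\<lambda>n. f n x)" by (rule LIMSEQ_ignore_initial_segment)
        then have "(\<lambda>k. ennreal ((f (n + k) x - f n x)\<^sup>2)) \<longlonglongrightarrow> ennreal ((lim (\<lambda>n. f n x) - f n x)\<^sup>2)"
          by (intro tendsto_intros) (simp add: add.commute)
        then show "ennreal ((lim (\<lambda>n. f n x) - f n x)\<^sup>2) = liminf (\<lambda>k. ennreal ((f (n + k) x - f n x)\<^sup>2))"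
          by (intro lim_imp_Liminf[symmetric]) auto
      qed
    qed
    also have "\<dots> \<le> liminf (\<lambda>k. \<integral>\<^sup>+x. ennreal ((f (n + k) x - f n x)\<^sup>2) \<partial>M)"
      by (rule nn_integral_liminf) simp
    also have "\<dots> \<le> liminf (\<lambda>k. ennreal (4 * C * (1/16)^n))"
      by (intro Liminf_mono always_eventually allI geometric_square_cauchy m le C)
    also have "\<dots> = ennreal (4 * C * (1/16)^n)" by (simp add: Liminf_const)
    finally show ?thesis .
  qed
qed

text \<open>Summable mean square errors force the errors to 0 almost surely. The bound is assumed
  only from \<open>n0\<close> on because the grid approximations used later are controlled at time t
  only once their horizon has passed t.\<close>

lemma AE_tendsto_of_geometric:
  fixes f :: "nat \<Rightarrow> 'a \<Rightarrow> real"
  assumes m [measurable]: "\<And>n. f n \<in> borel_measurable M" "g \<in> borel_measurable M"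
    and le: "\<And>n. n \<ge> n0 \<Longrightarrow> square_dist M (f n) g \<le> ennreal ((1/16)^n)"
  shows "AE x in M. (\<lambda>n. f n x) \<longlonglongrightarrow> g x"
proof -
  have "(\<integral>\<^sup>+x. (\<Sum>n. ennreal ((f (n + n0) x - g x)\<^sup>2)) \<partial>M) = (\<Sum>n. \<integral>\<^sup>+x. ennreal ((f (n + n0) x - g x)\<^sup>2) \<partial>M)"
    by (rule nn_integral_suminf) simp
  also have "\<dots> \<le> (\<Sum>n. ennreal ((1/16)^(n + n0)))"
    by (intro suminf_le allI le) auto
  also have "\<dots> < \<infinity>"
  proof -
    have "summable (\<lambda>n. (1/16::real)^(n + n0))" by (subst summable_iff_shift) (intro summable_geometric, simp)
    then show ?thesis by (simp add: suminf_ennreal2)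
  qed
  finally have fin: "(\<integral>\<^sup>+x. (\<Sum>n. ennreal ((f (n + n0) x - g x)\<^sup>2)) \<partial>M) \<noteq> \<infinity>" by simp
  have "AE x in M. (\<Sum>n. ennreal ((f (n + n0) x - g x)\<^sup>2)) \<noteq> \<infinity>"
    by (rule nn_integral_noteq_infinite[OF _ fin]) simp
  then show ?thesis
  proof eventually_elim
    fix x assume "(\<Sum>n. ennreal ((f (n + n0) x - g x)\<^sup>2)) \<noteq> \<infinity>"
    then have "summable (\<lambda>n. (f (n + n0) x - g x)\<^sup>2)" by (intro summable_suminf_not_top) auto
    then have "(\<lambda>n. (f (n + n0) x - g x)\<^sup>2) \<longlonglongrightarrow> 0" by (rule summable_LIMSEQ_zero)
    then have "(\<lambda>n. f (n + n0) x - g x) \<longlonglongrightarrow> 0" by simp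
    then have "(\<lambda>n. f (n + n0) x) \<longlonglongrightarrow> g x" by (simp add: LIM_zero_iff)
    then show "(\<lambda>n. f n x) \<longlonglongrightarrow> g x" by (rule LIMSEQ_offset)
  qed
qed

lemma AE_eq_of_square_le_geometric:
  fixes f g :: "'a \<Rightarrow> real"
  assumes [measurable]: "f \<in> borel_measurable M" "g \<in> borel_measurable M"
    and le: "\<And>n. square_dist M f g \<le> ennreal (C * (1/16)^n)"
  shows "AE x in M. f x = g x"
proof -
  have "(\<lambda>n. ennreal (C * (1/16)^n)) \<longlonglongrightarrow> ennreal (C * 0)"
    by (intro tendsto_intros LIMSEQ_realpow_zero) auto
  then have "square_dist M f g \<le> ennreal (C * 0)"
    by (rule LIMSEQ_le_const) (use le in auto)
  then have "square_dist M f g = 0" by simp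
  then have "AE x in M. ennreal ((f x - g x)\<^sup>2) = 0" by (subst (asm) nn_integral_0_iff_AE) auto
  then show ?thesis by eventually_elim (simp add: ennreal_eq_0_iff)
qed

lemma borel_measurable_fst [measurable]: "fst \<in> borel_measurable (borel :: ('a::second_countable_topology \<times> 'b::second_countable_topology) measure)"
  and borel_measurable_snd [measurable]: "snd \<in> borel_measurable (borel :: ('a \<times> 'b) measure)"
  by (auto intro!: borel_measurable_continuous_onI continuous_intros)

section \<open>Continuity of translations in mean square\<close>

lemma translate_nn_integral:
  fixes f :: "'a::euclidean_space \<Rightarrow> ennreal"
  assumes [measurable]: "f \<in> borel_measurable borel"
  shows "(\<integral>\<^sup>+x. f (x + d) \<partial>lborel) = (\<integral>\<^sup>+x. f x \<partial>lborel)"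
proof -
  have "(\<integral>\<^sup>+x. f x \<partial>lborel) = (\<integral>\<^sup>+x. f x \<partial>distr lborel borel (\<lambda>x. d + x))"
    by (subst lborel_distr_plus) simp
  also have "\<dots> = (\<integral>\<^sup>+x. f (d + x) \<partial>lborel)" by (rule nn_integral_distr) auto
  finally show ?thesis by (simp add: add.commute)
qed

lemma reflect_nn_integral:
  fixes f :: "'a::euclidean_space \<Rightarrow> ennreal"
  assumes [measurable]: "f \<in> borel_measurable borel"
  shows "(\<integral>\<^sup>+x. f (c - x) \<partial>lborel) = (\<integral>\<^sup>+x. f x \<partial>lborel)"
proof -
  have "lborel = density (distr lborel borel (\<lambda>x::'a. c + (-1) *\<^sub>R x)) (\<lambda>_. 1)"
    using lborel_affine[of "-1" c] by simp
  then have "(\<integral>\<^sup>+x. f x \<partial>lborel) = (\<integral>\<^sup>+x. f x \<partial>distr lborel borel (\<lambda>x::'a. c + (-1) *\<^sub>R x))"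
    by (simp add: density_1)
  also have "\<dots> = (\<integral>\<^sup>+x. f (c + (-1) *\<^sub>R x) \<partial>lborel)" by (rule nn_integral_distr) auto
  finally show ?thesis by simp
qed

definition translation_error :: "('a::euclidean_space \<Rightarrow> real) \<Rightarrow> 'a \<Rightarrow> ennreal" where
  "translation_error f d = square_dist lborel (\<lambda>x. f (x + d)) f"

lemma open_translate_eventually:
  fixes K U :: "'a::euclidean_space set"
  assumes "compact K" "open U" "K \<subseteq> U"
  shows "\<forall>\<^sub>F d in at 0. \<forall>x\<in>K. x - d \<in> U \<and> x + d \<in> U"
proof -
  obtain e where e: "e > 0" "(\<Union>x\<in>K. ball x e) \<subseteq> U"
    using compact_subset_open_imp_ball_epsilon_subset[OF assms] .
  show ?thesis unfolding eventually_at
  proof (intro exI[of _ e] conjI ballI impI)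
    fix x d :: 'a assume "d \<noteq> 0 \<and> dist d 0 < e" "x \<in> K"
    then have "x + d \<in> ball x e" "x - d \<in> ball x e" by (simp_all add: dist_norm)
    with e(2) \<open>x \<in> K\<close> show "x + d \<in> U" "x - d \<in> U" by blast+
  qed (rule e)
qed

text \<open>The compact set is the complement of an open set that barely exceeds \<open>- A\<close>,
  cut by a large ball; each of the two operations loses at most e/2.\<close>

lemma inner_regular_compact:
  fixes A :: "'a::euclidean_space set"
  assumes A [measurable]: "A \<in> sets borel" and fin: "emeasure lborel A < \<infinity>" and e: "0 < e"
  obtains K where "compact K" "K \<subseteq> A" "emeasure lborel (A - K) \<le> ennreal e"
proof -
  have "(\<lambda>n. emeasure lborel (A - cball 0 (real n))) \<longlonglongrightarrow> emeasure lborel (\<Inter>n. A - cball 0 (real n))"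
  proof (rule Lim_emeasure_decseq)
    show "decseq (\<lambda>n. A - cball 0 (real n))" by (auto simp: decseq_def)
    show "emeasure lborel (A - cball 0 (real i)) \<noteq> \<infinity>" for i
      using fin emeasure_mono[of "A - cball 0 (real i)" A lborel] by (auto simp: top_unique)
  qed auto
  moreover have "(\<Inter>n. A - cball 0 (real n)) = {}"
    using real_arch_simple by (auto simp: dist_norm)
  ultimately have "(\<lambda>n. emeasure lborel (A - cball 0 (real n))) \<longlonglongrightarrow> 0" by (simp only: emeasure_empty)
  then have "\<forall>\<^sub>F n in sequentially. emeasure lborel (A - cball 0 (real n)) < ennreal (e/2)"
    by (rule order_tendstoD) (use e in simp)
  then obtain n where n: "emeasure lborel (A - cball 0 (real n)) < ennreal (e/2)"
    by (auto simp: eventually_sequentially)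
  obtain U where U: "open U" "- A \<subseteq> U" "emeasure lborel (U - (- A)) < ennreal (e/2)"
    using outer_regular_lborel[of "- A" "e/2"] A e by auto
  have [measurable]: "U \<in> sets borel" using U(1) by simp
  show thesis
  proof
    show "compact (- U \<inter> cball 0 (real n))" using U(1) by (intro closed_Int_compact) auto
    show "- U \<inter> cball 0 (real n) \<subseteq> A" using U(2) by auto
    have "emeasure lborel (A - (- U \<inter> cball 0 (real n))) \<le> emeasure lborel ((U - (- A)) \<union> (A - cball 0 (real n)))"
      by (intro emeasure_mono) auto
    also have "\<dots> \<le> emeasure lborel (U - (- A)) + emeasure lborel (A - cball 0 (real n))"
      by (intro emeasure_subadditive) auto
    also have "\<dots> \<le> ennreal (e/2) + ennreal (e/2)" using n U(3) by (intro add_mono) auto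
    also have "\<dots> = ennreal e" using e by (simp flip: ennreal_plus)
    finally show "emeasure lborel (A - (- U \<inter> cball 0 (real n))) \<le> ennreal e" .
  qed
qed

text \<open>A is squeezed between a compact K and an open U. For small d the shifts of K by d and by
  -d stay in U, so wherever A and its translate differ, one of the points x, x + d lies in
  \<open>A - K\<close> or in \<open>U - A\<close>. This leaves four sets of measure at most
  e/4.\<close>

lemma translation_error_indicator:
  fixes A :: "'a::euclidean_space set"
  assumes A [measurable]: "A \<in> sets borel" and fin: "emeasure lborel A < \<infinity>" and e: "0 < e"
  shows "\<forall>\<^sub>F d in at 0. translation_error (indicator A) d \<le> ennreal e"
proof -
  obtain K where K: "compact K" "K \<subseteq> A" "emeasure lborel (A - K) \<le> ennreal (e/4)"
    using inner_regular_compact[OF A fin, of "e/4"] e by auto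
  obtain U where U: "open U" "A \<subseteq> U" "emeasure lborel (U - A) < ennreal (e/4)"
    using outer_regular_lborel[OF A, of "e/4"] e by auto
  have [measurable]: "U \<in> sets borel" "K \<in> sets borel" using U(1) K(1) by (auto intro: borel_compact)
  have KU: "K \<subseteq> U" using K(2) U(2) by auto
  show ?thesis
    using open_translate_eventually[OF K(1) U(1) KU]
  proof eventually_elim
    fix d assume d: "\<forall>x\<in>K. x - d \<in> U \<and> x + d \<in> U"
    have pt: "ennreal ((indicator A (x + d) - indicator A x)\<^sup>2) \<le>
       indicator (A - K) (x + d) + indicator (U - A) (x + d) + (indicator (A - K) x + indicator (U - A) x)" for x
    proof -
      have "x \<in> U" if "x + d \<in> K" using d that by force
      moreover have "x + d \<in> U" if "x \<in> K" using d that by force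
      ultimately show ?thesis by (auto simp: indicator_def)
    qed
    have "translation_error (indicator A) d \<le> (\<integral>\<^sup>+x. indicator (A - K) (x + d) + indicator (U - A) (x + d) + (indicator (A - K) x + indicator (U - A) x) \<partial>lborel)"
      unfolding translation_error_def by (intro nn_integral_mono pt)
    also have "\<dots> = ((\<integral>\<^sup>+x. indicator (A - K) (x + d) \<partial>lborel) + (\<integral>\<^sup>+x. indicator (U - A) (x + d) \<partial>lborel)) + (emeasure lborel (A - K) + emeasure lborel (U - A))"
      by (simp add: nn_integral_add)
    also have "\<dots> = (emeasure lborel (A - K) + emeasure lborel (U - A)) + (emeasure lborel (A - K) + emeasure lborel (U - A))"
      by (simp add: translate_nn_integral)
    also have "\<dots> \<le> (ennreal (e/4) + ennreal (e/4)) + (ennreal (e/4) + ennreal (e/4))"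
      using K(3) U(3) by (intro add_mono) auto
    also have "\<dots> = ennreal e" using e by (simp flip: ennreal_plus)
    finally show "translation_error (indicator A) d \<le> ennreal e" .
  qed
qed

lemma ennreal_tendsto_0I:
  fixes f :: "'a \<Rightarrow> ennreal"
  assumes "\<And>e. 0 < e \<Longrightarrow> \<forall>\<^sub>F x in F. f x \<le> ennreal e"
  shows "(f \<longlongrightarrow> 0) F"
proof (rule order_tendstoI)
  fix a :: ennreal assume "0 < a"
  then obtain e where "0 < e" "ennreal e < a"
    by (metis dense ennreal_less_zero_iff less_top ennreal_enn2real enn2real_positive_iff le_less_trans le_less not_less_zero)
  then show "\<forall>\<^sub>F x in F. f x < a"
    using assms[OF \<open>0 < e\<close>] by (auto elim: eventually_mono)
qed auto

text \<open>By translation invariance the translates of f and g are as far apart as f and g, so this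
  distance enters with 2 + 4 = 6, while the error of g passes through two triangle
  inequalities.\<close>

lemma translation_error_triangle:
  fixes f g :: "'a::euclidean_space \<Rightarrow> real"
  assumes [measurable]: "f \<in> borel_measurable borel" "g \<in> borel_measurable borel"
  shows "translation_error f d \<le> 6 * square_dist lborel f g + 4 * translation_error g d"
proof -
  let ?D = "\<integral>\<^sup>+x. ennreal ((f x - g x)\<^sup>2) \<partial>lborel"
  have "translation_error f d \<le> 2 * square_dist lborel (\<lambda>x. f (x + d)) (\<lambda>x. g (x + d)) + 2 * square_dist lborel (\<lambda>x. g (x + d)) f"
    unfolding translation_error_def by (rule nn_integral_square_triangle) auto
  also have "square_dist lborel (\<lambda>x. f (x + d)) (\<lambda>x. g (x + d)) = ?D"
    using translate_nn_integral[of "\<lambda>x. ennreal ((f x - g x)\<^sup>2)" d] by simp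
  also have "square_dist lborel (\<lambda>x. g (x + d)) f \<le> 2 * translation_error g d + 2 * square_dist lborel g f"
    unfolding translation_error_def by (rule nn_integral_square_triangle) auto
  also have "square_dist lborel g f = ?D" by (rule nn_integral_square_commute)
  also have "2 * ?D + 2 * (2 * translation_error g d + 2 * ?D) = 6 * ?D + 4 * translation_error g d"
  proof -
    have "2 * a + 2 * (2 * b + 2 * a) = 6 * a + 4 * (b::ennreal)" for a b
    proof -
      have "2 * (2 * b + 2 * a) = 4 * b + 4 * a" by (simp add: distrib_left mult.assoc[symmetric])
      moreover have "2 * a + 4 * a = (2 + 4) * a" by (rule distrib_right[symmetric])
      ultimately show ?thesis by (simp add: add.assoc[symmetric] add.commute)
    qed
    then show ?thesis .
  qed
  finally show ?thesis by (simp add: mult_left_mono add_left_mono)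
qed

text \<open>No regularity of f enters beyond square integrability; the claim is built up from
  indicators by measurable induction. In the monotone limit, dominated convergence makes some
  \<open>U i\<close> close to f in mean square, and the choices e/12 and e/8 match the factors 6 and
  4 of the triangle inequality.\<close>

lemma translation_error_tendsto_0:
  fixes f :: "'a::euclidean_space \<Rightarrow> real"
  assumes f: "f \<in> borel_measurable borel" "\<And>x. 0 \<le> f x" and fin: "(\<integral>\<^sup>+x. ennreal ((f x)\<^sup>2) \<partial>lborel) < \<infinity>"
  shows "(translation_error f \<longlongrightarrow> 0) (at 0)"
  using f fin
proof (induction rule: borel_measurable_induct_real)
  case (set A)
  have "(\<integral>\<^sup>+x. ennreal ((indicator A x)\<^sup>2) \<partial>lborel) = (\<integral>\<^sup>+x. indicator A x \<partial>(lborel :: 'a measure))"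
    by (intro nn_integral_cong) (auto simp: indicator_def)
  then have "emeasure lborel A < \<infinity>" using set by simp
  then show ?case using set by (intro ennreal_tendsto_0I translation_error_indicator) auto
next
  case (mult u c)
  note [measurable] = mult.hyps(2)
  have te: "translation_error (\<lambda>x. c * u x) = (\<lambda>d. ennreal (c\<^sup>2) * translation_error u d)"
    unfolding translation_error_def
    by (subst nn_integral_cmult[symmetric]) (auto simp: ennreal_mult[symmetric] power_mult_distrib right_diff_distrib[symmetric])
  show ?case
  proof (cases "c = 0")
    case False
    have "(\<integral>\<^sup>+x. ennreal ((c * u x)\<^sup>2) \<partial>lborel) = ennreal (c\<^sup>2) * (\<integral>\<^sup>+x. ennreal ((u x)\<^sup>2) \<partial>lborel)"
      by (subst nn_integral_cmult[symmetric]) (auto simp: ennreal_mult power_mult_distrib)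
    then have "(\<integral>\<^sup>+x. ennreal ((u x)\<^sup>2) \<partial>lborel) < \<infinity>"
      using mult.prems False by (auto simp: ennreal_mult_less_top)
    from mult.IH[OF this] have "((\<lambda>d. ennreal (c\<^sup>2) * translation_error u d) \<longlongrightarrow> ennreal (c\<^sup>2) * 0) (at 0)"
      by (intro tendsto_mult_ennreal tendsto_const) auto
    then show ?thesis unfolding te by simp
  qed (simp add: translation_error_def)
next
  case (add u v)
  note [measurable] = add.hyps(1,3)
  have le: "(\<integral>\<^sup>+x. ennreal ((w x)\<^sup>2) \<partial>lborel) \<le> (\<integral>\<^sup>+x. ennreal ((v x + u x)\<^sup>2) \<partial>lborel)" if "w = u \<or> w = v" for w
    using that add.hyps(2,4) by (intro nn_integral_mono ennreal_leI power_mono) auto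
  have "(translation_error u \<longlongrightarrow> 0) (at 0)" "(translation_error v \<longlongrightarrow> 0) (at 0)"
    using le[of u] le[of v] add.prems by (auto intro!: add.IH intro: le_less_trans)
  then have lim: "((\<lambda>d. 2 * translation_error u d + 2 * translation_error v d) \<longlongrightarrow> 2 * 0 + 2 * 0) (at 0)"
    by (intro tendsto_add tendsto_mult_ennreal tendsto_const) auto
  have le: "translation_error (\<lambda>x. v x + u x) d \<le> 2 * translation_error u d + 2 * translation_error v d" for d
  proof -
    have "translation_error (\<lambda>x. v x + u x) d = square_dist lborel (\<lambda>x. u (x + d) - u x) (\<lambda>x. v x - v (x + d))"
      unfolding translation_error_def by (intro nn_integral_cong arg_cong[of _ _ ennreal] arg_cong[of _ _ "\<lambda>z. z\<^sup>2"]) simp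
    also have "\<dots> \<le> 2 * square_dist lborel (\<lambda>x. u (x + d) - u x) (\<lambda>_. 0) + 2 * square_dist lborel (\<lambda>_. 0) (\<lambda>x. v x - v (x + d))"
      by (rule nn_integral_square_triangle) auto
    finally show ?thesis unfolding translation_error_def by simp
  qed
  show ?case
  proof (rule tendsto_sandwich)
    show "((\<lambda>_. 0) \<longlongrightarrow> 0) (at (0::'a))" by (rule tendsto_const)
    show "((\<lambda>d. 2 * translation_error u d + 2 * translation_error v d) \<longlongrightarrow> 0) (at 0)" using lim by simp
  qed (auto intro!: always_eventually le)
next
  case (seq U)
  note [measurable] = seq.hyps(1)
  have le: "U i x \<le> f x" for i x
    using seq.hyps(3) seq.hyps(4)[of x] by (auto intro!: incseq_le simp: incseq_def le_fun_def)
  have f [measurable]: "f \<in> borel_measurable borel" by (rule borel_measurable_LIMSEQ_real[OF seq.hyps(4)]) auto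
  have f0: "0 \<le> f x" for x using le[of 0 x] seq.hyps(2)[of 0 x] by simp
  have "(\<lambda>i. \<integral>\<^sup>+x. ennreal ((f x - U i x)\<^sup>2) \<partial>lborel) \<longlonglongrightarrow> (\<integral>\<^sup>+x. 0 \<partial>(lborel :: 'a measure))"
  proof (rule nn_integral_dominated_convergence)
    show "AE x in lborel. ennreal ((f x - U i x)\<^sup>2) \<le> ennreal ((f x)\<^sup>2)" for i
      using le seq.hyps(2) by (auto intro!: AE_I2 ennreal_leI power_mono)
    show "AE x in lborel. (\<lambda>i. ennreal ((f x - U i x)\<^sup>2)) \<longlonglongrightarrow> 0"
    proof (rule AE_I2)
      fix x
      have "(\<lambda>i. ennreal ((f x - U i x)\<^sup>2)) \<longlonglongrightarrow> ennreal ((f x - f x)\<^sup>2)"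
        using seq.hyps(4)[of x] by (intro tendsto_intros) auto
      then show "(\<lambda>i. ennreal ((f x - U i x)\<^sup>2)) \<longlonglongrightarrow> 0" by simp
    qed
  qed (use seq.prems in auto)
  then have D: "(\<lambda>i. \<integral>\<^sup>+x. ennreal ((f x - U i x)\<^sup>2) \<partial>lborel) \<longlonglongrightarrow> 0" by simp
  show ?case
  proof (rule ennreal_tendsto_0I)
    fix e :: real assume e: "0 < e"
    have "\<forall>\<^sub>F i in sequentially. square_dist lborel f (U i) < ennreal (e/12)"
      using D by (rule order_tendstoD) (use e in simp)
    then obtain i where i: "square_dist lborel f (U i) < ennreal (e/12)"
      by (auto simp: eventually_sequentially)
    have "(\<integral>\<^sup>+x. ennreal ((U i x)\<^sup>2) \<partial>lborel) \<le> (\<integral>\<^sup>+x. ennreal ((f x)\<^sup>2) \<partial>lborel)"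
      using le seq.hyps(2) by (intro nn_integral_mono ennreal_leI power_mono) auto
    then have "(translation_error (U i) \<longlongrightarrow> 0) (at 0)" using seq.prems by (intro seq.IH) auto
    then have "\<forall>\<^sub>F d in at 0. translation_error (U i) d < ennreal (e/8)"
      by (rule order_tendstoD) (use e in simp)
    then show "\<forall>\<^sub>F d in at 0. translation_error f d \<le> ennreal e"
    proof eventually_elim
      fix d assume d: "translation_error (U i) d < ennreal (e/8)"
      have "translation_error f d \<le> 6 * square_dist lborel f (U i) + 4 * translation_error (U i) d"
        by (rule translation_error_triangle) auto
      also have "\<dots> \<le> 6 * ennreal (e/12) + 4 * ennreal (e/8)"
        using i d by (intro add_mono mult_left_mono) auto
      also have "\<dots> = ennreal (6 * (e/12) + 4 * (e/8))"
        using e by (subst ennreal_plus) (auto simp: ennreal_mult[symmetric] simp flip: ennreal_numeral)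
      finally show "translation_error f d \<le> ennreal e" by simp
    qed
  qed
qed

section \<open>Densities with integrable Fourier transform\<close>

text \<open>The standard Gaussian density, taken as a product over \<open>Basis\<close> so that its
  Fourier transform is a product of one-dimensional characteristic functions.\<close>

definition gauss_weight :: "'a::euclidean_space \<Rightarrow> real" where
  "gauss_weight z = (\<Prod>b\<in>Basis. std_normal_density (z \<bullet> b))"

lemma gauss_weight_nonneg: "0 \<le> gauss_weight z"
  unfolding gauss_weight_def by (intro prod_nonneg) auto

lemma gauss_weight_le_1: "gauss_weight z \<le> 1"
proof -
  have "std_normal_density x \<le> 1" for x :: real
  proof -
    have "1 \<le> sqrt (2 * pi)" using pi_gt3 by (intro real_le_rsqrt) auto
    then have "1 / sqrt (2 * pi) \<le> 1" by simp
    moreover have "exp (- x\<^sup>2 / 2) \<le> 1" by simp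
    ultimately have "1 / sqrt (2 * pi) * exp (- x\<^sup>2 / 2) \<le> 1 * 1" by (intro mult_mono) auto
    then show ?thesis by (simp add: std_normal_density_def)
  qed
  then show ?thesis unfolding gauss_weight_def by (intro prod_le_1) auto
qed

lemma gauss_weight_measurable [measurable]: "gauss_weight \<in> borel_measurable borel"
  unfolding gauss_weight_def[abs_def] by measurable

interpretation lborel_product: product_sigma_finite "\<lambda>b::'a::euclidean_space. lborel :: real measure"
  by standard

lemma inner_sum_Basis: "b \<in> Basis \<Longrightarrow> (\<Sum>c\<in>Basis. f c *\<^sub>R c) \<bullet> b = f (b :: 'a::euclidean_space)"
  by (simp add: inner_sum_left_Basis)

text \<open>\<open>lborel\<close> is the image of the product measure over \<open>Basis\<close>
  under the coordinate map, so an integral of a product of one-coordinate functions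
  factorises.\<close>

lemma integral_prod_Basis:
  fixes f :: "'a::euclidean_space \<Rightarrow> real \<Rightarrow> complex"
  assumes f: "\<And>b. b \<in> Basis \<Longrightarrow> integrable lborel (f b)"
  shows "integrable lborel (\<lambda>z. \<Prod>b\<in>Basis. f b (z \<bullet> b))"
    and "(LINT z|lborel. (\<Prod>b\<in>Basis. f b (z \<bullet> b))) = (\<Prod>b\<in>Basis. (LINT x|lborel. f b x))"
proof -
  let ?S = "\<lambda>h. \<Sum>b\<in>(Basis :: 'a set). h b *\<^sub>R b"
  have [measurable]: "f b \<in> borel_measurable borel" if "b \<in> Basis" for b
    using f[OF that] by auto
  have S [measurable]: "?S \<in> measurable (\<Pi>\<^sub>M b\<in>Basis. lborel) borel" by measurable
  have F: "(\<lambda>z::'a. \<Prod>b\<in>Basis. f b (z \<bullet> b)) \<in> borel_measurable borel"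
    by (intro borel_measurable_prod) measurable
  have eq: "(\<lambda>h. \<Prod>b\<in>Basis. f b (?S h \<bullet> b)) = (\<lambda>h. \<Prod>b\<in>Basis. f b (h b))"
    by (intro ext prod.cong) (simp_all add: inner_sum_Basis)
  show "integrable lborel (\<lambda>z. \<Prod>b\<in>Basis. f b (z \<bullet> b))"
    unfolding lborel_eq[where 'a = 'a] integrable_distr_eq[OF S F] eq
    by (intro lborel_product.product_integrable_prod f) auto
  show "(LINT z|lborel. (\<Prod>b\<in>Basis. f b (z \<bullet> b))) = (\<Prod>b\<in>Basis. (LINT x|lborel. f b x))"
    unfolding lborel_eq[where 'a = 'a] integral_distr[OF S F] eq
    by (intro lborel_product.product_integral_prod f) auto
qed

lemma std_normal_fourier:
  "integrable lborel (\<lambda>x. complex_of_real (std_normal_density x) * iexp (t * x))"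
  "(LINT x|lborel. complex_of_real (std_normal_density x) * iexp (t * x)) = complex_of_real (exp (- t\<^sup>2 / 2))"
proof -
  show "integrable lborel (\<lambda>x. complex_of_real (std_normal_density x) * iexp (t * x))"
    by (rule Bochner_Integration.integrable_bound[OF integrable_normal_density[of 1 0]]) (auto simp: norm_mult)
  have "complex_of_real (exp (- t\<^sup>2 / 2)) = char std_normal_distribution t"
    by (simp add: char_std_normal_distribution)
  also have "\<dots> = (LINT x|lborel. std_normal_density x *\<^sub>R iexp (t * x))"
    unfolding char_def by (rule integral_density) auto
  finally show "(LINT x|lborel. complex_of_real (std_normal_density x) * iexp (t * x)) = complex_of_real (exp (- t\<^sup>2 / 2))"
    by (simp add: scaleR_conv_of_real)
qed

lemma gauss_weight_fourier:
  fixes w :: "'a::euclidean_space"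
  shows "integrable lborel (\<lambda>z. complex_of_real (gauss_weight z) * iexp (w \<bullet> z))"
    and "(LINT z|lborel. complex_of_real (gauss_weight z) * iexp (w \<bullet> z)) = complex_of_real (exp (- (norm w)\<^sup>2 / 2))"
proof -
  let ?f = "\<lambda>b x. complex_of_real (std_normal_density x) * iexp ((w \<bullet> b) * x)"
  have eq: "(\<lambda>z::'a. \<Prod>b\<in>Basis. ?f b (z \<bullet> b)) = (\<lambda>z. complex_of_real (gauss_weight z) * iexp (w \<bullet> z))"
  proof
    fix z :: 'a
    have "(\<Prod>b\<in>Basis. iexp ((w \<bullet> b) * (z \<bullet> b))) = iexp (w \<bullet> z)"
      by (subst euclidean_inner[of w z]) (simp add: exp_sum[symmetric] sum_distrib_left)
    then show "(\<Prod>b\<in>Basis. ?f b (z \<bullet> b)) = complex_of_real (gauss_weight z) * iexp (w \<bullet> z)"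
      by (simp add: prod.distrib gauss_weight_def)
  qed
  show "integrable lborel (\<lambda>z. complex_of_real (gauss_weight z) * iexp (w \<bullet> z))"
    using integral_prod_Basis(1)[of ?f] std_normal_fourier(1) unfolding eq by blast
  have "(\<Prod>b\<in>(Basis :: 'a set). complex_of_real (exp (- (w \<bullet> b)\<^sup>2 / 2))) = complex_of_real (exp (\<Sum>b\<in>(Basis :: 'a set). - (w \<bullet> b)\<^sup>2 / 2))"
    by (simp add: exp_sum)
  also have "(\<Sum>b\<in>(Basis :: 'a set). - (w \<bullet> b)\<^sup>2 / 2) = - (norm w)\<^sup>2 / 2"
    unfolding power2_norm_eq_inner euclidean_inner[of w w] by (simp add: sum_negf sum_divide_distrib power2_eq_square)
  finally show "(LINT z|lborel. complex_of_real (gauss_weight z) * iexp (w \<bullet> z)) = complex_of_real (exp (- (norm w)\<^sup>2 / 2))"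
    using integral_prod_Basis(2)[of ?f] std_normal_fourier unfolding eq by simp
qed

section \<open>From an integrable Fourier transform to a bound on the density\<close>

lemma scale_nn_integral:
  fixes f :: "'a::euclidean_space \<Rightarrow> ennreal"
  assumes [measurable]: "f \<in> borel_measurable borel" and c: "0 < c"
  shows "(\<integral>\<^sup>+x. f x \<partial>lborel) = ennreal (c ^ DIM('a)) * (\<integral>\<^sup>+x. f (c *\<^sub>R x) \<partial>lborel)"
proof -
  have "(\<integral>\<^sup>+x. f x \<partial>lborel) = (\<integral>\<^sup>+x. f x \<partial>density (distr lborel borel (\<lambda>x::'a. 0 + c *\<^sub>R x)) (\<lambda>_. \<bar>c\<bar>^DIM('a)))"
    using lborel_affine[of c "0::'a"] c by simp
  also have "\<dots> = (\<integral>\<^sup>+x. ennreal (c^DIM('a)) * f x \<partial>distr lborel borel (\<lambda>x::'a. c *\<^sub>R x))"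
    using c by (subst nn_integral_density) auto
  also have "\<dots> = ennreal (c ^ DIM('a)) * (\<integral>\<^sup>+x. f x \<partial>distr lborel borel (\<lambda>x::'a. c *\<^sub>R x))"
    by (rule nn_integral_cmult) simp
  also have "(\<integral>\<^sup>+x. f x \<partial>distr lborel borel (\<lambda>x::'a. c *\<^sub>R x)) = (\<integral>\<^sup>+x. f (c *\<^sub>R x) \<partial>lborel)"
    by (rule nn_integral_distr) auto
  finally show ?thesis .
qed

text \<open>Fourier inversion tested against a Gaussian. The bump
  \<open>exp (- (norm (?w y))\<^sup>2 / 2)\<close> is itself the Fourier transform of
  \<open>gauss_weight\<close>, so Fubini moves the oscillation onto f and produces \<phi> at z / e.
  Dropping the phase and the weight leaves \<open>e ^ DIM('a) * L\<close>, which scales like the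
  volume of the ball.\<close>

lemma fourier_ball_bound:
  fixes f :: "'a::euclidean_space \<Rightarrow> real"
  assumes f: "integrable lborel f" "\<And>x. 0 \<le> f x"
    and F: "\<And>\<xi>. (CLINT x|lborel. complex_of_real (f x) * iexp (\<xi> \<bullet> x)) = complex_of_real (\<phi> \<xi>)"
    and \<phi>: "\<And>\<xi>. 0 \<le> \<phi> \<xi>" "\<phi> \<in> borel_measurable borel" "(\<integral>\<^sup>+\<xi>. ennreal (\<phi> \<xi>) \<partial>lborel) \<le> ennreal L" "0 \<le> L"
    and e: "0 < e"
  shows "(\<integral>\<^sup>+y. ennreal (f y) * indicator (ball x e) y \<partial>lborel) \<le> ennreal (exp (1/2) * L * e ^ DIM('a))"
proof -
  note [measurable] = \<phi>(2) borel_measurable_integrable[OF f(1)]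
  let ?w = "\<lambda>y. (1/e) *\<^sub>R (y - x)"
  let ?H = "\<lambda>y z. complex_of_real (f y) * (complex_of_real (gauss_weight z) * iexp (?w y \<bullet> z))"
  have gi: "integrable lborel (gauss_weight :: 'a \<Rightarrow> real)"
    using integrable_norm[OF gauss_weight_fourier(1)[of "0::'a"]] by (simp add: abs_of_nonneg[OF gauss_weight_nonneg])
  have int: "integrable (lborel \<Otimes>\<^sub>M lborel) (case_prod ?H)"
  proof (rule lborel_pair.Fubini_integrable)
    show "case_prod ?H \<in> borel_measurable (lborel \<Otimes>\<^sub>M lborel)" by measurable
    have "integrable lborel (\<lambda>y. f y * (LINT z|lborel. gauss_weight (z::'a)))" using f(1) by simp
    then show "integrable lborel (\<lambda>y. LINT z|lborel. norm (case (y, z) of (y, z) \<Rightarrow> ?H y z))"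
      using f gauss_weight_nonneg by (simp add: norm_mult abs_of_nonneg[OF gauss_weight_nonneg])
    show "AE y in lborel. integrable lborel (\<lambda>z. case (y, z) of (y, z) \<Rightarrow> ?H y z)"
    proof (rule AE_I2)
      fix y
      have "integrable lborel (?H y)" by (rule integrable_mult_right[OF gauss_weight_fourier(1)])
      then show "integrable lborel (\<lambda>z. case (y, z) of (y, z) \<Rightarrow> ?H y z)" by simp
    qed
  qed
  have "complex_of_real (LINT y|lborel. f y * exp (- (norm (?w y))\<^sup>2 / 2)) = (LINT y|lborel. (LINT z|lborel. ?H y z))"
  proof -
    have "(LINT z|lborel. ?H y z) = complex_of_real (f y * exp (- (norm (?w y))\<^sup>2 / 2))" for y
      by (simp only: integral_mult_right_zero gauss_weight_fourier(2) of_real_mult)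
    then show ?thesis by (simp only: integral_complex_of_real)
  qed
  also have "\<dots> = (LINT z|lborel. (LINT y|lborel. ?H y z))"
    by (rule lborel_pair.Fubini_integral[OF int, symmetric])
  also have "\<dots> = (LINT z|lborel. complex_of_real (gauss_weight z) * (iexp (- (x \<bullet> z) / e) * complex_of_real (\<phi> ((1/e) *\<^sub>R z))))"
  proof (rule Bochner_Integration.integral_cong)
    fix z :: 'a
    have Heq: "?H y z = (complex_of_real (gauss_weight z) * iexp (- (x \<bullet> z) / e)) * (complex_of_real (f y) * iexp (((1/e) *\<^sub>R z) \<bullet> y))" for y
    proof -
      have "?w y \<bullet> z = - (x \<bullet> z) / e + ((1/e) *\<^sub>R z) \<bullet> y"
        by (simp add: inner_diff_left inner_commute[of z] diff_divide_distrib)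
      then have "iexp (?w y \<bullet> z) = iexp (- (x \<bullet> z) / e) * iexp (((1/e) *\<^sub>R z) \<bullet> y)"
        by (simp only: of_real_add distrib_left exp_add)
      then show ?thesis by (simp only: mult_ac)
    qed
    show "(LINT y|lborel. ?H y z) = complex_of_real (gauss_weight z) * (iexp (- (x \<bullet> z) / e) * complex_of_real (\<phi> ((1/e) *\<^sub>R z)))"
      by (simp only: Heq integral_mult_right_zero F mult.assoc)
  qed simp
  finally have eq: "complex_of_real (LINT y|lborel. f y * exp (- (norm (?w y))\<^sup>2 / 2)) = \<dots>" .
  have i1: "integrable lborel (\<lambda>y. f y * exp (- (norm (?w y))\<^sup>2 / 2))"
    by (rule Bochner_Integration.integrable_bound[OF f(1)]) (auto simp: f(2) abs_mult mult_left_le)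
  have "(\<integral>\<^sup>+y. ennreal (f y * exp (- (norm (?w y))\<^sup>2 / 2)) \<partial>lborel) = ennreal (LINT y|lborel. f y * exp (- (norm (?w y))\<^sup>2 / 2))"
    using f(2) by (intro nn_integral_eq_integral i1) auto
  also have "\<dots> \<le> ennreal (norm (complex_of_real (LINT y|lborel. f y * exp (- (norm (?w y))\<^sup>2 / 2))))"
    by (intro ennreal_leI) simp
  also have "\<dots> \<le> (\<integral>\<^sup>+z. ennreal (\<phi> ((1/e) *\<^sub>R z)) \<partial>(lborel :: 'a measure))"
  proof (cases "integrable lborel (\<lambda>z::'a. complex_of_real (gauss_weight z) * (iexp (- (x \<bullet> z) / e) * complex_of_real (\<phi> ((1/e) *\<^sub>R z))))")
    case True
    have "ennreal (norm (complex_of_real (LINT y|lborel. f y * exp (- (norm (?w y))\<^sup>2 / 2)))) \<le>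
      (\<integral>\<^sup>+z. ennreal (norm (complex_of_real (gauss_weight z) * (iexp (- (x \<bullet> z) / e) * complex_of_real (\<phi> ((1/e) *\<^sub>R z))))) \<partial>lborel)"
      unfolding eq by (rule integral_norm_bound_ennreal[OF True])
    also have "\<dots> \<le> (\<integral>\<^sup>+z. ennreal (\<phi> ((1/e) *\<^sub>R z)) \<partial>lborel)"
      using \<phi>(1) gauss_weight_nonneg gauss_weight_le_1
      by (intro nn_integral_mono ennreal_leI) (auto simp: norm_mult abs_of_nonneg[OF gauss_weight_nonneg] intro!: mult_left_le_one_le)
    finally show ?thesis .
  next
    \<comment> \<open>Without integrability the Bochner integral on the right of \<open>eq\<close>
      is 0 by convention, and the bound is trivial.\<close>
    case False
    then show ?thesis unfolding eq by (simp add: not_integrable_integral_eq)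
  qed
  also have "\<dots> = ennreal (e ^ DIM('a)) * (\<integral>\<^sup>+z. ennreal (\<phi> ((1/e) *\<^sub>R (e *\<^sub>R z))) \<partial>(lborel :: 'a measure))"
    by (rule scale_nn_integral[OF _ e]) measurable
  also have "\<dots> \<le> ennreal (e ^ DIM('a)) * ennreal L"
    using e \<phi>(3) by (intro mult_left_mono) auto
  finally have *: "(\<integral>\<^sup>+y. ennreal (f y * exp (- (norm (?w y))\<^sup>2 / 2)) \<partial>lborel) \<le> ennreal (e ^ DIM('a)) * ennreal L" .
  have "(\<integral>\<^sup>+y. ennreal (f y) * indicator (ball x e) y \<partial>lborel) \<le> (\<integral>\<^sup>+y. ennreal (exp (1/2)) * ennreal (f y * exp (- (norm (?w y))\<^sup>2 / 2)) \<partial>lborel)"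
  proof (rule nn_integral_mono)
    fix y
    show "ennreal (f y) * indicator (ball x e) y \<le> ennreal (exp (1/2)) * ennreal (f y * exp (- (norm (?w y))\<^sup>2 / 2))"
    proof (cases "y \<in> ball x e")
      case True
      \<comment> \<open>On the ball the bump is at least \<open>exp (- 1 / 2)\<close>, whence the
        factor \<open>exp (1/2)\<close>.\<close>
      then have "norm (?w y) \<le> 1" using e by (simp add: dist_norm norm_minus_commute)
      then have "(norm (?w y))\<^sup>2 \<le> 1" by (simp add: power_le_one)
      then have "1 \<le> exp (1/2) * exp (- (norm (?w y))\<^sup>2 / 2)" by (simp add: exp_add[symmetric])
      from mult_left_mono[OF this f(2)[of y]]
      have "f y \<le> exp (1/2) * (f y * exp (- (norm (?w y))\<^sup>2 / 2))" by (simp add: mult_ac)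
      then show ?thesis using True by (simp add: ennreal_mult'[symmetric] ennreal_leI)
    qed simp
  qed
  also have "\<dots> = ennreal (exp (1/2)) * (\<integral>\<^sup>+y. ennreal (f y * exp (- (norm (?w y))\<^sup>2 / 2)) \<partial>lborel)"
    by (rule nn_integral_cmult) measurable
  also have "\<dots> \<le> ennreal (exp (1/2)) * (ennreal (e ^ DIM('a)) * ennreal L)" by (intro mult_left_mono *) auto
  also have "\<dots> = ennreal (exp (1/2) * L * e ^ DIM('a))"
    using e \<phi>(4) by (simp add: ennreal_mult[symmetric] mult_ac)
  finally show ?thesis .
qed

text \<open>A bound on the averages over all balls is transferred to open sets by averaging over the centre
  (Fatou), then to Borel sets by outer regularity, so that no differentiation theorem is needed.\<close>

lemma ball_bound_imp_open_bound:
  fixes f :: "'a::euclidean_space \<Rightarrow> real"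
  assumes f [measurable]: "f \<in> borel_measurable borel"
    and ball: "\<And>x e. 0 < e \<Longrightarrow> (\<integral>\<^sup>+y. ennreal (f y) * indicator (ball x e) y \<partial>lborel) \<le> ennreal C * emeasure lborel (ball x e)"
    and A: "open A"
  shows "(\<integral>\<^sup>+y. ennreal (f y) * indicator A y \<partial>lborel) \<le> ennreal C * emeasure lborel A"
proof -
  have [measurable]: "A \<in> sets borel" using A by simp
  define V where "V e = emeasure lborel (ball (0::'a) e)" for e
  have Vx: "emeasure lborel (ball x e) = V e" if "0 < e" for x :: 'a and e
    unfolding V_def using that by (simp add: emeasure_ball)
  have V: "V e \<noteq> 0" "V e \<noteq> \<infinity>" if "0 < e" for e
  proof -
    have "unit_ball_vol (real DIM('a)) \<noteq> 0"
      using unit_ball_vol_pos[of "real DIM('a)"] by (metis less_irrefl of_nat_0_le_iff)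
    then show "V e \<noteq> 0" "V e \<noteq> \<infinity>"
      unfolding V_def using that by (simp_all add: emeasure_ball less_le)
  qed
  define r where "r n = 1 / real (Suc n)" for n
  have r: "0 < r n" for n by (simp add: r_def)
  \<comment> \<open>Tonelli turns the integral over y of the volumes of
    \<open>A \<inter> ball y (r n)\<close> into an integral over the centres x in A of the mass of f
    on \<open>ball x (r n)\<close>, where the hypothesis applies.\<close>
  have avg: "(\<integral>\<^sup>+y. ennreal (f y) * (emeasure lborel (A \<inter> ball y (r n)) / V (r n)) \<partial>lborel) \<le> ennreal C * emeasure lborel A" for n
  proof -
    let ?g = "\<lambda>x y. ennreal (f y) * (indicator A x * (if dist x y < r n then 1 else 0))"
    have "(\<integral>\<^sup>+y. ennreal (f y) * emeasure lborel (A \<inter> ball y (r n)) \<partial>lborel) = (\<integral>\<^sup>+y. (\<integral>\<^sup>+x. ?g x y \<partial>lborel) \<partial>lborel)"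
    proof (rule nn_integral_cong)
      fix y :: 'a
      have "(\<integral>\<^sup>+x. ?g x y \<partial>lborel) = ennreal (f y) * (\<integral>\<^sup>+x. indicator A x * (if dist x y < r n then 1 else 0) \<partial>lborel)"
        by (rule nn_integral_cmult) measurable
      also have "(\<integral>\<^sup>+x. indicator A x * (if dist x y < r n then 1 else 0) \<partial>lborel) = (\<integral>\<^sup>+x. indicator (A \<inter> ball y (r n)) x \<partial>(lborel :: 'a measure))"
        by (intro nn_integral_cong) (auto simp: indicator_def dist_commute)
      finally show "ennreal (f y) * emeasure lborel (A \<inter> ball y (r n)) = (\<integral>\<^sup>+x. ?g x y \<partial>lborel)" by simp
    qed
    also have "\<dots> = (\<integral>\<^sup>+x. (\<integral>\<^sup>+y. ?g x y \<partial>lborel) \<partial>lborel)"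
      by (rule lborel_pair.Fubini') measurable
    also have "\<dots> \<le> (\<integral>\<^sup>+x. (ennreal C * V (r n)) * indicator A x \<partial>(lborel :: 'a measure))"
    proof (rule nn_integral_mono)
      fix x :: 'a
      have [measurable]: "ball x (r n) \<in> sets borel" by simp
      have "(\<integral>\<^sup>+y. ?g x y \<partial>lborel) = (\<integral>\<^sup>+y. indicator A x * (ennreal (f y) * indicator (ball x (r n)) y) \<partial>lborel)"
        by (intro nn_integral_cong) (auto simp: indicator_def)
      also have "\<dots> = indicator A x * (\<integral>\<^sup>+y. ennreal (f y) * indicator (ball x (r n)) y \<partial>lborel)"
        by (rule nn_integral_cmult) measurable
      also have "\<dots> \<le> indicator A x * (ennreal C * V (r n))"
        using ball[OF r, of x n] Vx[OF r, of x n] by (intro mult_left_mono) auto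
      finally show "(\<integral>\<^sup>+y. ?g x y \<partial>lborel) \<le> (ennreal C * V (r n)) * indicator A x" by (simp add: mult.commute)
    qed
    also have "\<dots> = (ennreal C * V (r n)) * emeasure lborel A" by (rule nn_integral_cmult_indicator) simp
    finally have 1: "(\<integral>\<^sup>+y. ennreal (f y) * emeasure lborel (A \<inter> ball y (r n)) \<partial>lborel) \<le> (ennreal C * V (r n)) * emeasure lborel A" .
    have m [measurable]: "(\<lambda>y. emeasure lborel (A \<inter> ball y (r n))) \<in> borel_measurable borel"
    proof -
      have "(\<lambda>y::'a. \<integral>\<^sup>+x. indicator A x * (if dist x y < r n then 1 else 0) \<partial>lborel) \<in> borel_measurable borel" by measurable
      also have "(\<lambda>y::'a. \<integral>\<^sup>+x. indicator A x * (if dist x y < r n then 1 else 0) \<partial>lborel) = (\<lambda>y. \<integral>\<^sup>+x. indicator (A \<inter> ball y (r n)) x \<partial>lborel)"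
        by (intro ext nn_integral_cong) (auto simp: indicator_def dist_commute)
      finally show ?thesis by simp
    qed
    have "(\<integral>\<^sup>+y. ennreal (f y) * (emeasure lborel (A \<inter> ball y (r n)) / V (r n)) \<partial>lborel) = (\<integral>\<^sup>+y. (ennreal (f y) * emeasure lborel (A \<inter> ball y (r n))) / V (r n) \<partial>lborel)"
      by (simp add: ennreal_times_divide)
    also have "\<dots> = (\<integral>\<^sup>+y. ennreal (f y) * emeasure lborel (A \<inter> ball y (r n)) \<partial>lborel) / V (r n)"
      by (rule nn_integral_divide) measurable
    also have "\<dots> \<le> ((ennreal C * V (r n)) * emeasure lborel A) / V (r n)"
      by (rule divide_right_mono_ennreal[OF 1])
    also have "\<dots> = ennreal C * emeasure lborel A"
    proof -
      have "((ennreal C * V (r n)) * emeasure lborel A) / V (r n) = (ennreal C * emeasure lborel A) * V (r n) / V (r n)"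
        by (simp add: mult_ac)
      also have "\<dots> = ennreal C * emeasure lborel A"
        using V[OF r, of n] by (simp add: ennreal_mult_divide_eq)
      finally show ?thesis .
    qed
    finally show ?thesis .
  qed
  \<comment> \<open>Openness of A: as soon as \<open>ball y (r n)\<close> lies in A, the quotient of
    volumes is 1.\<close>
  have lim: "ennreal (f y) * indicator A y \<le> liminf (\<lambda>n. ennreal (f y) * (emeasure lborel (A \<inter> ball y (r n)) / V (r n)))" for y
  proof (cases "y \<in> A")
    case True
    then obtain e where e: "0 < e" "ball y e \<subseteq> A" using A open_contains_ball by blast
    obtain n0 where n0: "r n0 < e" using reals_Archimedean[OF e(1)] by (auto simp: r_def inverse_eq_divide)
    have "ennreal (f y) * (emeasure lborel (A \<inter> ball y (r n)) / V (r n)) = ennreal (f y)" if "n \<ge> n0" for n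
    proof -
      have "r n \<le> r n0" using that by (simp add: r_def frac_le)
      then have "A \<inter> ball y (r n) = ball y (r n)" using n0 e(2) by force
      then show ?thesis using Vx[OF r, of y n] V[OF r, of n] by (simp add: ennreal_divide_self less_top)
    qed
    then have "\<forall>\<^sub>F n in sequentially. ennreal (f y) \<le> ennreal (f y) * (emeasure lborel (A \<inter> ball y (r n)) / V (r n))"
      unfolding eventually_sequentially by (intro exI[of _ n0]) auto
    then have "ennreal (f y) \<le> liminf (\<lambda>n. ennreal (f y) * (emeasure lborel (A \<inter> ball y (r n)) / V (r n)))"
      by (rule Liminf_bounded)
    then show ?thesis using True by simp
  qed simp
  have "(\<integral>\<^sup>+y. ennreal (f y) * indicator A y \<partial>lborel) \<le> (\<integral>\<^sup>+y. liminf (\<lambda>n. ennreal (f y) * (emeasure lborel (A \<inter> ball y (r n)) / V (r n))) \<partial>lborel)"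
    by (intro nn_integral_mono lim)
  also have "\<dots> \<le> liminf (\<lambda>n. \<integral>\<^sup>+y. ennreal (f y) * (emeasure lborel (A \<inter> ball y (r n)) / V (r n)) \<partial>lborel)"
  proof (rule nn_integral_liminf)
    fix n
    have "(\<lambda>y::'a. \<integral>\<^sup>+x. indicator A x * (if dist x y < r n then 1 else 0) \<partial>lborel) \<in> borel_measurable borel" by measurable
    also have "(\<lambda>y::'a. \<integral>\<^sup>+x. indicator A x * (if dist x y < r n then 1 else 0) \<partial>lborel) = (\<lambda>y. \<integral>\<^sup>+x. indicator (A \<inter> ball y (r n)) x \<partial>lborel)"
      by (intro ext nn_integral_cong) (auto simp: indicator_def dist_commute)
    finally have [measurable]: "(\<lambda>y. emeasure lborel (A \<inter> ball y (r n))) \<in> borel_measurable borel" by simp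
    show "(\<lambda>y. ennreal (f y) * (emeasure lborel (A \<inter> ball y (r n)) / V (r n))) \<in> borel_measurable lborel" by measurable
  qed
  also have "\<dots> \<le> liminf (\<lambda>n. ennreal C * emeasure lborel A)"
    by (intro Liminf_mono always_eventually allI avg)
  also have "\<dots> = ennreal C * emeasure lborel A" by (simp add: Liminf_const)
  finally show ?thesis .
qed

lemma ball_bound_imp_AE_le:
  fixes f :: "'a::euclidean_space \<Rightarrow> real"
  assumes f [measurable]: "f \<in> borel_measurable borel" and C: "0 \<le> C"
    and ball: "\<And>x e. 0 < e \<Longrightarrow> (\<integral>\<^sup>+y. ennreal (f y) * indicator (ball x e) y \<partial>lborel) \<le> ennreal C * emeasure lborel (ball x e)"
  shows "AE x in lborel. f x \<le> C"
proof -
  have bd: "(\<integral>\<^sup>+y. ennreal (f y) * indicator A y \<partial>lborel) \<le> ennreal C * emeasure lborel A" if A [measurable]: "A \<in> sets borel" for A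
  proof (rule ennreal_le_epsilon)
    fix e :: real assume e: "0 < e"
    \<comment> \<open>The denominator C + 1 instead of C also covers C = 0.\<close>
    have "0 < e / (C + 1)" using e C by simp
    then obtain U where U: "open U" "A \<subseteq> U" "emeasure lborel (U - A) < ennreal (e / (C + 1))"
      using outer_regular_lborel[OF A] by blast
    have [measurable]: "U \<in> sets borel" using U(1) by simp
    have "(\<integral>\<^sup>+y. ennreal (f y) * indicator A y \<partial>lborel) \<le> (\<integral>\<^sup>+y. ennreal (f y) * indicator U y \<partial>lborel)"
      using U(2) by (intro nn_integral_mono) (auto simp: indicator_def)
    also have "\<dots> \<le> ennreal C * emeasure lborel U" by (rule ball_bound_imp_open_bound[OF f ball U(1)])
    also have "emeasure lborel U = emeasure lborel (A \<union> (U - A))" using U(2) by (simp add: Un_absorb1)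
    also have "\<dots> = emeasure lborel A + emeasure lborel (U - A)" by (rule plus_emeasure[symmetric]) auto
    also have "ennreal C * \<dots> \<le> ennreal C * (emeasure lborel A + ennreal (e / (C + 1)))"
      using U(3) by (intro mult_left_mono add_left_mono) auto
    also have "\<dots> = ennreal C * emeasure lborel A + ennreal (C * (e / (C + 1)))"
    proof -
      have "ennreal C * ennreal (e / (C + 1)) = ennreal (C * (e / (C + 1)))"
        using C e by (intro ennreal_mult[symmetric]) auto
      then show ?thesis by (simp only: distrib_left)
    qed
    also have "\<dots> \<le> ennreal C * emeasure lborel A + ennreal e"
      using C e by (intro add_left_mono ennreal_leI) (simp add: field_simps)
    finally show "(\<integral>\<^sup>+y. ennreal (f y) * indicator A y \<partial>lborel) \<le> ennreal C * emeasure lborel A + ennreal e" .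
  qed
  \<comment> \<open>Cutting with \<open>cball 0 (real n)\<close> makes the measure a of the set
    finite, so that \<open>(C + 1 / real (Suc n)) * a \<le> C * a\<close> forces a = 0.\<close>
  have null: "emeasure lborel {x \<in> cball 0 (real n). C + 1 / real (Suc n) \<le> f x} = 0" for n
  proof (rule ccontr)
    let ?A = "{x \<in> cball 0 (real n). C + 1 / real (Suc n) \<le> f x}"
    assume nz: "emeasure lborel ?A \<noteq> 0"
    have [measurable]: "?A \<in> sets borel" by measurable
    have "emeasure lborel ?A \<le> emeasure lborel (cball (0::'a) (real n))" by (rule emeasure_mono) auto
    also have "\<dots> < \<infinity>" by (simp add: emeasure_cball)
    finally have fin: "emeasure lborel ?A < \<infinity>" .
    then obtain a where a: "0 \<le> a" "emeasure lborel ?A = ennreal a" by (cases "emeasure lborel ?A" rule: ennreal_cases) auto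
    have "ennreal (C + 1 / real (Suc n)) * emeasure lborel ?A = (\<integral>\<^sup>+y. ennreal (C + 1 / real (Suc n)) * indicator ?A y \<partial>lborel)"
      by (rule nn_integral_cmult_indicator[symmetric]) simp
    also have "\<dots> \<le> (\<integral>\<^sup>+y. ennreal (f y) * indicator ?A y \<partial>lborel)"
      by (intro nn_integral_mono) (auto simp: indicator_def ennreal_leI)
    also have "\<dots> \<le> ennreal C * emeasure lborel ?A" by (rule bd) simp
    finally have "ennreal (C + 1 / real (Suc n)) * ennreal a \<le> ennreal C * ennreal a" unfolding a(2) .
    moreover have "b * a \<le> C * a" if "ennreal b * ennreal a \<le> ennreal C * ennreal a" "0 \<le> b" for b
      using that a(1) C by (simp add: ennreal_mult[symmetric] ennreal_le_iff)
    ultimately have "(C + 1 / real (Suc n)) * a \<le> C * a" using C by simp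
    then have "1 / real (Suc n) * a \<le> 0" unfolding distrib_right by linarith
    then have "a \<le> 0" by (simp add: divide_le_0_iff)
    then show False using nz a by simp
  qed
  have "AE x in lborel. \<forall>n. x \<notin> {x \<in> cball 0 (real n). C + 1 / real (Suc n) \<le> f x}"
    unfolding AE_all_countable by (intro allI AE_not_in null_setsI null) measurable
  then show ?thesis
  proof eventually_elim
    fix x assume x: "\<forall>n. x \<notin> {x \<in> cball 0 (real n). C + 1 / real (Suc n) \<le> f x}"
    show "f x \<le> C"
    proof (rule ccontr)
      assume "\<not> f x \<le> C"
      then have "0 < f x - C" by simp
      then obtain n1 where n1: "inverse (real (Suc n1)) < f x - C" using reals_Archimedean by blast
      obtain n2 :: nat where n2: "norm x \<le> real n2" using real_arch_simple by blast
      let ?n = "max n1 n2"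
      have "1 / real (Suc ?n) \<le> inverse (real (Suc n1))" by (simp add: inverse_eq_divide frac_le)
      then have "C + 1 / real (Suc ?n) \<le> f x" using n1 by simp
      moreover have "x \<in> cball 0 (real ?n)" using n2 by (simp add: dist_norm)
      ultimately show False using x by blast
    qed
  qed
qed

section \<open>The kernel\<close>

text \<open>Layer cake: \<open>exp (- v)\<close> is the integral of \<open>exp (- u)\<close> over u
  \<ge> v, and the order of integration is exchanged. The set where
  \<open>\<tau> * norm \<xi> powr \<alpha> \<le> u\<close> lies in a ball of radius
  \<open>(u / \<tau>) powr (1 / \<alpha>)\<close>, and integrating the volume of this ball against
  \<open>exp (- u)\<close> gives a Gamma integral.\<close>

lemma stable_fourier_integral:
  assumes \<alpha>: "0 < \<alpha>" and \<tau>: "0 < \<tau>"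
  shows "(\<integral>\<^sup>+\<xi>. ennreal (exp (- \<tau> * norm (\<xi> :: 'a::euclidean_space) powr \<alpha>)) \<partial>lborel)
     \<le> ennreal (unit_ball_vol (real DIM('a)) * Gamma (real DIM('a) / \<alpha> + 1) * \<tau> powr (- (real DIM('a) / \<alpha>)))"
proof -
  let ?V = "unit_ball_vol (real DIM('a))" and ?k = "real DIM('a) / \<alpha>"
  have k: "0 \<le> ?k" using \<alpha> by simp
  have e: "ennreal (exp (- v)) = (\<integral>\<^sup>+u. ennreal (exp (- u)) * indicator {v..} u \<partial>lborel)" for v :: real
  proof -
    have "(\<integral>\<^sup>+u. ennreal (exp (- u)) * indicator {v..} u \<partial>lborel) = ennreal (0 - (- exp (- v)))"
    proof (rule nn_integral_FTC_atLeast)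
      have "((\<lambda>u::real. exp (- u)) \<longlongrightarrow> 0) at_top"
        by (rule filterlim_compose[OF exp_at_bot filterlim_uminus_at_bot_at_top])
      from tendsto_minus[OF this] show "((\<lambda>u::real. - exp (- u)) \<longlongrightarrow> 0) at_top" by simp
    qed (auto intro!: derivative_eq_intros)
    then show ?thesis by simp
  qed
  let ?g = "\<lambda>(\<xi>::'a) (u::real). ennreal (exp (- u)) * (if \<tau> * norm \<xi> powr \<alpha> \<le> u then 1 else 0)"
  have "(\<integral>\<^sup>+\<xi>. ennreal (exp (- \<tau> * norm (\<xi> :: 'a) powr \<alpha>)) \<partial>lborel) = (\<integral>\<^sup>+\<xi>. (\<integral>\<^sup>+u. ?g \<xi> u \<partial>lborel) \<partial>lborel)"
  proof (rule nn_integral_cong)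
    fix \<xi> :: 'a
    have "ennreal (exp (- (\<tau> * norm \<xi> powr \<alpha>))) = (\<integral>\<^sup>+u. ?g \<xi> u \<partial>lborel)"
      by (subst e, intro nn_integral_cong) (auto simp: indicator_def)
    then show "ennreal (exp (- \<tau> * norm \<xi> powr \<alpha>)) = (\<integral>\<^sup>+u. ?g \<xi> u \<partial>lborel)" by simp
  qed
  also have "\<dots> = (\<integral>\<^sup>+u. (\<integral>\<^sup>+\<xi>. ?g \<xi> u \<partial>lborel) \<partial>lborel)"
    by (rule lborel_pair.Fubini'[symmetric]) measurable
  also have "\<dots> \<le> (\<integral>\<^sup>+u. ennreal (?V * \<tau> powr (- ?k)) * ennreal (indicator {0..} u * u powr ((?k + 1) - 1) / exp u) \<partial>lborel)"
  proof (rule nn_integral_mono)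
    fix u :: real
    have "(\<integral>\<^sup>+\<xi>. ?g \<xi> u \<partial>lborel) = ennreal (exp (- u)) * (\<integral>\<^sup>+\<xi>. indicator {\<xi>::'a. \<tau> * norm \<xi> powr \<alpha> \<le> u} \<xi> \<partial>lborel)"
      by (subst nn_integral_cmult[symmetric]) (auto intro!: nn_integral_cong simp: indicator_def)
    also have "(\<integral>\<^sup>+\<xi>. indicator {\<xi>::'a. \<tau> * norm \<xi> powr \<alpha> \<le> u} \<xi> \<partial>lborel) = emeasure lborel {\<xi>::'a. \<tau> * norm \<xi> powr \<alpha> \<le> u}"
      by (rule nn_integral_indicator) measurable
    finally have 1: "(\<integral>\<^sup>+\<xi>. ?g \<xi> u \<partial>lborel) = ennreal (exp (- u)) * emeasure lborel {\<xi>::'a. \<tau> * norm \<xi> powr \<alpha> \<le> u}" .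
    show "(\<integral>\<^sup>+\<xi>. ?g \<xi> u \<partial>lborel) \<le> ennreal (?V * \<tau> powr (- ?k)) * ennreal (indicator {0..} u * u powr ((?k + 1) - 1) / exp u)"
    proof (cases "0 \<le> u")
      case False
      have "0 \<le> \<tau> * norm \<xi> powr \<alpha>" for \<xi> :: 'a using \<tau> by simp
      then have "{\<xi>::'a. \<tau> * norm \<xi> powr \<alpha> \<le> u} = {}" using False by (auto simp: not_le intro: less_le_trans)
      then show ?thesis using 1 by simp
    next
      case True
      define r where "r = (u / \<tau>) powr (1 / \<alpha>)"
      have r: "0 \<le> r" by (simp add: r_def)
      have sub: "{\<xi>::'a. \<tau> * norm \<xi> powr \<alpha> \<le> u} \<subseteq> cball 0 r"
      proof safe
        fix \<xi> :: 'a assume "\<tau> * norm \<xi> powr \<alpha> \<le> u"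
        then have "norm \<xi> powr \<alpha> \<le> u / \<tau>" using \<tau> by (simp add: field_simps)
        then have "(norm \<xi> powr \<alpha>) powr (1 / \<alpha>) \<le> (u / \<tau>) powr (1 / \<alpha>)" using \<alpha> by (intro powr_mono2) auto
        then show "\<xi> \<in> cball 0 r" using \<alpha> by (simp add: powr_powr r_def dist_norm)
      qed
      have "r ^ DIM('a) = (u / \<tau>) powr ?k"
      proof (cases "u = 0")
        case True
        then show ?thesis using \<alpha> by (simp add: r_def)
      next
        case False
        then have "0 < r" using \<open>0 \<le> u\<close> \<tau> by (simp add: r_def)
        then have "r ^ DIM('a) = r powr real DIM('a)" by (simp add: powr_realpow)
        then show ?thesis by (simp add: r_def powr_powr)
      qed
      also have "\<dots> = u powr ?k * \<tau> powr (- ?k)" using True \<tau> by (simp add: powr_divide powr_minus_divide)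
      finally have rd: "r ^ DIM('a) = u powr ?k * \<tau> powr (- ?k)" .
      have "emeasure lborel {\<xi>::'a. \<tau> * norm \<xi> powr \<alpha> \<le> u} \<le> emeasure lborel (cball (0::'a) r)"
        by (rule emeasure_mono[OF sub]) simp
      also have "\<dots> = ennreal (?V * (u powr ?k * \<tau> powr (- ?k)))" using r by (simp add: emeasure_cball rd)
      finally have "(\<integral>\<^sup>+\<xi>. ?g \<xi> u \<partial>lborel) \<le> ennreal (exp (- u)) * ennreal (?V * (u powr ?k * \<tau> powr (- ?k)))"
        unfolding 1 by (intro mult_left_mono) auto
      also have "\<dots> = ennreal (?V * \<tau> powr (- ?k)) * ennreal (indicator {0..} u * u powr ((?k + 1) - 1) / exp u)"
        using True by (simp add: ennreal_mult[symmetric] exp_minus field_simps)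
      finally show ?thesis .
    qed
  qed
  also have "\<dots> = ennreal (?V * \<tau> powr (- ?k)) * (\<integral>\<^sup>+u. ennreal (indicator {0..} u * u powr ((?k + 1) - 1) / exp u) \<partial>lborel)"
    by (rule nn_integral_cmult) measurable
  also have "(\<integral>\<^sup>+u. ennreal (indicator {0..} u * u powr ((?k + 1) - 1) / exp u) \<partial>lborel) = ennreal (Gamma (?k + 1))"
    using k by (intro Gamma_conv_nn_integral_real[symmetric]) auto
  also have "ennreal (?V * \<tau> powr (- ?k)) * ennreal (Gamma (?k + 1)) = ennreal (?V * Gamma (?k + 1) * \<tau> powr (- ?k))"
    using k Gamma_real_pos[of "?k + 1"] by (simp add: ennreal_mult[symmetric] mult_ac)
  finally show ?thesis .
qed

lemma stable_density_mass:
  fixes p :: "real \<Rightarrow> 'a::euclidean_space \<Rightarrow> real"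
  assumes p: "isotropic_stable_density \<alpha> \<nu> p" and s: "0 < s"
  shows "(\<integral>\<^sup>+x. ennreal (p s x) \<partial>lborel) = 1"
proof -
  have ps: "\<And>x. 0 \<le> p s x" "integrable lborel (p s)"
     "(CLINT x|lborel. complex_of_real (p s x) * iexp (0 \<bullet> x)) = complex_of_real (exp (- s * \<nu> * norm (0::'a) powr \<alpha>))"
    using p s unfolding isotropic_stable_density_def by blast+
  have "complex_of_real (LINT x|lborel. p s x) = 1" using ps(3) by simp
  then have "(LINT x|lborel. p s x) = 1" by (simp only: of_real_eq_1_iff)
  then show ?thesis using ps by (simp add: nn_integral_eq_integral)
qed

text \<open>Since \<open>p s\<close> has mass one, its square integral is at most its essential
  supremum, and this is controlled by the integral of the Fourier transform.\<close>

lemma stable_density_square: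
  fixes p :: "real \<Rightarrow> 'a::euclidean_space \<Rightarrow> real"
  assumes p: "isotropic_stable_density \<alpha> \<nu> p" and \<alpha>: "0 < \<alpha>" and \<nu>: "0 < \<nu>"
  obtains C where "0 \<le> C" "\<And>s. 0 < s \<Longrightarrow> (\<integral>\<^sup>+x. ennreal ((p s x)\<^sup>2) \<partial>lborel) \<le> ennreal (C * s powr (- (real DIM('a) / \<alpha>)))"
proof -
  let ?V = "unit_ball_vol (real DIM('a))" and ?k = "real DIM('a) / \<alpha>"
  have V: "0 < ?V" by simp
  have k: "0 \<le> ?k" using \<alpha> by simp
  \<comment> \<open>\<open>C * s powr (- ?k)\<close> is \<open>exp (1/2) * L / ?V\<close>, with L
    the bound on the Fourier integral below; the volume of the unit ball cancels.\<close>
  define C where "C = exp (1/2) * Gamma (?k + 1) * \<nu> powr (- ?k)"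
  have C: "0 \<le> C" unfolding C_def using k Gamma_real_pos[of "?k + 1"] by simp
  have "(\<integral>\<^sup>+x. ennreal ((p s x)\<^sup>2) \<partial>lborel) \<le> ennreal (C * s powr (- ?k))" if s: "0 < s" for s
  proof -
    let ?\<phi> = "\<lambda>\<xi>::'a. exp (- s * \<nu> * norm \<xi> powr \<alpha>)"
    define L where "L = ?V * Gamma (?k + 1) * (s * \<nu>) powr (- ?k)"
    have L: "0 \<le> L" unfolding L_def using k Gamma_real_pos[of "?k + 1"] V by simp
    have ps: "\<And>x. 0 \<le> p s x" "integrable lborel (p s)"
      "\<And>\<xi>. (CLINT x|lborel. complex_of_real (p s x) * iexp (\<xi> \<bullet> x)) = complex_of_real (?\<phi> \<xi>)"
      using p s unfolding isotropic_stable_density_def by blast+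
    note [measurable] = borel_measurable_integrable[OF ps(2)]
    have \<phi>L: "(\<integral>\<^sup>+\<xi>. ennreal (?\<phi> \<xi>) \<partial>lborel) \<le> ennreal L"
      using stable_fourier_integral[OF \<alpha>, of "s * \<nu>", where 'a = 'a] s \<nu> by (simp add: L_def)
    have Ck: "C * s powr (- ?k) = exp (1/2) * L / ?V"
    proof -
      have "exp (1/2) * a * \<nu> powr (- ?k) * s powr (- ?k) = exp (1/2) * (v * a * (s * \<nu>) powr (- ?k)) / v" if "0 < v" for a v :: real
        using that s \<nu> by (simp add: powr_mult field_simps)
      from this[OF V] show ?thesis unfolding C_def L_def .
    qed
    have "AE x in lborel. p s x \<le> C * s powr (- ?k)"
    proof (rule ball_bound_imp_AE_le)
      fix x :: 'a and e :: real assume e: "0 < e"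
      have "(\<integral>\<^sup>+y. ennreal (p s y) * indicator (ball x e) y \<partial>lborel) \<le> ennreal (exp (1/2) * L * e ^ DIM('a))"
        by (rule fourier_ball_bound[OF ps(2,1,3) _ _ \<phi>L L e]) auto
      also have "\<dots> = ennreal (C * s powr (- ?k)) * emeasure lborel (ball x e)"
      proof -
        have "ennreal (exp (1/2) * L * a) = ennreal (exp (1/2) * L / v) * ennreal (v * a)" if "0 < v" "0 \<le> a" for a v :: real
          using that L by (simp add: ennreal_mult[symmetric])
        from this[OF V, of "e ^ DIM('a)"] show ?thesis unfolding Ck using e by (simp add: emeasure_ball)
      qed
      finally show "(\<integral>\<^sup>+y. ennreal (p s y) * indicator (ball x e) y \<partial>lborel) \<le> ennreal (C * s powr (- ?k)) * emeasure lborel (ball x e)" .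
    qed (use C in auto)
    then have "(\<integral>\<^sup>+x. ennreal ((p s x)\<^sup>2) \<partial>lborel) \<le> (\<integral>\<^sup>+x. ennreal (C * s powr (- ?k)) * ennreal (p s x) \<partial>lborel)"
    proof (intro nn_integral_mono_AE, eventually_elim)
      fix x assume "p s x \<le> C * s powr (- ?k)"
      from mult_right_mono[OF this ps(1)[of x]]
      show "ennreal ((p s x)\<^sup>2) \<le> ennreal (C * s powr (- ?k)) * ennreal (p s x)"
        using C ps(1)[of x] by (simp add: ennreal_mult[symmetric] power2_eq_square ennreal_leI)
    qed
    also have "\<dots> = ennreal (C * s powr (- ?k)) * (\<integral>\<^sup>+x. ennreal (p s x) \<partial>lborel)"
      by (rule nn_integral_cmult) measurable
    finally show ?thesis by (simp add: stable_density_mass[OF p s])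
  qed
  with C show thesis by (rule that)
qed

section \<open>Moments of the subordinator and of its inverse\<close>

lemma subordinator_mass:
  assumes g: "stable_subordinator_density \<beta> g"
  shows "(\<integral>\<^sup>+z. ennreal (g z) \<partial>lborel) = 1"
proof -
  have g': "\<And>z. 0 \<le> g z" "integrable lborel g" "(LINT z|lborel. exp (- 0 * z) * g z) = exp (- (0 powr \<beta>))"
    using g unfolding stable_subordinator_density_def by blast+
  then show ?thesis by (simp add: nn_integral_eq_integral)
qed

lemma powr_tail_integral:
  fixes \<delta> a :: real
  assumes "0 < \<delta>" "0 < a"
  shows "(\<integral>\<^sup>+l. ennreal (l powr (- \<delta> - 1)) * indicator {a..} l \<partial>lborel) = ennreal (a powr (- \<delta>) / \<delta>)"
proof -
  have "(\<integral>\<^sup>+l. ennreal (l powr (- \<delta> - 1)) * indicator {a..} l \<partial>lborel) = ennreal (0 - (- (a powr (- \<delta>)) / \<delta>))"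
  proof (rule nn_integral_FTC_atLeast)
    show "((\<lambda>l. - (l powr (- \<delta>)) / \<delta>) has_real_derivative x powr (- \<delta> - 1)) (at x)" if "a \<le> x" for x
      using that assms by (auto intro!: derivative_eq_intros simp: powr_diff)
    have "((\<lambda>l. l powr (- \<delta>)) \<longlongrightarrow> 0) at_top"
      using assms by (intro tendsto_neg_powr) (auto simp: filterlim_ident)
    then have "((\<lambda>l. - (l powr (- \<delta>)) / \<delta>) \<longlongrightarrow> - 0 / \<delta>) at_top"
      by (intro tendsto_divide tendsto_minus tendsto_const) (use assms in auto)
    then show "((\<lambda>l. - (l powr (- \<delta>)) / \<delta>) \<longlongrightarrow> 0) at_top" by simp
  qed auto
  then show ?thesis by simp
qed

text \<open>On \<open>{0<..1}\<close> the integrand is at most \<open>exp 1\<close> times the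
  integrand of the Gamma function.\<close>

lemma powr_unit_integral:
  fixes x :: real
  assumes "0 < x"
  shows "(\<integral>\<^sup>+l. ennreal (l powr (x - 1)) * indicator {0<..1} l \<partial>lborel) \<le> ennreal (exp 1 * Gamma x)"
proof -
  have "(\<integral>\<^sup>+l. ennreal (l powr (x - 1)) * indicator {0<..1} l \<partial>lborel)
     \<le> (\<integral>\<^sup>+l. ennreal (exp 1) * ennreal (indicator {0..} l * l powr (x - 1) / exp l) \<partial>lborel)"
  proof (rule nn_integral_mono)
    fix l :: real
    show "ennreal (l powr (x - 1)) * indicator {0<..1} l \<le> ennreal (exp 1) * ennreal (indicator {0..} l * l powr (x - 1) / exp l)"
    proof (cases "l \<in> {0<..1}")
      case True
      then have "exp l \<le> exp 1" by simp
      then have "l powr (x - 1) * exp l \<le> l powr (x - 1) * exp 1" by (intro mult_left_mono) auto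
      then have "l powr (x - 1) \<le> exp 1 * (l powr (x - 1) / exp l)" by (simp add: field_simps)
      then show ?thesis using True by (simp add: ennreal_mult'[symmetric] ennreal_leI)
    qed simp
  qed
  also have "\<dots> = ennreal (exp 1) * (\<integral>\<^sup>+l. ennreal (indicator {0..} l * l powr (x - 1) / exp l) \<partial>lborel)"
    by (rule nn_integral_cmult) measurable
  also have "\<dots> = ennreal (exp 1 * Gamma x)"
    using Gamma_conv_nn_integral_real[OF assms] Gamma_real_pos[OF assms] by (simp add: ennreal_mult)
  finally show ?thesis .
qed

text \<open>Fractional moments from the Laplace transform, through
  \<open>z powr \<delta> \<le> c * \<integral>\<^sup>+l. (1 - exp (- l * z)) * l powr (- \<delta> - 1)\<close>.\<close>

lemma subordinator_moment:
  assumes g: "stable_subordinator_density \<beta> g" and \<beta>: "0 < \<beta>" and \<delta>: "0 < \<delta>" "\<delta> < \<beta>"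
  obtains m where "0 \<le> m" "(\<integral>\<^sup>+z. ennreal (z powr \<delta> * g z) \<partial>lborel) \<le> ennreal m"
proof -
  have g': "\<And>z. 0 \<le> g z" "\<And>z. z < 0 \<Longrightarrow> g z = 0" "integrable lborel g"
     "\<And>l. 0 \<le> l \<Longrightarrow> (LINT z|lborel. exp (- l * z) * g z) = exp (- (l powr \<beta>))"
    using g unfolding stable_subordinator_density_def by blast+
  note [measurable] = borel_measurable_integrable[OF g'(3)]
  have int_g: "(LINT z|lborel. g z) = 1" using g'(4)[of 0] by simp
  \<comment> \<open>Only l \<ge> 1/z is kept in the integral, where \<open>1 - exp (- l * z)\<close>
    is at least \<open>1 - exp (- 1)\<close>; the factor \<delta> compensates the tail integral of
    \<open>l powr (- \<delta> - 1)\<close>.\<close>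
  define c where "c = \<delta> / (1 - exp (- 1))"
  have e1: "0 < 1 - exp (- 1 :: real)" by simp
  have c: "0 < c" using e1 \<delta> by (simp add: c_def)
  let ?h = "\<lambda>z l. ennreal ((1 - exp (- l * z)) * l powr (- \<delta> - 1)) * indicator {0<..} l"
  have pt: "ennreal (z powr \<delta>) \<le> ennreal c * (\<integral>\<^sup>+l. ?h z l \<partial>lborel)" if z: "0 < z" for z
  proof -
    have "ennreal (1 - exp (- 1)) * ennreal ((1/z) powr (- \<delta>) / \<delta>) = (\<integral>\<^sup>+l. ennreal (1 - exp (- 1)) * (ennreal (l powr (- \<delta> - 1)) * indicator {1/z..} l) \<partial>lborel)"
      using z \<delta> by (subst nn_integral_cmult) (auto simp: powr_tail_integral)
    also have "\<dots> \<le> (\<integral>\<^sup>+l. ?h z l \<partial>lborel)"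
    proof (rule nn_integral_mono)
      fix l :: real
      show "ennreal (1 - exp (- 1)) * (ennreal (l powr (- \<delta> - 1)) * indicator {1/z..} l) \<le> ?h z l"
      proof (cases "1/z \<le> l")
        case True
        then have l: "0 < l" using z by (smt (verit) divide_pos_pos)
        have "1 \<le> l * z" using True z by (simp add: field_simps)
        then have "1 - exp (- 1) \<le> 1 - exp (- l * z)" by simp
        then have "(1 - exp (- 1)) * l powr (- \<delta> - 1) \<le> (1 - exp (- l * z)) * l powr (- \<delta> - 1)" by (rule mult_right_mono) simp
        then show ?thesis using True l e1 by (simp add: ennreal_mult[symmetric] ennreal_leI)
      qed simp
    qed
    finally have 1: "ennreal (1 - exp (- 1)) * ennreal ((1/z) powr (- \<delta>) / \<delta>) \<le> (\<integral>\<^sup>+l. ?h z l \<partial>lborel)" .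
    have "z powr \<delta> = c * ((1 - exp (- 1)) * ((1/z) powr (- \<delta>) / \<delta>))"
      using z \<delta> e1 by (simp add: c_def powr_divide powr_minus field_simps)
    then have "ennreal (z powr \<delta>) = ennreal c * (ennreal (1 - exp (- 1)) * ennreal ((1/z) powr (- \<delta>) / \<delta>))"
      using c e1 \<delta> by (simp add: ennreal_mult[symmetric])
    also have "\<dots> \<le> ennreal c * (\<integral>\<^sup>+l. ?h z l \<partial>lborel)" by (intro mult_left_mono 1) auto
    finally show ?thesis .
  qed
  have "(\<integral>\<^sup>+z. ennreal (z powr \<delta> * g z) \<partial>lborel) \<le> (\<integral>\<^sup>+z. ennreal c * (\<integral>\<^sup>+l. ?h z l * ennreal (g z) \<partial>lborel) \<partial>lborel)"
  proof (rule nn_integral_mono)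
    fix z :: real
    consider "z < 0" | "z = 0" | "0 < z" by linarith
    then show "ennreal (z powr \<delta> * g z) \<le> ennreal c * (\<integral>\<^sup>+l. ?h z l * ennreal (g z) \<partial>lborel)"
    proof cases
      case 3
      have "ennreal (z powr \<delta> * g z) = ennreal (z powr \<delta>) * ennreal (g z)" using g'(1) by (simp add: ennreal_mult)
      also have "\<dots> \<le> (ennreal c * (\<integral>\<^sup>+l. ?h z l \<partial>lborel)) * ennreal (g z)" by (intro mult_right_mono pt 3) auto
      also have "\<dots> = ennreal c * (\<integral>\<^sup>+l. ?h z l * ennreal (g z) \<partial>lborel)"
        by (subst nn_integral_multc) (auto simp: mult.assoc)
      finally show ?thesis .
    qed (auto simp: g'(2))
  qed
  also have "\<dots> = ennreal c * (\<integral>\<^sup>+z. (\<integral>\<^sup>+l. ?h z l * ennreal (g z) \<partial>lborel) \<partial>lborel)"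
    by (rule nn_integral_cmult) measurable
  also have "(\<integral>\<^sup>+z. (\<integral>\<^sup>+l. ?h z l * ennreal (g z) \<partial>lborel) \<partial>lborel) = (\<integral>\<^sup>+l. (\<integral>\<^sup>+z. ?h z l * ennreal (g z) \<partial>lborel) \<partial>lborel)"
    by (rule lborel_pair.Fubini'[symmetric]) measurable
  \<comment> \<open>By the Laplace transform the z-integral produces
    \<open>1 - exp (- (l powr \<beta>))\<close>. This is at most \<open>l powr \<beta>\<close>,
    integrable at 0 against \<open>l powr (- \<delta> - 1)\<close> because \<delta> < \<beta>, and
    at most 1, integrable at infinity because 0 < \<delta>.\<close>
  also have "\<dots> \<le> (\<integral>\<^sup>+l. ennreal (l powr ((\<beta> - \<delta>) - 1)) * indicator {0<..1} l + ennreal (l powr (- \<delta> - 1)) * indicator {1..} l \<partial>lborel)"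
  proof (rule nn_integral_mono)
    fix l :: real
    show "(\<integral>\<^sup>+z. ?h z l * ennreal (g z) \<partial>lborel) \<le> ennreal (l powr ((\<beta> - \<delta>) - 1)) * indicator {0<..1} l + ennreal (l powr (- \<delta> - 1)) * indicator {1..} l"
    proof (cases "0 < l")
      case False
      then show ?thesis by simp
    next
      case True
      have ie: "integrable lborel (\<lambda>z. exp (- l * z) * g z)"
      proof (rule Bochner_Integration.integrable_bound[OF g'(3)])
        show "AE z in lborel. norm (exp (- l * z) * g z) \<le> norm (g z)"
        proof (rule AE_I2)
          fix z
          show "norm (exp (- l * z) * g z) \<le> norm (g z)"
            using True g'(2)[of z] by (cases "z < 0") (auto simp: abs_mult intro!: mult_left_le_one_le)
        qed
      qed measurable
      have "(\<integral>\<^sup>+z. ?h z l * ennreal (g z) \<partial>lborel) = (\<integral>\<^sup>+z. ennreal (l powr (- \<delta> - 1)) * ennreal ((1 - exp (- l * z)) * g z) \<partial>lborel)"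
      proof (rule nn_integral_cong)
        fix z :: real
        show "?h z l * ennreal (g z) = ennreal (l powr (- \<delta> - 1)) * ennreal ((1 - exp (- l * z)) * g z)"
          using True g'(1)[of z] g'(2)[of z]
          by (cases "z < 0") (auto simp: ennreal_mult[symmetric] mult_ac)
      qed
      also have "\<dots> = ennreal (l powr (- \<delta> - 1)) * (\<integral>\<^sup>+z. ennreal ((1 - exp (- l * z)) * g z) \<partial>lborel)"
        by (rule nn_integral_cmult) measurable
      also have "(\<integral>\<^sup>+z. ennreal ((1 - exp (- l * z)) * g z) \<partial>lborel) = ennreal (LINT z|lborel. (1 - exp (- l * z)) * g z)"
      proof (rule nn_integral_eq_integral)
        show "integrable lborel (\<lambda>z. (1 - exp (- l * z)) * g z)" using g'(3) ie by (simp add: left_diff_distrib)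
        show "AE z in lborel. 0 \<le> (1 - exp (- l * z)) * g z"
        proof (rule AE_I2)
          fix z show "0 \<le> (1 - exp (- l * z)) * g z"
            using True g'(1)[of z] g'(2)[of z] by (cases "z < 0") auto
        qed
      qed
      also have "(LINT z|lborel. (1 - exp (- l * z)) * g z) = 1 - exp (- (l powr \<beta>))"
        using g'(3) ie g'(4)[of l] True int_g by (simp add: left_diff_distrib)
      also have "ennreal (l powr (- \<delta> - 1)) * ennreal (1 - exp (- (l powr \<beta>))) = ennreal (l powr (- \<delta> - 1) * (1 - exp (- (l powr \<beta>))))"
        by (rule ennreal_mult[symmetric]) auto
      also have "\<dots> \<le> ennreal (l powr ((\<beta> - \<delta>) - 1)) * indicator {0<..1} l + ennreal (l powr (- \<delta> - 1)) * indicator {1..} l"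
      proof (cases "l \<le> 1")
        case True
        have "1 - exp (- (l powr \<beta>)) \<le> l powr \<beta>" using exp_ge_add_one_self[of "- (l powr \<beta>)"] by linarith
        then have "l powr (- \<delta> - 1) * (1 - exp (- (l powr \<beta>))) \<le> l powr (- \<delta> - 1) * l powr \<beta>" by (rule mult_left_mono) simp
        also have "\<dots> = l powr ((\<beta> - \<delta>) - 1)" by (simp add: powr_add[symmetric] algebra_simps)
        finally have "ennreal (l powr (- \<delta> - 1) * (1 - exp (- (l powr \<beta>)))) \<le> ennreal (l powr ((\<beta> - \<delta>) - 1)) * indicator {0<..1} l"
          using True \<open>0 < l\<close> by (simp add: ennreal_leI)
        then show ?thesis by (rule order_trans) simp
      next
        case False
        have "l powr (- \<delta> - 1) * (1 - exp (- (l powr \<beta>))) \<le> l powr (- \<delta> - 1) * 1" by (rule mult_left_mono) auto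
        then show ?thesis using False by (simp add: ennreal_leI)
      qed
      finally show ?thesis .
    qed
  qed
  also have "\<dots> = (\<integral>\<^sup>+l. ennreal (l powr ((\<beta> - \<delta>) - 1)) * indicator {0<..1} l \<partial>lborel) + (\<integral>\<^sup>+l. ennreal (l powr (- \<delta> - 1)) * indicator {1..} l \<partial>lborel)"
    by (rule nn_integral_add) measurable
  also have "\<dots> \<le> ennreal (exp 1 * Gamma (\<beta> - \<delta>)) + ennreal (1 powr (- \<delta>) / \<delta>)"
    using \<delta> by (intro add_mono powr_unit_integral) (auto simp: powr_tail_integral)
  also have "\<dots> = ennreal (exp 1 * Gamma (\<beta> - \<delta>) + 1 / \<delta>)"
    using \<delta> Gamma_real_pos[of "\<beta> - \<delta>"] by (simp add: ennreal_plus)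
  finally have "(\<integral>\<^sup>+z. ennreal (z powr \<delta> * g z) \<partial>lborel) \<le> ennreal c * ennreal (exp 1 * Gamma (\<beta> - \<delta>) + 1 / \<delta>)"
    by (simp add: mult_left_mono)
  also have "\<dots> = ennreal (c * (exp 1 * Gamma (\<beta> - \<delta>) + 1 / \<delta>))" using c by (simp add: ennreal_mult')
  finally show thesis
    using c \<delta> Gamma_real_pos[of "\<beta> - \<delta>"] by (intro that[of "c * (exp 1 * Gamma (\<beta> - \<delta>) + 1 / \<delta>)"]) auto
qed

text \<open>Monotone convergence of measures, so that a substitution has to be carried out only on
  compact intervals.\<close>

lemma density_le_of_incseq:
  fixes h :: "real \<Rightarrow> ennreal"
  assumes [measurable]: "h \<in> borel_measurable borel" and S: "\<And>n. S n \<in> sets borel" "incseq S"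
    and le: "\<And>n. (\<integral>\<^sup>+s. h s * indicator (S n) s \<partial>lborel) \<le> B"
  shows "(\<integral>\<^sup>+s. h s * indicator (\<Union>n. S n) s \<partial>lborel) \<le> B"
proof -
  have e: "(\<integral>\<^sup>+s. h s * indicator A s \<partial>lborel) = emeasure (density lborel h) A" if "A \<in> sets borel" for A
    using that by (subst emeasure_density) auto
  have "emeasure (density lborel h) (\<Union>n. S n) = (SUP n. emeasure (density lborel h) (S n))"
    using S by (intro SUP_emeasure_incseq[symmetric]) auto
  also have "\<dots> \<le> B" using le S(1) by (intro SUP_least) (simp add: e[symmetric])
  finally show ?thesis using S(1) by (subst e) auto
qed

text \<open>In terms of laws, the inverse subordinator at time t is distributed as
  \<open>(t / D) powr \<beta>\<close> with D of density g, so its moment of order -c is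
  \<open>t powr (- (\<beta> * c))\<close> times the moment of D of order \<open>\<beta> * c\<close>.
  The proof substitutes \<open>z = t * s powr (- 1 / \<beta>)\<close>.\<close>

lemma inverse_subordinator_substitution:
  assumes g: "stable_subordinator_density \<beta> g" and \<beta>: "0 < \<beta>" and t: "0 < t"
  shows "(\<integral>\<^sup>+s. ennreal (s powr (- c) * inverse_subordinator_density \<beta> g t s) * indicator {0<..} s \<partial>lborel)
     \<le> ennreal (t powr (- (\<beta> * c))) * (\<integral>\<^sup>+z. ennreal (z powr (\<beta> * c) * g z) \<partial>lborel)"
proof -
  have g': "\<And>z. 0 \<le> g z" "integrable lborel g" using g unfolding stable_subordinator_density_def by blast+
  note [measurable] = borel_measurable_integrable[OF g'(2)]
  let ?\<rho> = "inverse_subordinator_density \<beta> g t"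
  have [measurable]: "?\<rho> \<in> borel_measurable borel" unfolding inverse_subordinator_density_def[abs_def] by measurable
  define f where "f z = t powr (- (\<beta> * c)) * (z powr (\<beta> * c) * g z)" for z
  have f [measurable]: "f \<in> borel_measurable borel" unfolding f_def[abs_def] by measurable
  \<comment> \<open>The substitution decreases in s; in terms of r = - s it is increasing, as the
    substitution rule on intervals requires.\<close>
  define \<phi> where "\<phi> r = t * (- r) powr (- 1 / \<beta>)" for r
  define \<phi>' where "\<phi>' r = t * inverse \<beta> * (- r) powr (- 1 - 1 / \<beta>)" for r
  define S where "S n = {1 / real (Suc n)..real (Suc n)}" for n
  have S_un: "(\<Union>n. S n) = {0<..}"
  proof (intro equalityI subsetI)
    fix s :: real assume s: "s \<in> {0<..}"
    obtain n1 where n1: "inverse (real (Suc n1)) < s" using reals_Archimedean s by auto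
    obtain n2 :: nat where n2: "s \<le> real n2" using real_arch_simple by blast
    have "1 / real (Suc (max n1 n2)) \<le> inverse (real (Suc n1))" by (simp add: inverse_eq_divide frac_le)
    then have "s \<in> S (max n1 n2)" using n1 n2 by (simp add: S_def)
    then show "s \<in> (\<Union>n. S n)" by blast
  next
    fix s assume "s \<in> (\<Union>n. S n)"
    then obtain n where "1 / real (Suc n) \<le> s" by (auto simp: S_def)
    moreover have "0 < 1 / real (Suc n)" by simp
    ultimately have "0 < s" by linarith
    then show "s \<in> {0<..}" by simp
  qed
  have "(\<integral>\<^sup>+s. ennreal (s powr (- c) * ?\<rho> s) * indicator (\<Union>n. S n) s \<partial>lborel) \<le> (\<integral>\<^sup>+z. ennreal (f z) \<partial>lborel)"
  proof (rule density_le_of_incseq)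
    show "(\<lambda>s. ennreal (s powr (- c) * ?\<rho> s)) \<in> borel_measurable borel" by measurable
    show "S n \<in> sets borel" for n by (simp add: S_def)
    show "incseq S" by (auto simp: incseq_def S_def frac_le intro: order_trans[rotated])
    fix n
    let ?a = "- real (Suc n)" and ?b = "- (1 / real (Suc n))"
    have ab: "?a \<le> ?b" "?b < 0" by (simp_all add: field_simps)
    have "(\<integral>\<^sup>+s. ennreal (s powr (- c) * ?\<rho> s) * indicator (S n) s \<partial>lborel)
        = (\<integral>\<^sup>+r. ennreal ((0 - r) powr (- c) * ?\<rho> (0 - r)) * indicator (S n) (0 - r) \<partial>lborel)"
      by (rule reflect_nn_integral[symmetric]) (simp add: S_def)
    also have "\<dots> = (\<integral>\<^sup>+r. ennreal (f (\<phi> r) * \<phi>' r * indicator {?a..?b} r) \<partial>lborel)"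
    proof (rule nn_integral_cong)
      fix r :: real
      show "ennreal ((0 - r) powr (- c) * ?\<rho> (0 - r)) * indicator (S n) (0 - r) = ennreal (f (\<phi> r) * \<phi>' r * indicator {?a..?b} r)"
      proof (cases "r \<in> {?a..?b}")
        case True
        then have "r \<le> ?b" by (simp only: atLeastAtMost_iff)
        then have "r < 0" using ab(2) by (rule le_less_trans)
        then have r: "0 < - r" by simp
        have "(\<phi> r) powr (\<beta> * c) = t powr (\<beta> * c) * (- r) powr (- c)"
          using t r \<beta> by (simp add: \<phi>_def powr_mult powr_powr)
        then have "f (\<phi> r) = (t powr (- (\<beta> * c)) * t powr (\<beta> * c)) * ((- r) powr (- c) * g (\<phi> r))"
          by (simp add: f_def mult_ac)
        also have "t powr (- (\<beta> * c)) * t powr (\<beta> * c) = 1" using t by (simp add: powr_add[symmetric])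
        finally have "f (\<phi> r) * \<phi>' r = (- r) powr (- c) * ?\<rho> (- r)"
          by (simp add: inverse_subordinator_density_def \<phi>_def \<phi>'_def mult_ac)
        then show ?thesis using True by (auto simp: S_def indicator_def)
      next
        case False
        then show ?thesis by (auto simp: S_def indicator_def)
      qed
    qed
    also have "\<dots> = (\<integral>\<^sup>+z. ennreal (f z * indicator {\<phi> ?a..\<phi> ?b} z) \<partial>lborel)"
    proof (rule nn_integral_substitution[symmetric])
      show "set_borel_measurable borel {\<phi> ?a..\<phi> ?b} f" unfolding set_borel_measurable_def by measurable
      show "(\<phi> has_real_derivative \<phi>' r) (at r)" if "r \<in> {?a..?b}" for r
      proof -
        have "r \<le> ?b" using that by (simp only: atLeastAtMost_iff)
        then have r: "r < 0" using ab(2) by (rule le_less_trans)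
        show ?thesis unfolding \<phi>_def[abs_def] \<phi>'_def
        proof -
          have c: "- 1 - \<beta> = - \<beta> - 1" by simp
          show "((\<lambda>r. t * (- r) powr (- 1 / \<beta>)) has_real_derivative t * inverse \<beta> * (- r) powr (- 1 - 1 / \<beta>)) (at r)"
            using r \<beta> by (auto intro!: derivative_eq_intros simp: field_simps powr_diff c)
        qed
      qed
      show "continuous_on {?a..?b} \<phi>'"
        unfolding \<phi>'_def[abs_def] using ab(2) by (intro continuous_intros) auto
      show "0 \<le> \<phi>' r" for r unfolding \<phi>'_def using t \<beta> by simp
    qed (rule ab)
    also have "\<dots> \<le> (\<integral>\<^sup>+z. ennreal (f z) \<partial>lborel)"
      using g'(1) by (intro nn_integral_mono ennreal_leI) (auto simp: f_def indicator_def)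
    finally show "(\<integral>\<^sup>+s. ennreal (s powr (- c) * ?\<rho> s) * indicator (S n) s \<partial>lborel) \<le> (\<integral>\<^sup>+z. ennreal (f z) \<partial>lborel)" .
  qed
  also have "(\<integral>\<^sup>+z. ennreal (f z) \<partial>lborel) = ennreal (t powr (- (\<beta> * c))) * (\<integral>\<^sup>+z. ennreal (z powr (\<beta> * c) * g z) \<partial>lborel)"
    unfolding f_def using g'(1) by (subst nn_integral_cmult[symmetric]) (auto simp: ennreal_mult)
  finally show ?thesis unfolding S_un .
qed

text \<open>The Gamma integral after scaling time by l. The negative power of l is what makes the
  weighted norm of the kernel small.\<close>

lemma exp_powr_integral:
  fixes l x :: real
  assumes l: "0 < l" and x: "0 < x"
  shows "(\<integral>\<^sup>+t. ennreal (exp (- l * t) * t powr (x - 1)) * indicator {0<..} t \<partial>lborel) \<le> ennreal (l powr (- x) * Gamma x)"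
proof -
  let ?f = "\<lambda>t::real. ennreal (indicator {0..} t * t powr (x - 1) / exp t)"
  have "ennreal (Gamma x) = ennreal l * (\<integral>\<^sup>+t. ?f (l *\<^sub>R t) \<partial>lborel)"
    using scale_nn_integral[of ?f l] l Gamma_conv_nn_integral_real[OF x] by simp
  then have G: "ennreal (l powr (- x)) * ennreal (Gamma x) = ennreal (l powr (- x)) * (ennreal l * (\<integral>\<^sup>+t. ?f (l *\<^sub>R t) \<partial>lborel))" by simp
  have "(\<integral>\<^sup>+t. ennreal (exp (- l * t) * t powr (x - 1)) * indicator {0<..} t \<partial>lborel) \<le> (\<integral>\<^sup>+t. ennreal (l powr (- x) * l) * ?f (l *\<^sub>R t) \<partial>lborel)"
  proof (rule nn_integral_mono)
    fix t :: real
    show "ennreal (exp (- l * t) * t powr (x - 1)) * indicator {0<..} t \<le> ennreal (l powr (- x) * l) * ?f (l *\<^sub>R t)"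
    proof (cases "0 < t")
      case True
      have "l powr (- x) * l * (l * t) powr (x - 1) = (l powr (- x) * l powr 1 * l powr (x - 1)) * t powr (x - 1)"
        using l True by (simp add: powr_mult)
      also have "l powr (- x) * l powr 1 * l powr (x - 1) = 1" by (simp only: powr_add[symmetric]) (use l in simp)
      finally have "l powr (- x) * l * ((l * t) powr (x - 1) / exp (l * t)) = exp (- l * t) * t powr (x - 1)"
        by (simp add: exp_minus field_simps)
      then show ?thesis using True l by (simp add: ennreal_mult[symmetric])
    qed simp
  qed
  also have "\<dots> = ennreal (l powr (- x) * l) * (\<integral>\<^sup>+t. ?f (l *\<^sub>R t) \<partial>lborel)"
    by (rule nn_integral_cmult) measurable
  also have "\<dots> = ennreal (l powr (- x)) * ennreal (Gamma x)"
    unfolding G using l by (simp add: ennreal_mult mult.assoc)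
  also have "\<dots> = ennreal (l powr (- x) * Gamma x)"
    using Gamma_real_pos[OF x] by (simp add: ennreal_mult)
  finally show ?thesis .
qed

section \<open>Space-time bounds for the subordinated kernel\<close>

locale subordinated_kernel =
  fixes \<alpha> \<beta> \<nu> :: real and p :: "real \<Rightarrow> 'a::euclidean_space \<Rightarrow> real" and g :: "real \<Rightarrow> real"
  assumes \<alpha>: "0 < \<alpha>" and \<beta>: "0 < \<beta>" and \<nu>: "0 < \<nu>"
    and dim: "real DIM('a) < min 2 (1 / \<beta>) * \<alpha>"
    and p: "isotropic_stable_density \<alpha> \<nu> p" and g: "stable_subordinator_density \<beta> g"
begin

abbreviation G :: "real \<Rightarrow> 'a \<Rightarrow> real" where "G \<equiv> fundamental_solution \<beta> g p"

abbreviation time_density :: "real \<Rightarrow> real \<Rightarrow> real" where "time_density \<equiv> inverse_subordinator_density \<beta> g"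

text \<open>\<open>p\<close> is controlled for positive times only; the extension by 0 is measurable
  on all of space-time, as the Fubini arguments require.\<close>

definition pos_density :: "real \<times> 'a \<Rightarrow> real" where
  "pos_density z = (if 0 < fst z then p (fst z) (snd z) else 0)"

definition half_order :: real where "half_order = real DIM('a) / (2 * \<alpha>)"

text \<open>The two halves of the dimension condition. \<open>d < 2 * \<alpha>\<close> gives
  \<open>half_order < 1\<close>, so the subordinator has a finite moment of order
  \<open>\<beta> * half_order\<close>, which is below \<beta>; \<open>d < \<alpha> / \<beta>\<close>
  gives \<open>2 * \<beta> * half_order < 1\<close>, so the square of the kernel is integrable at t
  = 0.\<close>

lemma half_order_bounds: "0 < half_order" "half_order < 1" "\<beta> * half_order < 1 / 2"
proof -
  have "min 2 (1 / \<beta>) * \<alpha> \<le> 2 * \<alpha>" "min 2 (1 / \<beta>) * \<alpha> \<le> (1 / \<beta>) * \<alpha>"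
    by (rule mult_right_mono; use \<alpha> in simp)+
  then have "real DIM('a) < 2 * \<alpha>" "real DIM('a) < (1 / \<beta>) * \<alpha>" using dim by linarith+
  then show "0 < half_order" "half_order < 1" "\<beta> * half_order < 1 / 2"
    using \<alpha> \<beta> by (auto simp: half_order_def field_simps)
qed

lemma g_nonneg: "0 \<le> g z" and g_neg: "z < 0 \<Longrightarrow> g z = 0" and g_integrable: "integrable lborel g"
  using g unfolding stable_subordinator_density_def by blast+

lemma g_measurable [measurable]: "g \<in> borel_measurable borel"
  using borel_measurable_integrable[OF g_integrable] by simp

lemma time_density_nonneg: "0 < t \<Longrightarrow> 0 \<le> time_density t s"
  using \<beta> g_nonneg by (simp add: inverse_subordinator_density_def)

lemma time_density_measurable [measurable]:
  assumes [measurable]: "f \<in> borel_measurable L" "h \<in> borel_measurable L"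
  shows "(\<lambda>z. time_density (f z) (h z)) \<in> borel_measurable L"
  unfolding inverse_subordinator_density_def by measurable

lemma pos_density_measurable [measurable]: "pos_density \<in> borel_measurable borel"
proof -
  have p': "(\<lambda>(s, x). p s x) \<in> borel_measurable (restrict_space borel {0<..} \<Otimes>\<^sub>M borel)"
    using p unfolding isotropic_stable_density_def by blast
  let ?R = "restrict_space (borel :: (real \<times> 'a) measure) ({0<..} \<times> UNIV)"
  have "(\<lambda>z. (fst z, snd z)) \<in> measurable ?R (restrict_space borel {0<..} \<Otimes>\<^sub>M borel)"
  proof (rule measurable_Pair)
    show "fst \<in> measurable ?R (restrict_space borel {0<..})"
      by (intro measurable_restrict_space2 measurable_restrict_space1 borel_measurable_continuous_onI continuous_intros)
         (auto simp: space_restrict_space)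
    show "snd \<in> measurable ?R borel"
      by (intro measurable_restrict_space1 borel_measurable_continuous_onI continuous_intros)
  qed
  from measurable_compose[OF this p'] have "(\<lambda>z. p (fst z) (snd z)) \<in> borel_measurable ?R" by (simp add: case_prod_unfold)
  moreover have "{0<..} \<times> UNIV \<in> sets (borel :: (real \<times> 'a) measure)" by (intro borel_open open_Times) auto
  ultimately have "(\<lambda>z. indicator ({0<..} \<times> UNIV) z *\<^sub>R p (fst z) (snd z)) \<in> borel_measurable borel"
    by (subst (asm) borel_measurable_restrict_space_iff) auto
  also have "(\<lambda>z. indicator ({0<..} \<times> UNIV) z *\<^sub>R p (fst z) (snd z)) = pos_density"
    by (auto simp: pos_density_def fun_eq_iff indicator_def)
  finally show ?thesis .
qed

lemma pos_density_nonneg: "0 \<le> pos_density z"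
  using p by (auto simp: pos_density_def isotropic_stable_density_def)

lemma pos_density_compose [measurable]:
  assumes [measurable]: "f \<in> borel_measurable L" "h \<in> borel_measurable L"
  shows "(\<lambda>z. pos_density (f z, h z)) \<in> borel_measurable L"
proof -
  have "(\<lambda>z. (f z, h z)) \<in> borel_measurable L" by (rule borel_measurable_Pair) measurable
  from measurable_compose[OF this pos_density_measurable] show ?thesis .
qed

lemma G_eq: "G t x = (LINT s|lborel. pos_density (s, x) * time_density t s)"
  unfolding fundamental_solution_def set_lebesgue_integral_def
  by (intro Bochner_Integration.integral_cong) (auto simp: pos_density_def indicator_def)

text \<open>At t = 0 the prefactor t vanishes, and for t < 0 the argument of g is negative. The
  kernel is thus causal, and convolutions with it can be taken over all of space-time.\<close>

lemma G_past: "t \<le> 0 \<Longrightarrow> G t x = 0"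
proof -
  assume t: "t \<le> 0"
  have "pos_density (s, x) * time_density t s = 0" for s
  proof (cases "t = 0 \<or> s \<le> 0")
    case True
    then show ?thesis by (auto simp: pos_density_def inverse_subordinator_density_def)
  next
    case False
    then have "t * s powr (- 1 / \<beta>) < 0" using t by (simp add: mult_neg_pos)
    then show ?thesis using g_neg by (simp add: inverse_subordinator_density_def)
  qed
  then have "(\<lambda>s. pos_density (s, x) * time_density t s) = (\<lambda>s. 0)" by (rule ext)
  then show ?thesis by (simp add: G_eq)
qed

lemma G_nonneg: "0 \<le> G t x"
proof (cases "0 < t")
  case True
  then show ?thesis unfolding G_eq
    by (intro Bochner_Integration.integral_nonneg) (auto simp: pos_density_nonneg time_density_nonneg)
qed (simp add: G_past)

lemma G_measurable: "(\<lambda>(t, x). G t x) \<in> borel_measurable borel"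
proof -
  have "(\<lambda>z::real \<times> 'a. LINT s|lborel. pos_density (s, snd z) * time_density (fst z) s) \<in> borel_measurable (borel \<Otimes>\<^sub>M borel)"
    by measurable
  then show ?thesis by (simp add: G_eq case_prod_unfold borel_prod)
qed

lemma G_measurable_compose [measurable]:
  assumes [measurable]: "f \<in> borel_measurable L" "h \<in> borel_measurable L"
  shows "(\<lambda>z. G (f z) (h z)) \<in> borel_measurable L"
proof -
  have "(\<lambda>z. (f z, h z)) \<in> borel_measurable L" by (rule borel_measurable_Pair) measurable
  from measurable_compose[OF this G_measurable] show ?thesis by simp
qed

text \<open>Only an inequality, because G is 0 by convention wherever the Bochner integral does not
  exist. Apart from nonnegativity, the size of G matters only from above.\<close>

lemma G_le_nn_integral:
  assumes "0 < t"
  shows "ennreal (G t x) \<le> (\<integral>\<^sup>+s. ennreal (pos_density (s, x) * time_density t s) \<partial>lborel)"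
proof (cases "integrable lborel (\<lambda>s. pos_density (s, x) * time_density t s)")
  case True
  then show ?thesis unfolding G_eq
    using assms by (subst nn_integral_eq_integral) (auto simp: pos_density_nonneg time_density_nonneg)
qed (simp add: G_eq not_integrable_integral_eq)

lemma pos_density_mass: "(\<integral>\<^sup>+x. ennreal (pos_density (s, x)) \<partial>lborel) = indicator {0<..} s"
  using stable_density_mass[OF p, of s] by (simp add: pos_density_def indicator_def)

text \<open>The case c = 0 of the substitution: \<open>p s\<close> integrates to 1 over x, and the
  law of the inverse subordinator has mass at most 1.\<close>

lemma G_mass: "(\<integral>\<^sup>+x. ennreal (G t x) \<partial>lborel) \<le> 1"
proof (cases "0 < t")
  case False
  then show ?thesis by (simp add: G_past)
next
  case True
  have "(\<integral>\<^sup>+x. ennreal (G t x) \<partial>lborel) \<le> (\<integral>\<^sup>+x. (\<integral>\<^sup>+s. ennreal (pos_density (s, x) * time_density t s) \<partial>lborel) \<partial>lborel)"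
    by (intro nn_integral_mono G_le_nn_integral True)
  also have "\<dots> = (\<integral>\<^sup>+s. (\<integral>\<^sup>+x. ennreal (pos_density (s, x) * time_density t s) \<partial>lborel) \<partial>lborel)"
    by (rule lborel_pair.Fubini') measurable
  also have "\<dots> = (\<integral>\<^sup>+s. ennreal (s powr (- 0) * time_density t s) * indicator {0<..} s \<partial>lborel)"
  proof (rule nn_integral_cong)
    fix s :: real
    have "(\<integral>\<^sup>+x. ennreal (pos_density (s, x) * time_density t s) \<partial>lborel) = (\<integral>\<^sup>+x. ennreal (time_density t s) * ennreal (pos_density (s, x)) \<partial>lborel)"
      using time_density_nonneg[OF True] pos_density_nonneg by (simp add: ennreal_mult[symmetric] mult.commute)
    also have "\<dots> = ennreal (time_density t s) * indicator {0<..} s"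
      by (subst nn_integral_cmult) (auto simp: pos_density_mass)
    finally show "(\<integral>\<^sup>+x. ennreal (pos_density (s, x) * time_density t s) \<partial>lborel) = ennreal (s powr (- 0) * time_density t s) * indicator {0<..} s"
      by (auto simp: indicator_def)
  qed
  also have "\<dots> \<le> ennreal (t powr (- (\<beta> * 0))) * (\<integral>\<^sup>+z. ennreal (z powr (\<beta> * 0) * g z) \<partial>lborel)"
    by (rule inverse_subordinator_substitution[OF g \<beta> True])
  also have "\<dots> \<le> 1 * (\<integral>\<^sup>+z. ennreal (g z) \<partial>lborel)"
    using g_nonneg True by (intro mult_mono nn_integral_mono ennreal_leI) (auto simp: powr_zero_eq_one)
  also have "\<dots> = 1" by (simp add: subordinator_mass[OF g])
  finally show ?thesis .
qed

text \<open>Cauchy-Schwarz in s, with the time density split as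
  \<open>sqrt (s powr c * \<rho> s) * sqrt (s powr (- c) * \<rho> s)\<close> for c =
  \<open>half_order\<close>. Integrating the square of \<open>p s x\<close> over x costs
  \<open>s powr (- (2 * c))\<close>, so the first factor becomes a multiple of the second and only
  the moment B of order -c remains. This is why half of d / \<alpha> is the right weight.\<close>

lemma G_square_bound:
  obtains C where "0 \<le> C" "\<And>t. 0 < t \<Longrightarrow> (\<integral>\<^sup>+x. ennreal ((G t x)\<^sup>2) \<partial>lborel) \<le> ennreal (C * t powr (- (2 * (\<beta> * half_order))))"
proof -
  let ?c = half_order
  obtain C where C: "0 \<le> C" "\<And>s. 0 < s \<Longrightarrow> (\<integral>\<^sup>+x. ennreal ((p s x)\<^sup>2) \<partial>lborel) \<le> ennreal (C * s powr (- (real DIM('a) / \<alpha>)))"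
    using stable_density_square[OF p \<alpha> \<nu>] by blast
  have "0 < \<beta> * ?c" "\<beta> * ?c < \<beta>" using half_order_bounds \<beta> by auto
  then obtain m where m: "0 \<le> m" "(\<integral>\<^sup>+z. ennreal (z powr (\<beta> * ?c) * g z) \<partial>lborel) \<le> ennreal m"
    using subordinator_moment[OF g \<beta>] by blast
  have two: "real DIM('a) / \<alpha> = 2 * ?c" using \<alpha> by (simp add: half_order_def)
  have "(\<integral>\<^sup>+x. ennreal ((G t x)\<^sup>2) \<partial>lborel) \<le> ennreal (C * m\<^sup>2 * t powr (- (2 * (\<beta> * ?c))))" if t: "0 < t" for t
  proof -
    let ?\<rho> = "time_density t"
    note \<rho> = time_density_nonneg[OF t]
    define B where "B = (\<integral>\<^sup>+s. ennreal (s powr (- ?c) * ?\<rho> s) * indicator {0<..} s \<partial>lborel)"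
    have B: "B \<le> ennreal (t powr (- (\<beta> * ?c)) * m)"
    proof -
      have "B \<le> ennreal (t powr (- (\<beta> * ?c))) * (\<integral>\<^sup>+z. ennreal (z powr (\<beta> * ?c) * g z) \<partial>lborel)"
        unfolding B_def by (rule inverse_subordinator_substitution[OF g \<beta> t])
      also have "\<dots> \<le> ennreal (t powr (- (\<beta> * ?c))) * ennreal m" by (intro mult_left_mono m) auto
      finally show ?thesis using m(1) by (simp add: ennreal_mult)
    qed
    let ?A = "\<lambda>x s. ennreal ((pos_density (s, x))\<^sup>2 * (s powr ?c * ?\<rho> s))"
    have pt: "ennreal ((G t x)\<^sup>2) \<le> (\<integral>\<^sup>+s. ?A x s \<partial>lborel) * B" for x
    proof -
      let ?f = "\<lambda>s. ennreal (pos_density (s, x) * sqrt (s powr ?c * ?\<rho> s))"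
      let ?h = "\<lambda>s. ennreal (sqrt (s powr (- ?c) * ?\<rho> s)) * indicator {0<..} s"
      have "ennreal ((G t x)\<^sup>2) = (ennreal (G t x))\<^sup>2" by (simp add: ennreal_power G_nonneg)
      also have "\<dots> \<le> (\<integral>\<^sup>+s. ennreal (pos_density (s, x) * ?\<rho> s) \<partial>lborel)\<^sup>2"
        by (intro power_mono G_le_nn_integral t) auto
      also have "(\<integral>\<^sup>+s. ennreal (pos_density (s, x) * ?\<rho> s) \<partial>lborel) = (\<integral>\<^sup>+s. ?f s * ?h s \<partial>lborel)"
      proof (rule nn_integral_cong)
        fix s :: real
        show "ennreal (pos_density (s, x) * ?\<rho> s) = ?f s * ?h s"
        proof (cases "0 < s")
          case True
          have "sqrt (s powr ?c * ?\<rho> s) * sqrt (s powr (- ?c) * ?\<rho> s) = sqrt ((s powr ?c * s powr (- ?c)) * (?\<rho> s)\<^sup>2)"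
            by (simp add: real_sqrt_mult[symmetric] power2_eq_square mult_ac)
          also have "s powr ?c * s powr (- ?c) = 1" using True by (simp add: powr_add[symmetric])
          finally have "sqrt (s powr ?c * ?\<rho> s) * sqrt (s powr (- ?c) * ?\<rho> s) = ?\<rho> s" using \<rho>[of s] by simp
          then show ?thesis
            using True \<rho>[of s] pos_density_nonneg[of "(s, x)"] by (simp add: ennreal_mult[symmetric] mult.assoc)
        qed (simp add: pos_density_def)
      qed
      also have "(\<integral>\<^sup>+s. ?f s * ?h s \<partial>lborel)\<^sup>2 \<le> (\<integral>\<^sup>+s. (?f s)\<^sup>2 \<partial>lborel) * (\<integral>\<^sup>+s. (?h s)\<^sup>2 \<partial>lborel)"
        by (rule Cauchy_Schwarz_nn_integral) measurable
      also have "(\<integral>\<^sup>+s. (?f s)\<^sup>2 \<partial>lborel) = (\<integral>\<^sup>+s. ?A x s \<partial>lborel)"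
        using \<rho> pos_density_nonneg by (intro nn_integral_cong) (simp add: ennreal_power power_mult_distrib)
      also have "(\<integral>\<^sup>+s. (?h s)\<^sup>2 \<partial>lborel) = B"
        unfolding B_def using \<rho> by (intro nn_integral_cong) (auto simp: ennreal_power indicator_def)
      finally show ?thesis .
    qed
    have "(\<integral>\<^sup>+x. ennreal ((G t x)\<^sup>2) \<partial>lborel) \<le> (\<integral>\<^sup>+x. (\<integral>\<^sup>+s. ?A x s \<partial>lborel) * B \<partial>lborel)"
      by (intro nn_integral_mono pt)
    also have "\<dots> = (\<integral>\<^sup>+x. (\<integral>\<^sup>+s. ?A x s \<partial>lborel) \<partial>lborel) * B"
      by (rule nn_integral_multc) measurable
    also have "(\<integral>\<^sup>+x. (\<integral>\<^sup>+s. ?A x s \<partial>lborel) \<partial>lborel) = (\<integral>\<^sup>+s. (\<integral>\<^sup>+x. ?A x s \<partial>lborel) \<partial>lborel)"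
      by (rule lborel_pair.Fubini') measurable
    also have "\<dots> \<le> (\<integral>\<^sup>+s. ennreal C * (ennreal (s powr (- ?c) * ?\<rho> s) * indicator {0<..} s) \<partial>lborel)"
    proof (rule nn_integral_mono)
      fix s :: real
      show "(\<integral>\<^sup>+x. ?A x s \<partial>lborel) \<le> ennreal C * (ennreal (s powr (- ?c) * ?\<rho> s) * indicator {0<..} s)"
      proof (cases "0 < s")
        case True
        have "(\<integral>\<^sup>+x. ?A x s \<partial>lborel) = (\<integral>\<^sup>+x. ennreal (s powr ?c * ?\<rho> s) * ennreal ((p s x)\<^sup>2) \<partial>lborel)"
          using True \<rho>[of s] by (intro nn_integral_cong) (simp add: pos_density_def ennreal_mult[symmetric] mult.commute)
        also have "\<dots> = ennreal (s powr ?c * ?\<rho> s) * (\<integral>\<^sup>+x. ennreal ((p s x)\<^sup>2) \<partial>lborel)"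
        proof (rule nn_integral_cmult)
          have "integrable lborel (p s)" using p True unfolding isotropic_stable_density_def by blast
          then show "(\<lambda>x. ennreal ((p s x)\<^sup>2)) \<in> borel_measurable lborel" by measurable
        qed
        also have "\<dots> \<le> ennreal (s powr ?c * ?\<rho> s) * ennreal (C * s powr (- (2 * ?c)))"
          using C(2)[OF True] unfolding two by (intro mult_left_mono) auto
        also have "\<dots> = ennreal (C * ((s powr ?c * s powr (- (2 * ?c))) * ?\<rho> s))"
          using C(1) \<rho>[of s] by (simp add: ennreal_mult[symmetric] mult_ac)
        also have "s powr ?c * s powr (- (2 * ?c)) = s powr (- ?c)" by (simp add: powr_add[symmetric])
        finally show ?thesis using True C(1) \<rho>[of s] by (simp add: ennreal_mult)
      qed (simp add: pos_density_def)
    qed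
    also have "\<dots> = ennreal C * B" unfolding B_def by (rule nn_integral_cmult) measurable
    finally have "(\<integral>\<^sup>+x. ennreal ((G t x)\<^sup>2) \<partial>lborel) \<le> ennreal C * B * B" by (simp add: mult_right_mono)
    also have "\<dots> \<le> ennreal C * ennreal (t powr (- (\<beta> * ?c)) * m) * ennreal (t powr (- (\<beta> * ?c)) * m)"
      by (intro mult_mono B order_refl) auto
    also have "\<dots> = ennreal (C * m\<^sup>2 * (t powr (- (\<beta> * ?c)) * t powr (- (\<beta> * ?c))))"
      using C(1) m(1) by (simp add: ennreal_mult[symmetric] power2_eq_square mult_ac)
    also have "t powr (- (\<beta> * ?c)) * t powr (- (\<beta> * ?c)) = t powr (- (2 * (\<beta> * ?c)))"
      by (simp add: powr_add[symmetric])
    finally show ?thesis .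
  qed
  moreover have "0 \<le> C * m\<^sup>2" using C(1) by simp
  ultimately show thesis using that by blast
qed

text \<open>For fixed t the square integral over x is at most a multiple of
  \<open>t powr (k - 1)\<close> with k > 0, and the Laplace transform of this power at l is
  \<open>Gamma k * l powr (- k)\<close>, which tends to 0.\<close>

lemma G_square:
  assumes e: "0 < e"
  shows "\<exists>l>0. (\<integral>\<^sup>+(t, x). ennreal (exp (- l * t) * (G t x)\<^sup>2) \<partial>lborel) \<le> ennreal e"
proof -
  obtain C where C: "0 \<le> C" "\<And>t. 0 < t \<Longrightarrow> (\<integral>\<^sup>+x. ennreal ((G t x)\<^sup>2) \<partial>lborel) \<le> ennreal (C * t powr (- (2 * (\<beta> * half_order))))"
    using G_square_bound by blast
  define k where "k = 1 - 2 * (\<beta> * half_order)"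
  have k: "0 < k" using half_order_bounds by (simp add: k_def)
  have bound: "(\<integral>\<^sup>+(t, x). ennreal (exp (- l * t) * (G t x)\<^sup>2) \<partial>lborel) \<le> ennreal (C * Gamma k * l powr (- k))" if l: "0 < l" for l
  proof -
    have m: "(\<lambda>(t, x). ennreal (exp (- l * t) * (G t x)\<^sup>2)) \<in> borel_measurable (lborel \<Otimes>\<^sub>M lborel)"
      by measurable
    have "(\<integral>\<^sup>+(t, x). ennreal (exp (- l * t) * (G t x)\<^sup>2) \<partial>lborel) = (\<integral>\<^sup>+(t, x). ennreal (exp (- l * t) * (G t x)\<^sup>2) \<partial>(lborel \<Otimes>\<^sub>M lborel))"
      by (simp add: lborel_prod)
    also have "\<dots> = (\<integral>\<^sup>+t. (\<integral>\<^sup>+x. ennreal (exp (- l * t) * (G t x)\<^sup>2) \<partial>lborel) \<partial>lborel)"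
      using lborel.nn_integral_fst[OF m, symmetric] by simp
    also have "\<dots> \<le> (\<integral>\<^sup>+t. ennreal C * (ennreal (exp (- l * t) * t powr (k - 1)) * indicator {0<..} t) \<partial>lborel)"
    proof (rule nn_integral_mono)
      fix t :: real
      show "(\<integral>\<^sup>+x. ennreal (exp (- l * t) * (G t x)\<^sup>2) \<partial>lborel) \<le> ennreal C * (ennreal (exp (- l * t) * t powr (k - 1)) * indicator {0<..} t)"
      proof (cases "0 < t")
        case True
        have "(\<integral>\<^sup>+x. ennreal (exp (- l * t) * (G t x)\<^sup>2) \<partial>lborel) = ennreal (exp (- l * t)) * (\<integral>\<^sup>+x. ennreal ((G t x)\<^sup>2) \<partial>lborel)"
          by (subst nn_integral_cmult[symmetric]) (auto simp: ennreal_mult)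
        also have "\<dots> \<le> ennreal (exp (- l * t)) * ennreal (C * t powr (- (2 * (\<beta> * half_order))))"
          by (intro mult_left_mono C True) auto
        also have "\<dots> = ennreal C * ennreal (exp (- l * t) * t powr (k - 1))"
          using C(1) by (simp add: ennreal_mult[symmetric] k_def mult_ac)
        finally show ?thesis using True by simp
      qed (simp add: G_past)
    qed
    also have "\<dots> = ennreal C * (\<integral>\<^sup>+t. ennreal (exp (- l * t) * t powr (k - 1)) * indicator {0<..} t \<partial>lborel)"
      by (rule nn_integral_cmult) measurable
    also have "\<dots> \<le> ennreal C * ennreal (l powr (- k) * Gamma k)"
      by (intro mult_left_mono exp_powr_integral l k) auto
    also have "\<dots> = ennreal (C * Gamma k * l powr (- k))"
      using C(1) Gamma_real_pos[OF k] by (simp add: ennreal_mult[symmetric] mult_ac)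
    finally show ?thesis .
  qed
  have "((\<lambda>l. C * Gamma k * l powr (- k)) \<longlongrightarrow> C * Gamma k * 0) at_top"
    using k by (intro tendsto_mult tendsto_const tendsto_neg_powr) (auto simp: filterlim_ident)
  then have "\<forall>\<^sub>F l in at_top. C * Gamma k * l powr (- k) < e"
    using e by (auto dest: order_tendstoD)
  then have "\<forall>\<^sub>F l in at_top. 0 < l \<and> C * Gamma k * l powr (- k) < e"
    using eventually_gt_at_top[of 0] by eventually_elim auto
  then obtain l where l: "0 < l" "C * Gamma k * l powr (- k) < e"
    unfolding eventually_at_top_linorder by blast
  show ?thesis
  proof (intro exI[of _ l] conjI l(1))
    show "(\<integral>\<^sup>+(t, x). ennreal (exp (- l * t) * (G t x)\<^sup>2) \<partial>lborel) \<le> ennreal e"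
      by (rule order_trans[OF bound[OF l(1)]]) (use l(2) in \<open>intro ennreal_leI, simp\<close>)
  qed
qed

end

section \<open>The compensated Poisson noise\<close>

lemma integrable_bounded_mult:
  fixes f Y :: "'a \<Rightarrow> real"
  assumes "Y \<in> borel_measurable M" "bounded (Y ` space M)" "integrable M f"
  shows "integrable M (\<lambda>\<omega>. Y \<omega> * f \<omega>)"
proof -
  obtain c where c: "\<And>\<omega>. \<omega> \<in> space M \<Longrightarrow> \<bar>Y \<omega>\<bar> \<le> c"
    using assms(2) unfolding bounded_iff by auto
  show ?thesis
  proof (rule Bochner_Integration.integrable_bound[of M "\<lambda>\<omega>. c * f \<omega>"])
    show "AE \<omega> in M. norm (Y \<omega> * f \<omega>) \<le> norm (c * f \<omega>)"
    proof (rule AE_I2)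
      fix \<omega> assume "\<omega> \<in> space M"
      then have "\<bar>Y \<omega>\<bar> \<le> \<bar>c\<bar>" using c[of \<omega>] by linarith
      then show "norm (Y \<omega> * f \<omega>) \<le> norm (c * f \<omega>)" by (simp add: abs_mult mult_right_mono)
    qed
  qed (use assms in auto)
qed

locale poisson_noise = prob_space M
  for M :: "'w measure" +
  fixes \<mu> :: "'a::euclidean_space measure"
    and N :: "'w \<Rightarrow> (real \<times> 'a \<times> 'a) measure"
  assumes levy: "levy_measure \<mu>"
    and prm: "poisson_random_measure M (intensity \<mu>) N"
begin

abbreviation \<Lambda> :: "(real \<times> 'a \<times> 'a) measure" where "\<Lambda> \<equiv> intensity \<mu>"
abbreviation \<F> :: "real \<Rightarrow> 'w measure" where "\<F> \<equiv> noise_filtration M \<mu> N"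
abbreviation marks :: "('a \<times> 'a) measure" where "marks \<equiv> lborel \<Otimes>\<^sub>M \<mu>"

lemma sets_mu [simp, measurable_cong]: "sets \<mu> = sets borel"
  using levy by (simp add: levy_measure_def)

lemma space_mu [simp]: "space \<mu> = UNIV"
  using sets_eq_imp_space_eq[OF sets_mu] by simp

lemma sigma_finite_mu: "sigma_finite_measure \<mu>"
  using levy by (simp add: levy_measure_def)

lemma sets_marks [simp, measurable_cong]: "sets marks = sets borel"
proof -
  have "sets marks = sets (borel \<Otimes>\<^sub>M borel :: ('a \<times> 'a) measure)"
    by (intro sets_pair_measure_cong sets_lborel sets_mu)
  then show ?thesis by (simp only: borel_prod)
qed

lemma space_marks [simp]: "space marks = UNIV"
  using sets_eq_imp_space_eq[OF sets_marks] by simp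

lemma sigma_finite_marks: "sigma_finite_measure marks"
  by (intro sigma_finite_pair_measure lborel.sigma_finite_measure_axioms sigma_finite_mu)

lemma sets_intensity [simp, measurable_cong]:
  "sets \<Lambda> = sets (restrict_space borel {0..} \<Otimes>\<^sub>M borel)"
  unfolding intensity_def
  by (intro sets_pair_measure_cong sets_marks sets_restrict_space_cong) simp

lemma space_intensity [simp]: "space \<Lambda> = {0..} \<times> UNIV"
  by (simp add: intensity_def space_pair_measure space_restrict_space)

lemma sigma_finite_time: "sigma_finite_measure (restrict_space lborel {0::real..})"
  by (intro sigma_finite_measure_restrict_space lborel.sigma_finite_measure_axioms) simp

lemma sigma_finite_intensity: "sigma_finite_measure \<Lambda>"
  unfolding intensity_def
  by (intro sigma_finite_pair_measure sigma_finite_time sigma_finite_marks)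

lemma interval_in_time: "0 \<le> a \<Longrightarrow> {a<..b} \<in> sets (restrict_space borel {0::real..})"
  by (subst sets_restrict_space_iff) auto

lemma cylinder_sets [simp, intro]:
  "0 \<le> a \<Longrightarrow> B \<in> sets borel \<Longrightarrow> {a<..b} \<times> B \<in> sets \<Lambda>"
  using interval_in_time[of a b] by simp

lemma emeasure_cylinder:
  assumes "0 \<le> a" "a \<le> b" "B \<in> sets borel"
  shows "emeasure \<Lambda> ({a<..b} \<times> B) = ennreal (b - a) * emeasure marks B"
proof -
  interpret sigma_finite_measure marks by (rule sigma_finite_marks)
  have "emeasure \<Lambda> ({a<..b} \<times> B) = emeasure (restrict_space lborel {0..}) {a<..b} * emeasure marks B"
    unfolding intensity_def
    by (intro emeasure_pair_measure_Times) (use assms in \<open>auto simp only: sets_marks, auto simp: sets_restrict_space_iff\<close>)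
  also have "emeasure (restrict_space lborel {0..}) {a<..b} = ennreal (b - a)"
    using assms by (subst emeasure_restrict_space) auto
  finally show ?thesis .
qed

lemma slab_sets [simp, intro]: "{0..t} \<times> UNIV \<in> sets \<Lambda>"
proof -
  have "{0..t} \<in> sets (restrict_space borel {0::real..})"
    by (subst sets_restrict_space_iff) auto
  then show ?thesis by simp
qed

lemma sets_noise: "\<omega> \<in> space M \<Longrightarrow> sets (N \<omega>) = sets \<Lambda>"
  using prm unfolding poisson_random_measure_def by blast

lemma noise_measurable [measurable]: "A \<in> sets \<Lambda> \<Longrightarrow> (\<lambda>\<omega>. emeasure (N \<omega>) A) \<in> borel_measurable M"
  using prm unfolding poisson_random_measure_def by blast

lemma noise_poisson:
  "A \<in> sets \<Lambda> \<Longrightarrow> emeasure \<Lambda> A < \<infinity> \<Longrightarrow>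
    measure M {\<omega>\<in>space M. emeasure (N \<omega>) A = of_nat k} = exp (- measure \<Lambda> A) * measure \<Lambda> A ^ k / fact k"
  using prm unfolding poisson_random_measure_def by blast

lemma noise_indep:
  "A ` {..<n} \<subseteq> sets \<Lambda> \<Longrightarrow> disjoint_family_on A {..<n} \<Longrightarrow>
    indep_vars (\<lambda>_. borel) (\<lambda>i \<omega>. emeasure (N \<omega>) (A i)) {..<(n::nat)}"
  using prm unfolding poisson_random_measure_def by blast

subsection \<open>The filtration\<close>

lemma space_filtration [simp]: "space (\<F> t) = space M"
  unfolding noise_filtration_def by (rule space_measure_of) auto

lemma sets_filtration:
  "sets (\<F> t) = sigma_sets (space M)
       {(\<lambda>\<omega>. emeasure (N \<omega>) A) -` B \<inter> space M | A B.
          A \<in> sets \<Lambda> \<and> A \<subseteq> {0..t} \<times> UNIV \<and> B \<in> sets borel}"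
  unfolding noise_filtration_def by (rule sets_measure_of) auto

lemma noise_adapted:
  assumes "A \<in> sets \<Lambda>" "A \<subseteq> {0..t} \<times> UNIV"
  shows "(\<lambda>\<omega>. emeasure (N \<omega>) A) \<in> borel_measurable (\<F> t)"
proof (rule measurableI)
  fix B :: "ennreal set" assume "B \<in> sets borel"
  then show "(\<lambda>\<omega>. emeasure (N \<omega>) A) -` B \<inter> space (\<F> t) \<in> sets (\<F> t)"
    unfolding sets_filtration space_filtration using assms by (intro sigma_sets.Basic) blast
qed auto

lemma filtration_mono:
  assumes "s \<le> t" shows "sets (\<F> s) \<subseteq> sets (\<F> t)"
  unfolding sets_filtration
proof (rule sigma_sets_mono', safe)
  fix A B assume "A \<in> sets \<Lambda>" "A \<subseteq> {0..s} \<times> UNIV" "B \<in> sets (borel :: ennreal measure)"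
  moreover have "{0..s} \<times> UNIV \<subseteq> {0..t} \<times> (UNIV :: ('a \<times> 'a) set)" using assms by auto
  ultimately show "\<exists>A' B'. (\<lambda>\<omega>. emeasure (N \<omega>) A) -` B \<inter> space M = (\<lambda>\<omega>. emeasure (N \<omega>) A') -` B' \<inter> space M \<and>
      A' \<in> sets \<Lambda> \<and> A' \<subseteq> {0..t} \<times> UNIV \<and> B' \<in> sets borel"
    by blast
qed

lemma filtration_events: "sets (\<F> t) \<subseteq> events"
  unfolding sets_filtration
  by (rule sets.sigma_sets_subset) (auto intro: measurable_sets noise_measurable)

lemma measurable_filtration_mono: "s \<le> t \<Longrightarrow> f \<in> borel_measurable (\<F> s) \<Longrightarrow> f \<in> borel_measurable (\<F> t)"
  using filtration_mono[of s t] by (auto simp: measurable_def)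

lemma measurable_filtration: "f \<in> borel_measurable (\<F> s) \<Longrightarrow> f \<in> borel_measurable M"
  using filtration_events[of s] by (auto simp: measurable_def)

text \<open>A finite family of sets is generated by the disjoint atoms that it cuts out, which reduces
  the independence of the past from an increment to the independence of finitely many
  disjoint increments.\<close>

lemma indep_future_atoms:
  fixes As :: "nat \<Rightarrow> (real \<times> 'a \<times> 'a) set"
  assumes As: "\<And>i. i < n \<Longrightarrow> As i \<in> sets \<Lambda>" "\<And>i. i < n \<Longrightarrow> As i \<subseteq> {0..a} \<times> UNIV"
    and A: "A \<in> sets \<Lambda>" "A \<subseteq> {a<..} \<times> UNIV"
    and Bs: "\<And>i. i < n \<Longrightarrow> Bs i \<in> sets (borel :: ennreal measure)" and B: "B \<in> sets (borel :: ennreal measure)"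
  shows "prob ({\<omega>\<in>space M. \<forall>i<n. emeasure (N \<omega>) (As i) \<in> Bs i} \<inter> {\<omega>\<in>space M. emeasure (N \<omega>) A \<in> B})
    = prob {\<omega>\<in>space M. \<forall>i<n. emeasure (N \<omega>) (As i) \<in> Bs i} * prob {\<omega>\<in>space M. emeasure (N \<omega>) A \<in> B}"
proof -
  obtain f where f: "bij_betw f {..<card (Pow {..<n})} (Pow {..<n})"
    using ex_bij_betw_nat_finite[of "Pow {..<n}"] by (auto simp: atLeast0LessThan)
  define m where "m = card (Pow {..<n})"
  \<comment> \<open>The atom of S consists of the points lying in exactly the sets
    \<open>As i\<close> with i in S. The slab matters for S = {}, whose atom would otherwise reach
    into the future.\<close>
  define D where "D S = (({0..a} \<times> UNIV) \<inter> (\<Inter>i\<in>S. As i)) - (\<Union>i\<in>{..<n} - S. As i)" for S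
  have D_sets: "D S \<in> sets \<Lambda>" if "S \<subseteq> {..<n}" for S
  proof -
    have "({0..a} \<times> UNIV) \<inter> (\<Inter>i\<in>S. As i) \<in> sets \<Lambda>"
    proof (cases "S = {}")
      case False
      then show ?thesis using that As(1) finite_subset[OF that]
        by (intro sets.Int slab_sets sets.finite_INT) auto
    qed (use slab_sets in simp)
    then show ?thesis unfolding D_def using As(1) by (intro sets.Diff sets.finite_UN) auto
  qed
  have D_disj: "D S \<inter> D S' = {}" if "S \<subseteq> {..<n}" "S' \<subseteq> {..<n}" "S \<noteq> S'" for S S'
    using that unfolding D_def by blast
  have As_eq: "As i = (\<Union>k\<in>{k\<in>{..<m}. i \<in> f k}. D (f k))" if "i < n" for i
  proof (intro equalityI subsetI)
    fix z assume z: "z \<in> As i"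
    define S where "S = {j. j < n \<and> z \<in> As j}"
    have "S \<in> Pow {..<n}" by (auto simp: S_def)
    then obtain k where k: "k < m" "f k = S"
      using f unfolding bij_betw_def m_def by (metis imageE lessThan_iff)
    have "z \<in> D (f k)" using z As(2)[OF that] unfolding k D_def S_def by auto
    moreover have "i \<in> f k" using k z that by (simp add: S_def)
    ultimately show "z \<in> (\<Union>k\<in>{k\<in>{..<m}. i \<in> f k}. D (f k))" using k by auto
  qed (auto simp: D_def)
  have fk: "f k \<subseteq> {..<n}" if "k < m" for k
    using f that unfolding bij_betw_def m_def by blast
  have f_inj: "f k \<noteq> f k'" if "k < m" "k' < m" "k \<noteq> k'" for k k'
    using f that unfolding bij_betw_def m_def inj_on_def by blast
  \<comment> \<open>The future set is appended with index m, so that past atoms and future form a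
    single family of disjoint sets.\<close>
  define X where "X k = (if k < m then D (f k) else A)" for k
  have ind: "indep_vars (\<lambda>_. borel) (\<lambda>i \<omega>. emeasure (N \<omega>) (X i)) {..<Suc m}"
  proof (rule noise_indep)
    show "X ` {..<Suc m} \<subseteq> sets \<Lambda>" using D_sets fk A by (auto simp: X_def simp del: sets_intensity)
    have "D S \<inter> A = {}" for S using A(2) by (auto simp: D_def)
    then show "disjoint_family_on X {..<Suc m}"
      unfolding disjoint_family_on_def X_def using D_disj[OF fk fk f_inj] by auto
  qed
  have iv: "indep_var (PiM {..<m} (\<lambda>_. borel)) (\<lambda>\<omega>. \<lambda>i\<in>{..<m}. emeasure (N \<omega>) (X i))
      (PiM {m} (\<lambda>_. borel)) (\<lambda>\<omega>. \<lambda>i\<in>{m}. emeasure (N \<omega>) (X i))"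
    by (rule indep_var_restrict[OF ind]) auto
  define C where "C = {v \<in> space (PiM {..<m} (\<lambda>_. borel)). \<forall>i\<in>{..<n}. (\<Sum>k\<in>{k\<in>{..<m}. i \<in> f k}. v k) \<in> Bs i}"
  have C: "C \<in> sets (PiM {..<m} (\<lambda>_. borel :: ennreal measure))"
    unfolding C_def
  proof (intro sets.sets_Collect_finite_All finite_lessThan)
    fix i assume "i \<in> {..<n}"
    have [measurable]: "Bs i \<in> sets borel" using Bs \<open>i \<in> {..<n}\<close> by auto
    have "(\<lambda>v. \<Sum>k\<in>{k\<in>{..<m}. i \<in> f k}. v k) \<in> borel_measurable (PiM {..<m} (\<lambda>_. borel :: ennreal measure))"
      by (intro borel_measurable_sum) simp
    then show "{v \<in> space (PiM {..<m} (\<lambda>_. borel)). (\<Sum>k\<in>{k\<in>{..<m}. i \<in> f k}. v k) \<in> Bs i} \<in> sets (PiM {..<m} (\<lambda>_. borel))"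
      by measurable
  qed
  define C' where "C' = {v \<in> space (PiM {m} (\<lambda>_. borel)). v m \<in> B}"
  have C': "C' \<in> sets (PiM {m} (\<lambda>_. borel :: ennreal measure))"
    unfolding C'_def using B by measurable
  have e1: "{\<omega>\<in>space M. \<forall>i<n. emeasure (N \<omega>) (As i) \<in> Bs i} = (\<lambda>\<omega>. \<lambda>i\<in>{..<m}. emeasure (N \<omega>) (X i)) -` C \<inter> space M"
  proof -
    have "emeasure (N \<omega>) (As i) = (\<Sum>k\<in>{k\<in>{..<m}. i \<in> f k}. emeasure (N \<omega>) (X k))" if "\<omega> \<in> space M" "i < n" for \<omega> i
    proof -
      have "emeasure (N \<omega>) (\<Union>k\<in>{k\<in>{..<m}. i \<in> f k}. D (f k)) = (\<Sum>k\<in>{k\<in>{..<m}. i \<in> f k}. emeasure (N \<omega>) (D (f k)))"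
      proof (rule sum_emeasure[symmetric])
        show "(\<lambda>k. D (f k)) ` {k\<in>{..<m}. i \<in> f k} \<subseteq> sets (N \<omega>)"
          using D_sets fk sets_noise[OF that(1)] by auto
        show "disjoint_family_on (\<lambda>k. D (f k)) {k\<in>{..<m}. i \<in> f k}"
          unfolding disjoint_family_on_def using D_disj[OF fk fk f_inj] by auto
      qed auto
      then show ?thesis using As_eq[OF that(2)] by (simp add: X_def)
    qed
    then show ?thesis by (auto simp: C_def space_PiM PiE_def)
  qed
  have e2: "{\<omega>\<in>space M. emeasure (N \<omega>) A \<in> B} = (\<lambda>\<omega>. \<lambda>i\<in>{m}. emeasure (N \<omega>) (X i)) -` C' \<inter> space M"
    by (auto simp: C'_def space_PiM PiE_def X_def)
  show ?thesis unfolding e1 e2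
    using C C' by (intro indep_setD[OF iv[unfolded indep_var_eq, THEN conjunct2]]) (auto intro!: sigma_sets.Basic)
qed

text \<open>Finite cylinder events form an intersection-stable generator of \<open>\<F> a\<close>,
  so independence on generators extends by Dynkin's theorem.\<close>

lemma indep_future:
  assumes A: "A \<in> sets \<Lambda>" "A \<subseteq> {a<..} \<times> UNIV"
  shows "indep_set (sets (\<F> a)) (sigma_sets (space M) {(\<lambda>\<omega>. emeasure (N \<omega>) A) -` B \<inter> space M | B. B \<in> sets borel})"
proof -
  define P where "P = {{\<omega>\<in>space M. \<forall>i<n. emeasure (N \<omega>) (As i) \<in> Bs i} | n As Bs.
     \<forall>i<(n::nat). As i \<in> sets \<Lambda> \<and> As i \<subseteq> {0..a} \<times> UNIV \<and> Bs i \<in> sets (borel :: ennreal measure)}"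
  define F where "F = {(\<lambda>\<omega>. emeasure (N \<omega>) A) -` B \<inter> space M | B. B \<in> sets (borel :: ennreal measure)}"
  have P_ev: "P \<subseteq> events"
  proof
    fix E assume "E \<in> P"
    then obtain n As Bs where E: "E = {\<omega>\<in>space M. \<forall>i\<in>{..<n}. emeasure (N \<omega>) (As i) \<in> Bs i}"
      and *: "\<forall>i<(n::nat). As i \<in> sets \<Lambda> \<and> Bs i \<in> sets (borel :: ennreal measure)" unfolding P_def by auto
    show "E \<in> events" unfolding E
    proof (intro sets.sets_Collect_finite_All finite_lessThan)
      fix i assume "i \<in> {..<n}"
      then have [measurable]: "As i \<in> sets \<Lambda>" "Bs i \<in> sets borel" using * by auto
      show "{\<omega> \<in> space M. emeasure (N \<omega>) (As i) \<in> Bs i} \<in> events" by measurable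
    qed
  qed
  have F_ev: "F \<subseteq> events" unfolding F_def using measurable_sets[OF noise_measurable[OF A(1)]] by auto
  have PF: "indep_set P F"
    unfolding indep_set_def
  proof (intro indep_setsI)
    fix i :: bool show "case_bool P F i \<subseteq> events" using P_ev F_ev by (cases i) auto
  next
    fix E J assume J: "J \<noteq> {}" "J \<subseteq> UNIV" "finite J" and E: "\<forall>j\<in>J. E j \<in> case_bool P F j"
    have "prob (E True \<inter> E False) = prob (E True) * prob (E False)" if "J = UNIV"
    proof -
      have "E True \<in> P" "E False \<in> F" using bspec[OF E, of True] bspec[OF E, of False] that by simp_all
      then obtain n As Bs B where *:
        "E True = {\<omega>\<in>space M. \<forall>i<n. emeasure (N \<omega>) (As i) \<in> Bs i}"
        "\<forall>i<(n::nat). As i \<in> sets \<Lambda> \<and> As i \<subseteq> {0..a} \<times> UNIV \<and> Bs i \<in> sets (borel :: ennreal measure)"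
        "E False = (\<lambda>\<omega>. emeasure (N \<omega>) A) -` B \<inter> space M" "B \<in> sets borel"
        unfolding P_def F_def by auto
      have "E False = {\<omega>\<in>space M. emeasure (N \<omega>) A \<in> B}" unfolding *(3) by auto
      then show ?thesis using indep_future_atoms[of n As a A Bs B] A * by simp
    qed
    moreover have "J = UNIV \<or> J = {True} \<or> J = {False}"
    proof -
      have "J \<in> Pow {False, True}" by auto
      then show ?thesis using J(1) by (auto simp: Pow_insert UNIV_bool)
    qed
    ultimately show "prob (\<Inter>j\<in>J. E j) = (\<Prod>j\<in>J. prob (E j))"
      by (elim disjE) (simp_all add: UNIV_bool Int_commute mult.commute)
  qed
  have P_st: "Int_stable P"
  proof (rule Int_stableI)
    fix E E' assume "E \<in> P" "E' \<in> P"
    then obtain n As Bs n' As' Bs' where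
      E: "E = {\<omega>\<in>space M. \<forall>i<n. emeasure (N \<omega>) (As i) \<in> Bs i}"
        "\<forall>i<(n::nat). As i \<in> sets \<Lambda> \<and> As i \<subseteq> {0..a} \<times> UNIV \<and> Bs i \<in> sets (borel :: ennreal measure)"
      and E': "E' = {\<omega>\<in>space M. \<forall>i<n'. emeasure (N \<omega>) (As' i) \<in> Bs' i}"
        "\<forall>i<(n'::nat). As' i \<in> sets \<Lambda> \<and> As' i \<subseteq> {0..a} \<times> UNIV \<and> Bs' i \<in> sets (borel :: ennreal measure)"
      unfolding P_def by auto
    define A2 where "A2 i = (if i < n then As i else As' (i - n))" for i
    define B2 where "B2 i = (if i < n then Bs i else Bs' (i - n))" for i
    have "E \<inter> E' = {\<omega>\<in>space M. \<forall>i<n+n'. emeasure (N \<omega>) (A2 i) \<in> B2 i}"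
    proof -
      have "(\<forall>i<n+n'. emeasure (N \<omega>) (A2 i) \<in> B2 i) \<longleftrightarrow>
         (\<forall>i<n. emeasure (N \<omega>) (As i) \<in> Bs i) \<and> (\<forall>i<n'. emeasure (N \<omega>) (As' i) \<in> Bs' i)" for \<omega>
      proof safe
        fix i assume *: "\<forall>i<n+n'. emeasure (N \<omega>) (A2 i) \<in> B2 i" and i: "i < n'"
        then show "emeasure (N \<omega>) (As' i) \<in> Bs' i" using spec[OF *, of "i + n"] by (simp add: A2_def B2_def)
      next
        fix i assume *: "\<forall>i<n+n'. emeasure (N \<omega>) (A2 i) \<in> B2 i" and i: "i < n"
        then show "emeasure (N \<omega>) (As i) \<in> Bs i" using spec[OF *, of i] by (simp add: A2_def B2_def)
      qed (auto simp: A2_def B2_def)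
      then show ?thesis unfolding E E' by auto
    qed
    moreover have "\<forall>i<n+n'. A2 i \<in> sets \<Lambda> \<and> A2 i \<subseteq> {0..a} \<times> UNIV \<and> B2 i \<in> sets (borel :: ennreal measure)"
      using E(2) E'(2) by (simp add: A2_def B2_def del: sets_intensity)
    ultimately show "E \<inter> E' \<in> P" unfolding P_def by blast
  qed
  have F_st: "Int_stable F"
  proof (rule Int_stableI)
    fix E E' assume "E \<in> F" "E' \<in> F"
    then obtain B B' where "E = (\<lambda>\<omega>. emeasure (N \<omega>) A) -` B \<inter> space M" "B \<in> sets borel"
      "E' = (\<lambda>\<omega>. emeasure (N \<omega>) A) -` B' \<inter> space M" "B' \<in> sets borel" unfolding F_def by auto
    then have "E \<inter> E' = (\<lambda>\<omega>. emeasure (N \<omega>) A) -` (B \<inter> B') \<inter> space M" "B \<inter> B' \<in> sets borel" by auto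
    then show "E \<inter> E' \<in> F" unfolding F_def by blast
  qed
  have "indep_set (sigma_sets (space M) P) (sigma_sets (space M) F)"
    by (rule indep_set_sigma_sets[OF PF P_st F_st])
  moreover have "sets (\<F> a) \<subseteq> sigma_sets (space M) P"
    unfolding sets_filtration
  proof (rule sigma_sets_mono', safe)
    fix C B assume "C \<in> sets \<Lambda>" "C \<subseteq> {0..a} \<times> UNIV" "B \<in> sets (borel :: ennreal measure)"
    then have "{\<omega>\<in>space M. \<forall>i<Suc 0. emeasure (N \<omega>) ((\<lambda>_. C) i) \<in> (\<lambda>_. B) i} \<in> P"
      unfolding P_def by (intro CollectI exI conjI refl) auto
    then show "(\<lambda>\<omega>. emeasure (N \<omega>) C) -` B \<inter> space M \<in> P"
      by (simp add: vimage_def Int_def conj_commute)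
  qed
  ultimately show ?thesis
    unfolding F_def[symmetric] indep_set_def
    by (elim indep_sets_mono_sets) (auto split: bool.splits)
qed

subsection \<open>Moments of the compensated noise\<close>

definition compensated :: "(real \<times> 'a \<times> 'a) set \<Rightarrow> 'w \<Rightarrow> real" where
  "compensated A \<omega> = measure (N \<omega>) A - measure \<Lambda> A"

lemma compensated_measurable [measurable]: "A \<in> sets \<Lambda> \<Longrightarrow> compensated A \<in> borel_measurable M"
  unfolding compensated_def[abs_def] Sigma_Algebra.measure_def
  by (intro borel_measurable_diff borel_measurable_const measurable_compose[OF noise_measurable borel_measurable_enn2real[OF measurable_ident]]) (simp_all add: id_def)

lemma compensated_adapted:
  assumes "A \<in> sets \<Lambda>" "A \<subseteq> {0..t} \<times> UNIV"
  shows "compensated A \<in> borel_measurable (\<F> t)"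
proof -
  note [measurable] = noise_adapted[OF assms]
  show ?thesis unfolding compensated_def[abs_def] Sigma_Algebra.measure_def by measurable
qed

context
  fixes A :: "(real \<times> 'a \<times> 'a) set"
  assumes A: "A \<in> sets \<Lambda>" "emeasure \<Lambda> A < \<infinity>"
begin

abbreviation "pois k \<equiv> exp (- measure \<Lambda> A) * measure \<Lambda> A ^ k / fact k"

lemma poisson_sums: "(\<lambda>k. pois k) sums 1"
proof -
  have "(\<lambda>k. exp (- measure \<Lambda> A) * (measure \<Lambda> A ^ k /\<^sub>R fact k)) sums (exp (- measure \<Lambda> A) * exp (measure \<Lambda> A))"
    by (intro sums_mult exp_converges)
  then show ?thesis by (simp add: field_simps exp_minus)
qed

text \<open>The identity \<open>real (Suc k) * pois (Suc k) = measure \<Lambda> A * pois k\<close>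
  shifts the series by one index, and the term at k = 0 vanishes.\<close>

lemma poisson_sums1: "(\<lambda>k. real k * pois k) sums measure \<Lambda> A"
proof -
  have "(\<lambda>k. measure \<Lambda> A * pois k) sums (measure \<Lambda> A * 1)"
    by (intro sums_mult poisson_sums)
  also have "(\<lambda>k. measure \<Lambda> A * pois k) = (\<lambda>k. real (Suc k) * pois (Suc k))"
    by (auto simp: field_simps simp del: of_nat_Suc)
  finally show ?thesis by (subst (asm) sums_Suc_iff) simp
qed

lemma poisson_sums2: "(\<lambda>k. (real k)\<^sup>2 * pois k) sums (measure \<Lambda> A + (measure \<Lambda> A)\<^sup>2)"
proof -
  have "(\<lambda>k. measure \<Lambda> A * pois k + measure \<Lambda> A * (real k * pois k)) sums (measure \<Lambda> A * 1 + measure \<Lambda> A * measure \<Lambda> A)"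
    by (intro sums_mult sums_add poisson_sums poisson_sums1)
  also have "(\<lambda>k. measure \<Lambda> A * pois k + measure \<Lambda> A * (real k * pois k)) = (\<lambda>k. (real (Suc k))\<^sup>2 * pois (Suc k))"
  proof
    fix k
    have gen: "l * q + l * (real k * q) = (real (Suc k))\<^sup>2 * p" if "p * real (Suc k) = l * q" for p q l :: real
    proof -
      have "(real (Suc k))\<^sup>2 * p = real (Suc k) * (p * real (Suc k))" by (simp only: power2_eq_square mult_ac)
      then show ?thesis unfolding that by (simp add: algebra_simps)
    qed
    show "measure \<Lambda> A * pois k + measure \<Lambda> A * (real k * pois k) = (real (Suc k))\<^sup>2 * pois (Suc k)"
      by (rule gen) (auto simp: field_simps simp del: of_nat_Suc)
  qed
  finally show ?thesis by (subst (asm) sums_Suc_iff) (simp add: power2_eq_square)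
qed

text \<open>The law of N(A) is given only through the probabilities of the natural numbers; as these
  sum to 1, all other values, infinity included, have probability 0.\<close>

lemma noise_AE_nat: "AE \<omega> in M. \<exists>k. emeasure (N \<omega>) A = of_nat k"
proof -
  define E where "E k = {\<omega>\<in>space M. emeasure (N \<omega>) A = of_nat k}" for k :: nat
  have ev: "E k \<in> events" for k
    unfolding E_def using noise_measurable[OF A(1)] by measurable
  have "(\<lambda>k. prob (E k)) sums prob (\<Union>k. E k)"
    by (intro finite_measure_UNION) (auto simp: ev, auto simp: E_def disjoint_family_on_def)
  moreover have "(\<lambda>k. prob (E k)) sums 1"
    using poisson_sums noise_poisson[OF A] by (simp add: E_def)
  ultimately have "prob (\<Union>k. E k) = 1" using sums_unique2 by blast
  then have "AE \<omega> in M. \<omega> \<in> (\<Union>k. E k)" by (rule AE_prob_1)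
  then show ?thesis by eventually_elim (auto simp: E_def)
qed

lemma noise_AE_finite: "AE \<omega> in M. emeasure (N \<omega>) A < \<infinity>"
  using noise_AE_nat by eventually_elim (auto simp: of_nat_less_top)

text \<open>As N(A) is almost surely a natural number, the expectation is a series over its
  values.\<close>

lemma nn_integral_noise:
  assumes h: "\<And>k. 0 \<le> h (real k)" and S: "(\<lambda>k. h (real k) * pois k) sums S"
  shows "(\<integral>\<^sup>+\<omega>. ennreal (h (measure (N \<omega>) A)) \<partial>M) = ennreal S"
proof -
  define E where "E k = {\<omega>\<in>space M. emeasure (N \<omega>) A = of_nat k}" for k :: nat
  have ev [measurable]: "E k \<in> events" for k
    unfolding E_def using noise_measurable[OF A(1)] by measurable
  have "AE \<omega> in M. ennreal (h (measure (N \<omega>) A)) = (\<Sum>k. ennreal (h (real k)) * indicator (E k) \<omega>)"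
    using noise_AE_nat
  proof (rule AE_mp, intro AE_I2 impI)
    fix \<omega> assume w: "\<omega> \<in> space M" and "\<exists>k. emeasure (N \<omega>) A = of_nat k"
    then obtain k where k: "emeasure (N \<omega>) A = of_nat k" by auto
    have "(\<Sum>j. ennreal (h (real j)) * indicator (E j) \<omega>) = (\<Sum>j\<in>{k}. ennreal (h (real j)) * indicator (E j) \<omega>)"
      by (rule suminf_finite) (auto simp: E_def k indicator_def)
    then show "ennreal (h (measure (N \<omega>) A)) = (\<Sum>k. ennreal (h (real k)) * indicator (E k) \<omega>)"
      using w k by (simp add: E_def measure_def)
  qed
  then have "(\<integral>\<^sup>+\<omega>. ennreal (h (measure (N \<omega>) A)) \<partial>M) = (\<integral>\<^sup>+\<omega>. (\<Sum>k. ennreal (h (real k)) * indicator (E k) \<omega>) \<partial>M)"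
    by (rule nn_integral_cong_AE)
  also have "\<dots> = (\<Sum>k. \<integral>\<^sup>+\<omega>. ennreal (h (real k)) * indicator (E k) \<omega> \<partial>M)"
    by (rule nn_integral_suminf) simp
  also have "\<dots> = (\<Sum>k. ennreal (h (real k)) * emeasure M (E k))"
    by (simp add: nn_integral_cmult_indicator)
  also have "\<dots> = (\<Sum>k. ennreal (h (real k) * pois k))"
    using noise_poisson[OF A, folded E_def] h
    by (simp add: emeasure_eq_measure ennreal_mult' del: times_divide_eq_right)
  also have "\<dots> = ennreal S"
    by (rule suminf_ennreal_eq[OF _ S]) (simp add: h)
  finally show ?thesis .
qed

text \<open>With l the intensity of A, the three Poisson series combine to (l + l^2) - 2 * l^2 + l^2
  = l.\<close>

lemma compensated_sq: "has_bochner_integral M (\<lambda>\<omega>. (compensated A \<omega>)\<^sup>2) (measure \<Lambda> A)"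
proof -
  let ?l = "measure \<Lambda> A"
  have "(\<lambda>k. (real k)\<^sup>2 * pois k - 2 * ?l * (real k * pois k) + ?l\<^sup>2 * pois k) sums ((?l + ?l\<^sup>2) - 2 * ?l * ?l + ?l\<^sup>2 * 1)"
    by (intro sums_add sums_diff sums_mult poisson_sums poisson_sums1 poisson_sums2)
  moreover have "(real k)\<^sup>2 * pois k - 2 * ?l * (real k * pois k) + ?l\<^sup>2 * pois k = (real k - ?l)\<^sup>2 * pois k" for k
  proof -
    have gen: "(real k)\<^sup>2 * p - 2 * l * (real k * p) + l\<^sup>2 * p = (real k - l)\<^sup>2 * p" for l p :: real
      by (simp add: power2_eq_square algebra_simps)
    show ?thesis by (rule gen)
  qed
  ultimately have "(\<lambda>k. (\<lambda>r. (r - ?l)\<^sup>2) (real k) * pois k) sums ?l"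
    by (simp add: power2_eq_square)
  from nn_integral_noise[OF _ this] show ?thesis
    by (intro has_bochner_integral_nn_integral) (use A(1) in \<open>auto simp: compensated_def[symmetric]\<close>)
qed

lemma compensated_expectation: "has_bochner_integral M (compensated A) 0"
proof -
  have "has_bochner_integral M (\<lambda>\<omega>. measure (N \<omega>) A) (measure \<Lambda> A)"
  proof (rule has_bochner_integral_nn_integral)
    show "(\<integral>\<^sup>+\<omega>. ennreal (measure (N \<omega>) A) \<partial>M) = ennreal (measure \<Lambda> A)"
      by (rule nn_integral_noise) (use poisson_sums1 in auto)
    show "(\<lambda>\<omega>. measure (N \<omega>) A) \<in> borel_measurable M"
      unfolding Sigma_Algebra.measure_def using noise_measurable[OF A(1)] by measurable
  qed auto
  moreover have "has_bochner_integral M (\<lambda>\<omega>. measure \<Lambda> A) (measure \<Lambda> A)"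
    using has_bochner_integral_integrable[of M "\<lambda>\<omega>. measure \<Lambda> A"] by (simp add: prob_space)
  ultimately show ?thesis
    unfolding compensated_def[abs_def] using has_bochner_integral_diff by fastforce
qed

end

text \<open>Almost surely only: \<open>measure\<close> sends infinite mass to 0, so additivity needs
  both values of the noise to be finite.\<close>

lemma compensated_Un:
  assumes "A \<in> sets \<Lambda>" "emeasure \<Lambda> A < \<infinity>" "B \<in> sets \<Lambda>" "emeasure \<Lambda> B < \<infinity>" "A \<inter> B = {}"
  shows "AE \<omega> in M. compensated (A \<union> B) \<omega> = compensated A \<omega> + compensated B \<omega>"
  using noise_AE_finite[OF assms(1,2)] noise_AE_finite[OF assms(3,4)]
proof (rule AE_mp[OF AE_conjI], intro AE_I2 impI)
  fix \<omega> assume w: "\<omega> \<in> space M" "emeasure (N \<omega>) A < \<infinity> \<and> emeasure (N \<omega>) B < \<infinity>"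
  then show "compensated (A \<union> B) \<omega> = compensated A \<omega> + compensated B \<omega>"
    using assms sets_noise[OF w(1)] unfolding compensated_def
    by (subst (1 2) measure_Union) (auto simp del: sets_intensity)
qed

lemma indep_past_increment:
  assumes A: "A \<in> sets \<Lambda>" "A \<subseteq> {a<..} \<times> UNIV"
    and U: "U \<in> borel_measurable (\<F> a)" "integrable M U"
    and f: "f \<in> borel_measurable borel" "has_bochner_integral M (\<lambda>\<omega>. f (emeasure (N \<omega>) A)) c"
  shows "has_bochner_integral M (\<lambda>\<omega>. U \<omega> * (f (emeasure (N \<omega>) A) :: real)) (expectation U * c)"
proof -
  have iv: "indep_var borel U borel (\<lambda>\<omega>. f (emeasure (N \<omega>) A))"
    unfolding indep_var_eq
  proof (intro conjI)
    show Um: "U \<in> borel_measurable M" using U(1) by (rule measurable_filtration)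
    show fm: "(\<lambda>\<omega>. f (emeasure (N \<omega>) A)) \<in> borel_measurable M"
      using f(1) noise_measurable[OF A(1)] by measurable
    have 1: "sigma_sets (space M) {U -` B \<inter> space M | B. B \<in> sets borel} \<subseteq> sets (\<F> a)"
      using sets.sigma_sets_subset[of "{U -` B \<inter> space M | B. B \<in> sets borel}" "\<F> a"] measurable_sets[OF U(1)]
      by auto
    have 2: "sigma_sets (space M) {(\<lambda>\<omega>. f (emeasure (N \<omega>) A)) -` B \<inter> space M | B. B \<in> sets borel}
        \<subseteq> sigma_sets (space M) {(\<lambda>\<omega>. emeasure (N \<omega>) A) -` B \<inter> space M | B. B \<in> sets borel}"
    proof (rule sigma_sets_mono', safe)
      fix B :: "real set" assume "B \<in> sets borel"
      then have "f -` B \<in> sets borel" using f(1) by (metis measurable_sets_borel)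
      then show "\<exists>B'. (\<lambda>\<omega>. f (emeasure (N \<omega>) A)) -` B \<inter> space M = (\<lambda>\<omega>. emeasure (N \<omega>) A) -` B' \<inter> space M \<and> B' \<in> sets borel"
        by (intro exI[of _ "f -` B"]) auto
    qed
    show "indep_set (sigma_sets (space M) {U -` A \<inter> space M |A. A \<in> sets borel})
     (sigma_sets (space M) {(\<lambda>\<omega>. f (emeasure (N \<omega>) A)) -` Aa \<inter> space M |Aa. Aa \<in> sets borel})"
      using indep_future[OF A] 1 2 unfolding indep_set_def
      by (elim indep_sets_mono_sets) (simp split: bool.split)
  qed
  show ?thesis
    using indep_var_integrable[OF iv U(2)] indep_var_lebesgue_integral[OF iv U(2)] f(2)
    by (auto simp: has_bochner_integral_iff)
qed

text \<open>The martingale property and the conditional variance of the noise, tested against a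
  variable U known at time a.\<close>

lemma past_compensated:
  assumes A: "A \<in> sets \<Lambda>" "emeasure \<Lambda> A < \<infinity>" "A \<subseteq> {a<..} \<times> UNIV"
    and U: "U \<in> borel_measurable (\<F> a)" "integrable M U"
  shows "has_bochner_integral M (\<lambda>\<omega>. U \<omega> * compensated A \<omega>) 0"
    and "has_bochner_integral M (\<lambda>\<omega>. U \<omega> * (compensated A \<omega>)\<^sup>2) (expectation U * measure \<Lambda> A)"
proof -
  note * = indep_past_increment[OF A(1,3) U]
  show "has_bochner_integral M (\<lambda>\<omega>. U \<omega> * compensated A \<omega>) 0"
    using *[of "\<lambda>e. enn2real e - measure \<Lambda> A" 0] compensated_expectation[OF A(1,2)]
    by (simp add: compensated_def[abs_def] Sigma_Algebra.measure_def)
  show "has_bochner_integral M (\<lambda>\<omega>. U \<omega> * (compensated A \<omega>)\<^sup>2) (expectation U * measure \<Lambda> A)"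
    using *[of "\<lambda>e. (enn2real e - measure \<Lambda> A)\<^sup>2"] compensated_sq[OF A(1,2)]
    by (simp add: compensated_def[abs_def] Sigma_Algebra.measure_def)
qed

text \<open>By polarization the mixed moments over disjoint sets follow from the second moments, so that
  only one increment at a time has to be independent of the past.\<close>

lemma past_compensated_disjoint:
  assumes A: "A \<in> sets \<Lambda>" "emeasure \<Lambda> A < \<infinity>" "A \<subseteq> {a<..} \<times> UNIV"
    and B: "B \<in> sets \<Lambda>" "emeasure \<Lambda> B < \<infinity>" "B \<subseteq> {a<..} \<times> UNIV" and disj: "A \<inter> B = {}"
    and U: "U \<in> borel_measurable (\<F> a)" "integrable M U"
  shows "has_bochner_integral M (\<lambda>\<omega>. U \<omega> * compensated A \<omega> * compensated B \<omega>) 0"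
proof -
  have AB: "A \<union> B \<in> sets \<Lambda>" "emeasure \<Lambda> (A \<union> B) < \<infinity>" "A \<union> B \<subseteq> {a<..} \<times> UNIV"
    using A B emeasure_subadditive[of A \<Lambda> B]
    by (auto intro: le_less_trans simp: ennreal_add_less_top simp del: sets_intensity)
  have m: "measure \<Lambda> (A \<union> B) = measure \<Lambda> A + measure \<Lambda> B"
    using A B disj by (intro measure_Union) (auto simp del: sets_intensity)
  have "has_bochner_integral M (\<lambda>\<omega>. (1/2) * (U \<omega> * (compensated (A \<union> B) \<omega>)\<^sup>2 - U \<omega> * (compensated A \<omega>)\<^sup>2 - U \<omega> * (compensated B \<omega>)\<^sup>2))
     ((1/2) * (expectation U * measure \<Lambda> (A \<union> B) - expectation U * measure \<Lambda> A - expectation U * measure \<Lambda> B))"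
    by (intro has_bochner_integral_mult_right has_bochner_integral_diff past_compensated(2)[where a=a] A B AB U)
  also have "(1/2) * (expectation U * measure \<Lambda> (A \<union> B) - expectation U * measure \<Lambda> A - expectation U * measure \<Lambda> B) = 0"
    unfolding m by (simp add: algebra_simps)
  finally show ?thesis
  proof (subst has_bochner_integral_cong_AE)
    note [measurable] = measurable_filtration[OF U(1)] compensated_measurable[OF A(1)] compensated_measurable[OF B(1)]
      compensated_measurable[OF AB(1)]
    show "(\<lambda>\<omega>. U \<omega> * compensated A \<omega> * compensated B \<omega>) \<in> borel_measurable M" by measurable
    show "(\<lambda>\<omega>. (1/2) * (U \<omega> * (compensated (A \<union> B) \<omega>)\<^sup>2 - U \<omega> * (compensated A \<omega>)\<^sup>2 - U \<omega> * (compensated B \<omega>)\<^sup>2)) \<in> borel_measurable M" by measurable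
    show "AE \<omega> in M. U \<omega> * compensated A \<omega> * compensated B \<omega> =
      (1/2) * (U \<omega> * (compensated (A \<union> B) \<omega>)\<^sup>2 - U \<omega> * (compensated A \<omega>)\<^sup>2 - U \<omega> * (compensated B \<omega>)\<^sup>2)"
      using compensated_Un[OF A(1,2) B(1,2) disj] by eventually_elim (simp add: power2_eq_square algebra_simps)
  qed
qed

text \<open>A and B are cut into their common part and the two differences. Products over disjoint
  parts have mean 0, so only the square over \<open>A \<inter> B\<close> remains.\<close>

lemma past_compensated_mult:
  assumes A: "A \<in> sets \<Lambda>" "emeasure \<Lambda> A < \<infinity>" "A \<subseteq> {a<..} \<times> UNIV"
    and B: "B \<in> sets \<Lambda>" "emeasure \<Lambda> B < \<infinity>" "B \<subseteq> {a<..} \<times> UNIV"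
    and U: "U \<in> borel_measurable (\<F> a)" "integrable M U"
  shows "has_bochner_integral M (\<lambda>\<omega>. U \<omega> * compensated A \<omega> * compensated B \<omega>) (expectation U * measure \<Lambda> (A \<inter> B))"
proof -
  let ?C = "A \<inter> B" and ?D = "A - B" and ?E = "B - A"
  have fin: "emeasure \<Lambda> S < \<infinity>" if "S \<subseteq> A \<or> S \<subseteq> B" for S
    using that emeasure_mono[of S A \<Lambda>] emeasure_mono[of S B \<Lambda>] A B
    by (auto intro: le_less_trans simp del: sets_intensity)
  have C: "?C \<in> sets \<Lambda>" "emeasure \<Lambda> ?C < \<infinity>" "?C \<subseteq> {a<..} \<times> UNIV"
    and D: "?D \<in> sets \<Lambda>" "emeasure \<Lambda> ?D < \<infinity>" "?D \<subseteq> {a<..} \<times> UNIV"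
    and E: "?E \<in> sets \<Lambda>" "emeasure \<Lambda> ?E < \<infinity>" "?E \<subseteq> {a<..} \<times> UNIV"
    using A B by (auto intro!: fin[unfolded infinity_ennreal_def] simp del: sets_intensity)
  have "has_bochner_integral M (\<lambda>\<omega>. U \<omega> * (compensated ?C \<omega>)\<^sup>2 + U \<omega> * compensated ?C \<omega> * compensated ?E \<omega>
      + U \<omega> * compensated ?C \<omega> * compensated ?D \<omega> + U \<omega> * compensated ?D \<omega> * compensated ?E \<omega>)
      (expectation U * measure \<Lambda> ?C + 0 + 0 + 0)"
    by (intro has_bochner_integral_add past_compensated(2)[where a=a] past_compensated_disjoint[where a=a] C D E U) auto
  then show ?thesis
  proof (subst has_bochner_integral_cong_AE)
    note [measurable] = measurable_filtration[OF U(1)] compensated_measurable[OF A(1)] compensated_measurable[OF B(1)]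
      compensated_measurable[OF C(1)] compensated_measurable[OF D(1)] compensated_measurable[OF E(1)]
    show "(\<lambda>\<omega>. U \<omega> * compensated A \<omega> * compensated B \<omega>) \<in> borel_measurable M" by measurable
    show "(\<lambda>\<omega>. U \<omega> * (compensated ?C \<omega>)\<^sup>2 + U \<omega> * compensated ?C \<omega> * compensated ?E \<omega>
      + U \<omega> * compensated ?C \<omega> * compensated ?D \<omega> + U \<omega> * compensated ?D \<omega> * compensated ?E \<omega>) \<in> borel_measurable M"
      by measurable
    have "AE \<omega> in M. compensated (?C \<union> ?D) \<omega> = compensated ?C \<omega> + compensated ?D \<omega>"
      by (rule compensated_Un[OF C(1,2) D(1,2)]) auto
    moreover have "AE \<omega> in M. compensated (?C \<union> ?E) \<omega> = compensated ?C \<omega> + compensated ?E \<omega>"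
      by (rule compensated_Un[OF C(1,2) E(1,2)]) auto
    moreover have "?C \<union> ?D = A" "?C \<union> ?E = B" by auto
    ultimately have "AE \<omega> in M. compensated A \<omega> = compensated ?C \<omega> + compensated ?D \<omega>"
      "AE \<omega> in M. compensated B \<omega> = compensated ?C \<omega> + compensated ?E \<omega>" by simp_all
    then show "AE \<omega> in M. U \<omega> * compensated A \<omega> * compensated B \<omega> =
      U \<omega> * (compensated ?C \<omega>)\<^sup>2 + U \<omega> * compensated ?C \<omega> * compensated ?E \<omega>
      + U \<omega> * compensated ?C \<omega> * compensated ?D \<omega> + U \<omega> * compensated ?D \<omega> * compensated ?E \<omega>"
    proof eventually_elim
      case (elim \<omega>)
      show ?case unfolding elim by (simp add: power2_eq_square algebra_simps)
    qed
  qed simp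
qed

subsection \<open>Elementary processes\<close>

definition term_set :: "('w \<Rightarrow> real) \<times> real \<times> real \<times> ('a \<times> 'a) set \<Rightarrow> (real \<times> 'a \<times> 'a) set" where
  "term_set e = (case e of (Y, a, b, B) \<Rightarrow> {a<..b} \<times> B)"

lemma elementary_integral_sum:
  "elementary_integral \<mu> N es \<omega> = (\<Sum>i<length es. fst (es ! i) \<omega> * compensated (term_set (es ! i)) \<omega>)"
  unfolding elementary_integral_def sum_list_sum_nth atLeast0LessThan
  by (auto intro!: sum.cong simp: term_set_def compensated_def split: prod.splits)

lemma elementary_process_sum:
  "elementary_process es s x h \<omega> = (\<Sum>i<length es. fst (es ! i) \<omega> * indicator (term_set (es ! i)) (s, x, h))"
proof -
  have "(case e of (Y, a, b, B) \<Rightarrow> Y \<omega> * indicator {a<..b} s * indicator B (x, h)) = fst e \<omega> * indicator (term_set e) (s, x, h)" for e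
    by (cases e) (simp add: term_set_def indicator_times)
  then show ?thesis
    unfolding elementary_process_def sum_list_sum_nth atLeast0LessThan by (intro sum.cong) (simp_all only: length_map nth_map lessThan_iff)
qed

lemma elementary_Nil: "elementary M \<mu> N []"
  by (simp add: elementary_def)

lemma elementary_integral_append:
  "elementary_integral \<mu> N (es @ es') \<omega> = elementary_integral \<mu> N es \<omega> + elementary_integral \<mu> N es' \<omega>"
  by (simp add: elementary_integral_def)

lemma elementary_process_append:
  "elementary_process (es @ es') s x h \<omega> = elementary_process es s x h \<omega> + elementary_process es' s x h \<omega>"
  by (simp add: elementary_process_def)

lemma elementary_append: "elementary M \<mu> N es \<Longrightarrow> elementary M \<mu> N es' \<Longrightarrow> elementary M \<mu> N (es @ es')"
  by (auto simp: elementary_def)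

definition elementary_scale :: "real \<Rightarrow> ('w, 'a) elementary \<Rightarrow> ('w, 'a) elementary" where
  "elementary_scale c es = map (\<lambda>(Y, a, b, B). (\<lambda>\<omega>. c * Y \<omega>, a, b, B)) es"

lemma elementary_integral_scale:
  "elementary_integral \<mu> N (elementary_scale c es) \<omega> = c * elementary_integral \<mu> N es \<omega>"
  unfolding elementary_integral_def elementary_scale_def
  by (induction es) (auto simp: algebra_simps)

lemma elementary_process_scale:
  "elementary_process (elementary_scale c es) s x h \<omega> = c * elementary_process es s x h \<omega>"
  unfolding elementary_process_def elementary_scale_def
  by (induction es) (auto simp: algebra_simps)

lemma elementary_elementary_scale:
  assumes "elementary M \<mu> N es" shows "elementary M \<mu> N (elementary_scale c es)"
proof -
  have "bounded ((\<lambda>\<omega>. c * Y \<omega>) ` space M)" if "bounded (Y ` space M)" for Y :: "'w \<Rightarrow> real"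
    using bounded_scaling[OF that, of c] by (simp add: image_image)
  then show ?thesis
    using assms unfolding elementary_def elementary_scale_def by (fastforce split: prod.splits)
qed

definition past_term :: "('w \<Rightarrow> real) \<times> real \<times> real \<times> ('a \<times> 'a) set \<Rightarrow> bool" where
  "past_term e \<longleftrightarrow> (case e of (Y, a, b, B) \<Rightarrow> 0 \<le> a \<and> a < b \<and> Y \<in> borel_measurable (\<F> a) \<and>
        bounded (Y ` space M) \<and> B \<in> sets marks \<and> emeasure marks B < \<infinity>)"

lemma elementary_iff: "elementary M \<mu> N es \<longleftrightarrow> (\<forall>e\<in>set es. past_term e)"
  unfolding elementary_def past_term_def by simp

lemma finite_cylinder:
  assumes "0 \<le> a" "B \<in> sets marks" "emeasure marks B < \<infinity>"
  shows "{a<..b} \<times> B \<in> sets \<Lambda>" "emeasure \<Lambda> ({a<..b} \<times> B) < \<infinity>"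
proof -
  show "{a<..b} \<times> B \<in> sets \<Lambda>" using assms(1,2) unfolding sets_marks by (rule cylinder_sets)
  show "emeasure \<Lambda> ({a<..b} \<times> B) < \<infinity>"
  proof (cases "a \<le> b")
    case True
    then show ?thesis using emeasure_cylinder[OF assms(1) True assms(2)[unfolded sets_marks]] assms(3)
      by (auto simp: ennreal_mult_less_top)
  qed simp
qed

lemma past_term_set:
  "past_term e \<Longrightarrow> term_set e \<in> sets \<Lambda>" "past_term e \<Longrightarrow> emeasure \<Lambda> (term_set e) < \<infinity>"
  unfolding past_term_def term_set_def using finite_cylinder by (auto split: prod.splits simp del: sets_intensity)

text \<open>The earlier cylinder is cut at a', where the later one starts. Its part up to a' is
  known at time a' and joins the coefficients in \<open>U1\<close>, which multiplies an increment of
  mean 0; only the part after a' correlates with the later cylinder.\<close>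

lemma covariance_ordered:
  assumes e: "past_term (Y, a, b, B)" and e': "past_term (Y', a', b', B')" and aa': "a \<le> a'"
  shows "has_bochner_integral M (\<lambda>\<omega>. (Y \<omega> * compensated ({a<..b} \<times> B) \<omega>) * (Y' \<omega> * compensated ({a'<..b'} \<times> B') \<omega>))
     (expectation (\<lambda>\<omega>. Y \<omega> * Y' \<omega>) * measure \<Lambda> ({a<..b} \<times> B \<inter> {a'<..b'} \<times> B'))"
proof -
  \<comment> \<open>If the earlier cylinder ends before a', the minimum makes \<open>?A1\<close> all
    of it, and \<open>?A2\<close> is empty.\<close>
  define m where "m = min b a'"
  let ?A = "{a<..b} \<times> B" and ?A1 = "{a<..m} \<times> B" and ?A2 = "{a'<..b} \<times> B" and ?A' = "{a'<..b'} \<times> B'"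
  have p: "0 \<le> a" "a < b" "Y \<in> borel_measurable (\<F> a)" "bounded (Y ` space M)" "B \<in> sets marks" "emeasure marks B < \<infinity>"
    and p': "0 \<le> a'" "a' < b'" "Y' \<in> borel_measurable (\<F> a')" "bounded (Y' ` space M)" "B' \<in> sets marks" "emeasure marks B' < \<infinity>"
    using e e' by (auto simp: past_term_def)
  note A = finite_cylinder[OF p(1,5,6), of b] and A1 = finite_cylinder[OF p(1,5,6), of m]
    and A2 = finite_cylinder[OF p'(1) p(5,6), of b] and A' = finite_cylinder[OF p'(1,5,6), of b']
  have fut: "?A2 \<subseteq> {a'<..} \<times> UNIV" "?A' \<subseteq> {a'<..} \<times> UNIV" by auto
  have YM: "Y \<in> borel_measurable M" "Y' \<in> borel_measurable M" using p p' by (auto intro: measurable_filtration)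
  have YF: "Y \<in> borel_measurable (\<F> a')" using measurable_filtration_mono[OF aa' p(3)] .
  have A1F: "compensated ?A1 \<in> borel_measurable (\<F> a')"
    by (rule compensated_adapted[OF A1(1)]) (use p(1) in \<open>auto simp: m_def\<close>)
  define U1 where "U1 \<omega> = Y \<omega> * (Y' \<omega> * compensated ?A1 \<omega>)" for \<omega>
  define U2 where "U2 \<omega> = Y \<omega> * Y' \<omega>" for \<omega>
  have U1: "U1 \<in> borel_measurable (\<F> a')" "integrable M U1"
    unfolding U1_def[abs_def] using YF p'(3) A1F compensated_expectation[OF A1] YM p p'
    by (auto intro!: borel_measurable_times integrable_bounded_mult simp: has_bochner_integral_iff)
  have "integrable M (\<lambda>\<omega>. Y \<omega> * (Y' \<omega> * 1))"
    using YM p p' by (intro integrable_bounded_mult) auto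
  then have U2: "U2 \<in> borel_measurable (\<F> a')" "integrable M U2"
    unfolding U2_def[abs_def] using YF p'(3) by auto
  have "has_bochner_integral M (\<lambda>\<omega>. U1 \<omega> * compensated ?A' \<omega> + U2 \<omega> * compensated ?A2 \<omega> * compensated ?A' \<omega>)
      (0 + expectation U2 * measure \<Lambda> (?A2 \<inter> ?A'))"
    by (intro has_bochner_integral_add past_compensated(1)[where a=a'] past_compensated_mult[where a=a'] A' A2 fut U1 U2)
  also have "0 + expectation U2 * measure \<Lambda> (?A2 \<inter> ?A') = expectation (\<lambda>\<omega>. Y \<omega> * Y' \<omega>) * measure \<Lambda> (?A \<inter> ?A')"
  proof -
    have "?A2 \<inter> ?A' = ?A \<inter> ?A'" using aa' by auto
    moreover have "U2 = (\<lambda>\<omega>. Y \<omega> * Y' \<omega>)" by (rule ext) (rule U2_def)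
    ultimately show ?thesis by (simp only: add_0)
  qed
  finally show ?thesis
  proof (subst has_bochner_integral_cong_AE)
    note [measurable] = YM compensated_measurable[OF A(1)] compensated_measurable[OF A1(1)]
      compensated_measurable[OF A2(1)] compensated_measurable[OF A'(1)]
    show "(\<lambda>\<omega>. (Y \<omega> * compensated ?A \<omega>) * (Y' \<omega> * compensated ?A' \<omega>)) \<in> borel_measurable M" by measurable
    show "(\<lambda>\<omega>. U1 \<omega> * compensated ?A' \<omega> + U2 \<omega> * compensated ?A2 \<omega> * compensated ?A' \<omega>) \<in> borel_measurable M"
      unfolding U1_def U2_def by measurable
    have "AE \<omega> in M. compensated (?A1 \<union> ?A2) \<omega> = compensated ?A1 \<omega> + compensated ?A2 \<omega>"
      by (rule compensated_Un[OF A1 A2]) (auto simp: m_def)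
    moreover have "?A1 \<union> ?A2 = ?A" using aa' by (auto simp: m_def)
    ultimately have "AE \<omega> in M. compensated ?A \<omega> = compensated ?A1 \<omega> + compensated ?A2 \<omega>" by simp
    then show "AE \<omega> in M. (Y \<omega> * compensated ?A \<omega>) * (Y' \<omega> * compensated ?A' \<omega>) =
       U1 \<omega> * compensated ?A' \<omega> + U2 \<omega> * compensated ?A2 \<omega> * compensated ?A' \<omega>"
    proof eventually_elim
      case (elim \<omega>)
      show ?case unfolding elim U1_def U2_def by (simp add: algebra_simps)
    qed
  qed
qed

lemma covariance:
  assumes "past_term e" and "past_term e'"
  shows "has_bochner_integral M (\<lambda>\<omega>. (fst e \<omega> * compensated (term_set e) \<omega>) * (fst e' \<omega> * compensated (term_set e') \<omega>))
     (expectation (\<lambda>\<omega>. fst e \<omega> * fst e' \<omega>) * measure \<Lambda> (term_set e \<inter> term_set e'))"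
proof -
  obtain Y a b B where [simp]: "e = (Y, a, b, B)" by (rule prod_cases4)
  obtain Y' a' b' B' where [simp]: "e' = (Y', a', b', B')" by (rule prod_cases4)
  show ?thesis
  proof (cases "a \<le> a'")
    case True
    then show ?thesis using covariance_ordered[of Y a b B Y' a' b' B'] assms by (simp add: term_set_def)
  next
    case False
    then show ?thesis using covariance_ordered[of Y' a' b' B' Y a b B] assms
      by (simp add: term_set_def mult.commute Int_commute)
  qed
qed

lemma pair_sigma_finite_Q: "pair_sigma_finite M \<Lambda>"
  unfolding pair_sigma_finite_def by (intro conjI sigma_finite_measure_axioms sigma_finite_intensity)

text \<open>Same value as the covariance of the two stochastic terms: the indicators multiply to the
  indicator of the intersection, and Fubini separates \<omega> from space-time.\<close>

lemma term_product_integral: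
  assumes e: "past_term e" and e': "past_term e'"
  shows "has_bochner_integral (M \<Otimes>\<^sub>M \<Lambda>)
     (\<lambda>(\<omega>, z). (fst e \<omega> * indicator (term_set e) z) * (fst e' \<omega> * indicator (term_set e') z))
     (expectation (\<lambda>\<omega>. fst e \<omega> * fst e' \<omega>) * measure \<Lambda> (term_set e \<inter> term_set e'))"
proof -
  interpret Q: pair_sigma_finite M \<Lambda> by (rule pair_sigma_finite_Q)
  let ?C = "term_set e \<inter> term_set e'"
  have C: "?C \<in> sets \<Lambda>" using past_term_set(1)[OF e] past_term_set(1)[OF e'] by (rule sets.Int)
  have Cfin: "emeasure \<Lambda> ?C < \<infinity>"
    using emeasure_mono[OF Int_lower1 past_term_set(1)[OF e]] past_term_set(2)[OF e] by (rule le_less_trans)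
  have Y: "fst e \<in> borel_measurable M" "bounded (fst e ` space M)" "fst e' \<in> borel_measurable M" "bounded (fst e' ` space M)"
    using e e' by (auto simp: past_term_def split: prod.splits intro: measurable_filtration)
  have I1: "integrable M (\<lambda>\<omega>. fst e \<omega> * fst e' \<omega>)"
    using integrable_bounded_mult[OF Y(1,2), of "\<lambda>\<omega>. fst e' \<omega> * 1"] integrable_bounded_mult[OF Y(3,4), of "\<lambda>_. 1"]
    by simp
  have Csp: "?C \<inter> {0..} \<times> UNIV = ?C" using sets.sets_into_space[OF C] by (simp add: Int_absorb2 del: sets_intensity)
  have I2: "integrable \<Lambda> (indicator ?C :: _ \<Rightarrow> real)"
    using C Cfin by simp
  have eq: "(\<lambda>(\<omega>, z). (fst e \<omega> * indicator (term_set e) z) * (fst e' \<omega> * indicator (term_set e') z))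
     = (\<lambda>(\<omega>, z). (fst e \<omega> * fst e' \<omega>) * (indicator ?C z :: real))"
    by (auto simp: indicator_inter_arith)
  have m [measurable]: "(\<lambda>(\<omega>, z). (fst e \<omega> * fst e' \<omega>) * (indicator ?C z :: real)) \<in> borel_measurable (M \<Otimes>\<^sub>M \<Lambda>)"
    using Y(1,3) C by measurable
  have "integrable (M \<Otimes>\<^sub>M \<Lambda>) (\<lambda>(\<omega>, z). (fst e \<omega> * fst e' \<omega>) * (indicator ?C z :: real))"
  proof (rule Q.Fubini_integrable[OF m])
    have "integrable M (\<lambda>\<omega>. \<bar>fst e \<omega> * fst e' \<omega>\<bar> * measure \<Lambda> ?C)"
      using I1 by simp
    then show "integrable M (\<lambda>x. LINT y|\<Lambda>. norm (case (x, y) of (\<omega>, z) \<Rightarrow> fst e \<omega> * fst e' \<omega> * (indicator ?C z :: real)))"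
      by (simp add: abs_mult Csp)
    show "AE x in M. integrable \<Lambda> (\<lambda>y. case (x, y) of (\<omega>, z) \<Rightarrow> fst e \<omega> * fst e' \<omega> * (indicator ?C z :: real))"
      using I2 by simp
  qed
  moreover have "(LINT p|(M \<Otimes>\<^sub>M \<Lambda>). (case p of (\<omega>, z) \<Rightarrow> (fst e \<omega> * fst e' \<omega>) * (indicator ?C z :: real))) =
     expectation (\<lambda>\<omega>. fst e \<omega> * fst e' \<omega>) * measure \<Lambda> ?C"
    using Q.integral_fst'[OF calculation] by (simp add: Csp)
  ultimately show ?thesis unfolding eq by (simp add: has_bochner_integral_iff)
qed

text \<open>Both sides expand into the same double sum V of covariances, so overlapping terms are
  harmless and no refinement to disjoint cylinders is made.\<close>

lemma elementary_isometry:
  assumes "elementary M \<mu> N es"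
  shows "(\<integral>\<^sup>+\<omega>. ennreal ((elementary_integral \<mu> N es \<omega>)\<^sup>2) \<partial>M) =
     (\<integral>\<^sup>+(\<omega>, s, x, h). ennreal ((elementary_process es s x h \<omega>)\<^sup>2) \<partial>(M \<Otimes>\<^sub>M \<Lambda>))"
proof -
  let ?n = "length es"
  have t: "past_term (es ! i)" if "i < ?n" for i using assms that by (simp add: elementary_iff)
  define V where "V = (\<Sum>i<?n. \<Sum>j<?n. expectation (\<lambda>\<omega>. fst (es ! i) \<omega> * fst (es ! j) \<omega>) * measure \<Lambda> (term_set (es ! i) \<inter> term_set (es ! j)))"
  have 1: "has_bochner_integral M (\<lambda>\<omega>. (elementary_integral \<mu> N es \<omega>)\<^sup>2) V"
    unfolding elementary_integral_sum power2_eq_square sum_product V_def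
    by (intro has_bochner_integral_sum covariance t) auto
  have 2: "has_bochner_integral (M \<Otimes>\<^sub>M \<Lambda>) (\<lambda>p. \<Sum>i<?n. \<Sum>j<?n. (case p of (\<omega>, z) \<Rightarrow>
      (fst (es ! i) \<omega> * indicator (term_set (es ! i)) z) * (fst (es ! j) \<omega> * indicator (term_set (es ! j)) z))) V"
    unfolding V_def by (intro has_bochner_integral_sum term_product_integral t) auto
  have eq: "(\<lambda>p. \<Sum>i<?n. \<Sum>j<?n. (case p of (\<omega>, z) \<Rightarrow>
      (fst (es ! i) \<omega> * indicator (term_set (es ! i)) z) * (fst (es ! j) \<omega> * indicator (term_set (es ! j)) z)))
     = (\<lambda>(\<omega>, s, x, h). (elementary_process es s x h \<omega>)\<^sup>2)"
    by (rule ext, clarify) (simp only: prod.case elementary_process_sum power2_eq_square sum_product)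
  note 2 = 2[unfolded eq]
  have "(\<integral>\<^sup>+\<omega>. ennreal ((elementary_integral \<mu> N es \<omega>)\<^sup>2) \<partial>M) = ennreal V"
    using 1 by (auto simp: has_bochner_integral_iff nn_integral_eq_integral)
  moreover have "(\<integral>\<^sup>+p. ennreal (case p of (\<omega>, s, x, h) \<Rightarrow> (elementary_process es s x h \<omega>)\<^sup>2) \<partial>(M \<Otimes>\<^sub>M \<Lambda>)) = ennreal V"
    using 2 by (subst nn_integral_eq_integral) (auto simp: has_bochner_integral_iff)
  ultimately show ?thesis by (simp add: case_prod_unfold)
qed

end

section \<open>The integral of predictable processes\<close>

text \<open>The bookkeeping of four triangle inequalities, two between integrals and two between
  integrands. Each doubles the coefficient of the surviving D, and the approximation errors vanish
  in the limit; hence 16.\<close>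

lemma nn_integral_square_limit_le:
  fixes X Y Z X' Z' :: "nat \<Rightarrow> ennreal"
  assumes le: "\<And>n. d \<le> 2 * X n + 2 * (2 * Y n + 2 * Z n)" and X: "X \<longlonglongrightarrow> 0" and Z: "Z \<longlonglongrightarrow> 0"
    and Y: "\<And>n. Y n \<le> 2 * X' n + 2 * (2 * D + 2 * Z' n)" and X': "X' \<longlonglongrightarrow> 0" and Z': "Z' \<longlonglongrightarrow> 0"
  shows "d \<le> 16 * D"
proof -
  have "(\<lambda>n. 2 * X n + 2 * (2 * (2 * X' n + 2 * (2 * D + 2 * Z' n)) + 2 * Z n)) \<longlonglongrightarrow>
     2 * 0 + 2 * (2 * (2 * 0 + 2 * (2 * D + 2 * 0)) + 2 * 0)"
    by (intro tendsto_add tendsto_mult_ennreal tendsto_const X Z X' Z') auto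
  moreover have "d \<le> 2 * X n + 2 * (2 * (2 * X' n + 2 * (2 * D + 2 * Z' n)) + 2 * Z n)" for n
  proof -
    have "2 * Y n \<le> 2 * (2 * X' n + 2 * (2 * D + 2 * Z' n))" by (rule mult_left_mono[OF Y]) simp
    then have "2 * Y n + 2 * Z n \<le> 2 * (2 * X' n + 2 * (2 * D + 2 * Z' n)) + 2 * Z n" by (rule add_right_mono)
    then have "2 * (2 * Y n + 2 * Z n) \<le> 2 * (2 * (2 * X' n + 2 * (2 * D + 2 * Z' n)) + 2 * Z n)"
      by (rule mult_left_mono) simp
    then have "2 * X n + 2 * (2 * Y n + 2 * Z n) \<le> 2 * X n + 2 * (2 * (2 * X' n + 2 * (2 * D + 2 * Z' n)) + 2 * Z n)"
      by (rule add_left_mono)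
    with le[of n] show ?thesis by (rule order_trans)
  qed
  ultimately have "d \<le> 2 * 0 + 2 * (2 * (2 * 0 + 2 * (2 * D + 2 * 0)) + 2 * 0)"
    by (intro LIMSEQ_le_const) auto
  then show ?thesis by (simp add: mult.assoc[symmetric])
qed

context poisson_noise
begin

abbreviation predictable :: "('w \<times> real \<times> 'e::topological_space) measure" where
  "predictable \<equiv> predictable_sigma M \<F>"

abbreviation Q :: "('w \<times> real \<times> 'a \<times> 'a) measure" where "Q \<equiv> M \<Otimes>\<^sub>M \<Lambda>"

definition square_norm :: "('w \<times> real \<times> 'a \<times> 'a \<Rightarrow> real) \<Rightarrow> ennreal" where
  "square_norm f = (\<integral>\<^sup>+z. ennreal ((f z)\<^sup>2) \<partial>Q)"

definition eprocess :: "('w, 'a) elementary \<Rightarrow> 'w \<times> real \<times> 'a \<times> 'a \<Rightarrow> real" where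
  "eprocess es = (\<lambda>(\<omega>, s, x, h). elementary_process es s x h \<omega>)"

lemma space_predictable: "space predictable = space M \<times> {0<..} \<times> UNIV"
  unfolding predictable_sigma_def by (rule space_measure_of) (use filtration_events sets.sets_into_space in fastforce)

lemma sets_predictable: "sets predictable = sigma_sets (space M \<times> {0<..} \<times> UNIV)
       {F \<times> {a<..b} \<times> B | F a b B. 0 \<le> a \<and> a < b \<and> F \<in> sets (\<F> a) \<and> B \<in> sets borel}"
  unfolding predictable_sigma_def by (rule sets_measure_of) (use filtration_events sets.sets_into_space in fastforce)

lemma predictable_rectangle:
  "0 \<le> a \<Longrightarrow> F \<in> sets (\<F> a) \<Longrightarrow> B \<in> sets borel \<Longrightarrow> F \<times> {a<..b} \<times> B \<in> sets predictable"
  unfolding sets_predictable by (cases "a < b") (auto intro!: sigma_sets.Basic sigma_sets.Empty)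

lemma top_in_filtration: "space M \<in> sets (\<F> a)"
  using sets.top[of "\<F> a"] by simp

lemma space_Q: "space Q = space M \<times> {0..} \<times> UNIV"
  by (simp add: space_pair_measure)

lemma positive_time_sets: "space M \<times> {0<..} \<times> UNIV \<in> sets Q"
proof -
  have "{0<..} \<in> sets (restrict_space borel {0::real..})" by (subst sets_restrict_space_iff) auto
  then have "{0<..} \<times> UNIV \<in> sets \<Lambda>" by simp
  then show ?thesis by (intro pair_measureI) auto
qed

lemma predictable_sets_Q:
  fixes A :: "('w \<times> real \<times> 'a \<times> 'a) set"
  assumes "A \<in> sets predictable" shows "A \<in> sets Q"
  using assms[unfolded sets_predictable]
proof induct
  case (Basic A)
  then obtain F a b B where A: "A = F \<times> {a<..b} \<times> B" "0 \<le> a" "F \<in> sets (\<F> a)" "B \<in> sets borel" by blast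
  then have "{a<..b} \<times> B \<in> sets \<Lambda>" by (intro cylinder_sets)
  moreover have "F \<in> events" using filtration_events A(3) by auto
  ultimately show ?case unfolding A(1) by (rule pair_measureI[rotated])
next
  case (Compl A)
  then show ?case by (intro sets.Diff positive_time_sets)
next
  case (Union A)
  then show ?case by (intro sets.countable_UN) auto
qed auto

text \<open>Q contains time 0, which the predictable \<sigma>-algebra leaves out; the value 0 on
  that slice settles the remainder.\<close>

lemma predictable_measurable_Q:
  fixes X :: "'w \<times> real \<times> 'a \<times> 'a \<Rightarrow> real"
  assumes X: "X \<in> borel_measurable predictable" and 0: "\<And>\<omega> x h. X (\<omega>, 0, x, h) = 0"
  shows "X \<in> borel_measurable Q"
proof (rule measurableI)
  fix B :: "real set" assume B: "B \<in> sets borel"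
  have "X -` B \<inter> space predictable \<in> sets Q" using measurable_sets[OF X B] by (rule predictable_sets_Q)
  moreover have "space Q - space predictable \<in> sets Q"
    unfolding space_predictable by (intro sets.Diff positive_time_sets sets.top)
  moreover have "X -` B \<inter> space Q = (X -` B \<inter> space predictable) \<union> (if 0 \<in> B then space Q - space predictable else {})"
  proof -
    have "X z \<in> B \<longleftrightarrow> 0 \<in> B" if "z \<in> space Q" "z \<notin> space predictable" for z
      using that 0 unfolding space_Q space_predictable by (cases z) auto
    moreover have "space predictable \<subseteq> space Q" unfolding space_Q space_predictable by auto
    ultimately show ?thesis by (cases "0 \<in> B") (simp_all, blast+)
  qed
  ultimately show "X -` B \<inter> space Q \<in> sets Q" by auto
qed auto

lemma eprocess_measurable [measurable]:
  assumes "elementary M \<mu> N es" shows "eprocess es \<in> borel_measurable Q"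
proof -
  have eq: "eprocess es = (\<lambda>z. \<Sum>i<length es. fst (es ! i) (fst z) * indicator (term_set (es ! i)) (snd z))"
    unfolding eprocess_def elementary_process_sum by (auto simp: fun_eq_iff simp del: sum_mult_indicator)
  show ?thesis unfolding eq
  proof (intro borel_measurable_sum borel_measurable_times)
    fix i assume "i \<in> {..<length es}"
    then have "past_term (es ! i)" using assms by (simp add: elementary_iff)
    then have "fst (es ! i) \<in> borel_measurable M" and t: "term_set (es ! i) \<in> sets \<Lambda>"
      using past_term_set by (auto simp: past_term_def split: prod.splits intro: measurable_filtration)
    then show "(\<lambda>z. fst (es ! i) (fst z)) \<in> borel_measurable Q" by measurable
    show "(\<lambda>z. indicator (term_set (es ! i)) (snd z) :: real) \<in> borel_measurable Q"
      using borel_measurable_indicator[OF t] measurable_snd by (rule measurable_compose[rotated])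
  qed
qed

lemma elementary_integral_measurable:
  assumes "elementary M \<mu> N es" "\<forall>(Y, a, b, B)\<in>set es. b \<le> T"
  shows "elementary_integral \<mu> N es \<in> borel_measurable (\<F> T)"
proof -
  have "(\<lambda>\<omega>. fst e \<omega> * compensated (term_set e) \<omega>) \<in> borel_measurable (\<F> T)" if "e \<in> set es" for e
  proof -
    obtain Y a b B where e: "e = (Y, a, b, B)" by (rule prod_cases4)
    have p: "past_term (Y, a, b, B)" "b \<le> T" using assms that e by (auto simp: elementary_iff)
    have "Y \<in> borel_measurable (\<F> T)"
      using p by (auto simp: past_term_def intro: measurable_filtration_mono[of a T])
    moreover have "compensated ({a<..b} \<times> B) \<in> borel_measurable (\<F> T)"
    proof (rule compensated_adapted)
      show "{a<..b} \<times> B \<in> sets \<Lambda>" using past_term_set(1)[OF p(1)] by (simp add: term_set_def)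
      show "{a<..b} \<times> B \<subseteq> {0..T} \<times> UNIV" using p by (auto simp: past_term_def)
    qed
    ultimately show ?thesis by (simp add: e term_set_def)
  qed
  then show ?thesis unfolding elementary_integral_sum[abs_def] by (intro borel_measurable_sum) auto
qed

lemma elementary_integral_measurable_M:
  assumes "elementary M \<mu> N es"
  shows "elementary_integral \<mu> N es \<in> borel_measurable M"
proof -
  have "finite ((\<lambda>(Y, a, b, B). b) ` set es)" by simp
  then obtain T where "\<forall>x\<in>(\<lambda>(Y, a, b, B). b) ` set es. x \<le> T"
    using bdd_above_finite[THEN bdd_above.E] by metis
  then show ?thesis
    by (intro measurable_filtration[OF elementary_integral_measurable[OF assms, of T]]) auto
qed

lemma square_norm_triangle:
  assumes "f \<in> borel_measurable Q" "g \<in> borel_measurable Q" "h \<in> borel_measurable Q"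
  shows "square_norm (\<lambda>z. f z - h z) \<le> 2 * square_norm (\<lambda>z. f z - g z) + 2 * square_norm (\<lambda>z. g z - h z)"
  unfolding square_norm_def by (rule nn_integral_square_triangle[OF assms])

lemma square_norm_commute: "square_norm (\<lambda>z. f z - g z) = square_norm (\<lambda>z. g z - f z)"
  unfolding square_norm_def by (rule nn_integral_square_commute)

subsection \<open>Density of the elementary processes\<close>

text \<open>The constraint \<open>b \<le> T\<close> makes the approximating integrals, and hence
  their limit, measurable at time T.\<close>

definition approximable :: "real \<Rightarrow> ('w \<times> real \<times> 'a \<times> 'a \<Rightarrow> real) \<Rightarrow> bool" where
  "approximable T X \<longleftrightarrow> X \<in> borel_measurable Q \<and> (\<forall>e>0. \<exists>es. elementary M \<mu> N es \<and>
     (\<forall>(Y, a, b, B)\<in>set es. b \<le> T) \<and> square_norm (\<lambda>z. X z - eprocess es z) \<le> ennreal e)"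

lemma approximableD:
  assumes "approximable T X" "0 < e"
  obtains es where "elementary M \<mu> N es" "\<forall>(Y, a, b, B)\<in>set es. b \<le> T" "square_norm (\<lambda>z. X z - eprocess es z) \<le> ennreal e"
  using assms unfolding approximable_def by blast

lemma approximable_measurable: "approximable T X \<Longrightarrow> X \<in> borel_measurable Q"
  by (simp add: approximable_def)

lemma approximable_closure:
  assumes X: "X \<in> borel_measurable Q"
    and ex: "\<And>e. 0 < e \<Longrightarrow> \<exists>X'. approximable T X' \<and> square_norm (\<lambda>z. X z - X' z) \<le> ennreal e"
  shows "approximable T X"
  unfolding approximable_def
proof (intro conjI allI impI X)
  fix e :: real assume e: "0 < e"
  obtain X' where X': "approximable T X'" "square_norm (\<lambda>z. X z - X' z) \<le> ennreal (e/4)"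
    using ex[of "e/4"] e by auto
  obtain es where es: "elementary M \<mu> N es" "\<forall>(Y, a, b, B)\<in>set es. b \<le> T" "square_norm (\<lambda>z. X' z - eprocess es z) \<le> ennreal (e/4)"
    using approximableD[OF X'(1), of "e/4"] e by auto
  have "square_norm (\<lambda>z. X z - eprocess es z) \<le> 2 * square_norm (\<lambda>z. X z - X' z) + 2 * square_norm (\<lambda>z. X' z - eprocess es z)"
    by (intro square_norm_triangle X approximable_measurable[OF X'(1)] eprocess_measurable es)
  also have "\<dots> \<le> 2 * ennreal (e/4) + 2 * ennreal (e/4)"
    by (intro add_mono mult_left_mono X' es) auto
  also have "\<dots> = ennreal (2 * (e/4) + 2 * (e/4))"
    using e by (subst ennreal_plus) (auto simp: ennreal_mult[symmetric] simp flip: ennreal_numeral)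
  also have "\<dots> = ennreal e" by simp
  finally show "\<exists>es. elementary M \<mu> N es \<and> (\<forall>(Y, a, b, B)\<in>set es. b \<le> T) \<and> square_norm (\<lambda>z. X z - eprocess es z) \<le> ennreal e"
    using es by blast
qed

lemma eprocess_append: "eprocess (es @ es') z = eprocess es z + eprocess es' z"
  by (cases z) (simp add: eprocess_def elementary_process_append)

lemma eprocess_scale: "eprocess (elementary_scale c es) z = c * eprocess es z"
  by (cases z) (simp add: eprocess_def elementary_process_scale)

lemma approximable_add:
  assumes X: "approximable T X" and X': "approximable T X'"
  shows "approximable T (\<lambda>z. X z + X' z)"
  unfolding approximable_def
proof (intro conjI allI impI)
  note [measurable] = approximable_measurable[OF X] approximable_measurable[OF X']
  show "(\<lambda>z. X z + X' z) \<in> borel_measurable Q" by measurable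
  fix e :: real assume e: "0 < e"
  obtain es where es: "elementary M \<mu> N es" "\<forall>(Y, a, b, B)\<in>set es. b \<le> T" "square_norm (\<lambda>z. X z - eprocess es z) \<le> ennreal (e/4)"
    using approximableD[OF X, of "e/4"] e by auto
  obtain es' where es': "elementary M \<mu> N es'" "\<forall>(Y, a, b, B)\<in>set es'. b \<le> T" "square_norm (\<lambda>z. X' z - eprocess es' z) \<le> ennreal (e/4)"
    using approximableD[OF X', of "e/4"] e by auto
  have [measurable]: "eprocess es \<in> borel_measurable Q" "eprocess es' \<in> borel_measurable Q"
    using es(1) es'(1) by (auto intro: eprocess_measurable)
  have "square_norm (\<lambda>z. X z + X' z - eprocess (es @ es') z) = square_norm (\<lambda>z. (X z - eprocess es z) - (eprocess es' z - X' z))"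
    unfolding eprocess_append by (intro arg_cong[of _ _ square_norm] ext) simp
  also have "\<dots> \<le> 2 * square_norm (\<lambda>z. (X z - eprocess es z) - 0) + 2 * square_norm (\<lambda>z. 0 - (eprocess es' z - X' z))"
    by (rule square_norm_triangle) measurable
  also have "square_norm (\<lambda>z. 0 - (eprocess es' z - X' z)) = square_norm (\<lambda>z. X' z - eprocess es' z)"
    by (intro arg_cong[of _ _ square_norm] ext) simp
  also have "2 * square_norm (\<lambda>z. (X z - eprocess es z) - 0) + 2 * square_norm (\<lambda>z. X' z - eprocess es' z) \<le> 2 * ennreal (e/4) + 2 * ennreal (e/4)"
    using es(3) es'(3) by (intro add_mono mult_left_mono) auto
  also have "\<dots> = ennreal (2 * (e/4) + 2 * (e/4))"
    using e by (subst ennreal_plus) (auto simp: ennreal_mult[symmetric] simp flip: ennreal_numeral)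
  also have "\<dots> = ennreal e" by simp
  finally have "square_norm (\<lambda>z. X z + X' z - eprocess (es @ es') z) \<le> ennreal e" .
  moreover have "\<forall>(Y, a, b, B)\<in>set (es @ es'). b \<le> T" using es(2) es'(2) by auto
  ultimately show "\<exists>es. elementary M \<mu> N es \<and> (\<forall>(Y, a, b, B)\<in>set es. b \<le> T) \<and> square_norm (\<lambda>z. X z + X' z - eprocess es z) \<le> ennreal e"
    using elementary_append[OF es(1) es'(1)] by blast
qed

lemma square_norm_scale:
  assumes [measurable]: "X \<in> borel_measurable Q"
  shows "square_norm (\<lambda>z. c * X z) = ennreal (c\<^sup>2) * square_norm X"
  unfolding square_norm_def by (subst nn_integral_cmult[symmetric]) (auto simp: power_mult_distrib ennreal_mult)

lemma approximable_0: "approximable T (\<lambda>z. 0)"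
  unfolding approximable_def
  by (auto intro!: exI[of _ "[]"] simp: elementary_Nil eprocess_def elementary_process_def square_norm_def)

lemma approximable_scale:
  assumes X: "approximable T X"
  shows "approximable T (\<lambda>z. c * X z)"
proof (cases "c = 0")
  case True
  then show ?thesis using approximable_0 by simp
next
  case False
  show ?thesis
    unfolding approximable_def
  proof (intro conjI allI impI)
    note [measurable] = approximable_measurable[OF X]
    show "(\<lambda>z. c * X z) \<in> borel_measurable Q" by measurable
    fix e :: real assume e: "0 < e"
    obtain es where es: "elementary M \<mu> N es" "\<forall>(Y, a, b, B)\<in>set es. b \<le> T" "square_norm (\<lambda>z. X z - eprocess es z) \<le> ennreal (e/c\<^sup>2)"
      using approximableD[OF X, of "e/c\<^sup>2"] e False by auto
    have [measurable]: "eprocess es \<in> borel_measurable Q" using es(1) by (rule eprocess_measurable)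
    have "square_norm (\<lambda>z. c * X z - eprocess (elementary_scale c es) z) = square_norm (\<lambda>z. c * (X z - eprocess es z))"
      by (simp add: eprocess_scale right_diff_distrib)
    also have "\<dots> = ennreal (c\<^sup>2) * square_norm (\<lambda>z. X z - eprocess es z)" by (rule square_norm_scale) measurable
    also have "\<dots> \<le> ennreal (c\<^sup>2) * ennreal (e/c\<^sup>2)" by (intro mult_left_mono es) auto
    also have "\<dots> = ennreal e" using e False by (simp add: ennreal_mult[symmetric])
    finally have "square_norm (\<lambda>z. c * X z - eprocess (elementary_scale c es) z) \<le> ennreal e" .
    moreover have "\<forall>(Y, a, b, B)\<in>set (elementary_scale c es). b \<le> T" using es(2) by (auto simp: elementary_scale_def)
    ultimately show "\<exists>es. elementary M \<mu> N es \<and> (\<forall>(Y, a, b, B)\<in>set es. b \<le> T) \<and> square_norm (\<lambda>z. c * X z - eprocess es z) \<le> ennreal e"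
      using elementary_elementary_scale[OF es(1)] by blast
  qed
qed

lemma approximable_diff:
  assumes X: "approximable T X" and X': "approximable T X'"
  shows "approximable T (\<lambda>z. X z - X' z)"
  using approximable_add[OF X approximable_scale[OF X', of "-1"]] by simp

text \<open>In finite measure an increasing exhaustion leaves a remainder of small measure, and this
  measure is the squared distance of the indicators.\<close>

lemma approximable_incseq:
  assumes A: "\<And>n. A n \<in> sets Q" "incseq A" and fin: "emeasure Q (\<Union>n. A n) < \<infinity>"
    and ap: "\<And>n. approximable T (indicator (A n))"
  shows "approximable T (indicator (\<Union>n. A n))"
proof (rule approximable_closure)
  let ?U = "\<Union>n. A n"
  show U: "indicator ?U \<in> borel_measurable Q" using A(1) by (intro borel_measurable_indicator sets.countable_UN) auto
  fix e :: real assume e: "0 < e"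
  have "(\<lambda>n. emeasure Q (?U - A n)) \<longlonglongrightarrow> emeasure Q (\<Inter>n. ?U - A n)"
  proof (rule Lim_emeasure_decseq)
    show "range (\<lambda>n. ?U - A n) \<subseteq> sets Q" using A(1) by auto
    show "decseq (\<lambda>n. ?U - A n)" using A(2) by (auto simp: incseq_def decseq_def)
    show "emeasure Q (?U - A n) \<noteq> \<infinity>" for n
      using fin A(1) emeasure_mono[of "?U - A n" ?U Q] by (auto simp: top_unique)
  qed
  moreover have "(\<Inter>n. ?U - A n) = {}" by auto
  ultimately have "(\<lambda>n. emeasure Q (?U - A n)) \<longlonglongrightarrow> 0" by (simp only: emeasure_empty)
  then have "\<forall>\<^sub>F n in sequentially. emeasure Q (?U - A n) < ennreal e"
    by (rule order_tendstoD) (use e in simp)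
  then obtain n where n: "emeasure Q (?U - A n) < ennreal e" by (auto simp: eventually_sequentially)
  have "square_norm (\<lambda>z. indicator ?U z - indicator (A n) z) = (\<integral>\<^sup>+z. indicator (?U - A n) z \<partial>Q)"
    unfolding square_norm_def by (intro nn_integral_cong) (auto simp: indicator_def)
  also have "\<dots> = emeasure Q (?U - A n)" using A(1) by (intro nn_integral_indicator) auto
  finally show "\<exists>X'. approximable T X' \<and> square_norm (\<lambda>z. indicator ?U z - X' z) \<le> ennreal e"
    using n ap[of n] by (intro exI[of _ "indicator (A n)"]) auto
qed

lemma approximable_rectangle:
  assumes "0 \<le> a" "F \<in> sets (\<F> a)" "B \<in> sets borel" "emeasure marks B < \<infinity>"
  shows "approximable T (indicator (F \<times> {a<..min b T} \<times> B))"
proof (cases "a < min b T")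
  case False
  then have "indicator (F \<times> {a<..min b T} \<times> B) = (\<lambda>z. 0 :: real)" by (auto simp: indicator_def fun_eq_iff)
  then show ?thesis using approximable_0 by simp
next
  case True
  have F: "F \<in> events" using assms(2) filtration_events by auto
  let ?es = "[(indicator F :: 'w \<Rightarrow> real, a, min b T, B)]"
  have "bounded ((indicator F :: 'w \<Rightarrow> real) ` space M)"
    by (rule boundedI[of _ 1]) (auto simp: indicator_def)
  then have es: "elementary M \<mu> N ?es"
    using assms(1,2,4) assms(3)[folded sets_marks] True by (auto simp: elementary_def)
  have eq: "eprocess ?es = indicator (F \<times> {a<..min b T} \<times> B)"
    by (auto simp: eprocess_def elementary_process_def fun_eq_iff indicator_def)
  show ?thesis unfolding approximable_def
  proof (intro conjI allI impI)
    show "(indicator (F \<times> {a<..min b T} \<times> B) :: _ \<Rightarrow> real) \<in> borel_measurable Q"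
      using eprocess_measurable[OF es] unfolding eq .
    show "\<exists>es. elementary M \<mu> N es \<and> (\<forall>(Y, a, b, B)\<in>set es. b \<le> T) \<and>
        square_norm (\<lambda>z. indicator (F \<times> {a<..min b T} \<times> B) z - eprocess es z) \<le> ennreal e" for e
      using es by (intro exI[of _ ?es]) (simp add: eq square_norm_def)
  qed
qed

lemma emeasure_Q_cylinder:
  assumes "B \<in> sets borel" "emeasure marks B < \<infinity>"
  shows "space M \<times> {0<..T} \<times> B \<in> sets Q" "emeasure Q (space M \<times> {0<..T} \<times> B) < \<infinity>"
proof -
  interpret sigma_finite_measure \<Lambda> by (rule sigma_finite_intensity)
  have c: "{0<..T} \<times> B \<in> sets \<Lambda>" "emeasure \<Lambda> ({0<..T} \<times> B) < \<infinity>"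
    using finite_cylinder[of 0 B T] assms unfolding sets_marks by auto
  show "space M \<times> {0<..T} \<times> B \<in> sets Q" using c by (intro pair_measureI) auto
  have "emeasure Q (space M \<times> {0<..T} \<times> B) = emeasure M (space M) * emeasure \<Lambda> ({0<..T} \<times> B)"
    by (rule emeasure_pair_measure_Times[OF _ c(1)]) simp
  then show "emeasure Q (space M \<times> {0<..T} \<times> B) < \<infinity>" using c(2) by (simp add: emeasure_space_1)
qed

text \<open>Dynkin's theorem over predictable rectangles. The cut with a cylinder of finite measure
  keeps every indicator square integrable, so that complements and increasing unions stay
  approximable.\<close>

lemma approximable_predictable_cylinder:
  fixes A :: "('w \<times> real \<times> 'a \<times> 'a) set"
  assumes A: "A \<in> sets predictable" and C: "C \<in> sets borel" "emeasure marks C < \<infinity>"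
  shows "approximable T (indicator (A \<inter> (space M \<times> {0<..T} \<times> C)))"
proof -
  let ?D = "space M \<times> {0<..T} \<times> C"
  let ?G = "{F \<times> {a<..b} \<times> B | F a b (B :: ('a \<times> 'a) set). 0 \<le> a \<and> a < b \<and> F \<in> sets (\<F> a) \<and> B \<in> sets borel}"
  note D = emeasure_Q_cylinder[OF C, of T]
  have ap_D: "approximable T (indicator ?D)"
    using approximable_rectangle[OF _ top_in_filtration C, of 0 T T] by simp
  have st: "Int_stable ?G"
  proof (rule Int_stableI, clarify)
    fix F F' :: "'w set" and a b a' b' :: real and B B' :: "('a \<times> 'a) set"
    assume *: "0 \<le> a" "a < b" "F \<in> sets (\<F> a)" "B \<in> sets borel" "0 \<le> a'" "a' < b'" "F' \<in> sets (\<F> a')" "B' \<in> sets borel"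
    show "\<exists>F'' a'' b'' B''. (F \<times> {a<..b} \<times> B) \<inter> (F' \<times> {a'<..b'} \<times> B') = F'' \<times> {a''<..b''} \<times> B'' \<and>
       0 \<le> a'' \<and> a'' < b'' \<and> F'' \<in> sets (\<F> a'') \<and> B'' \<in> sets borel"
    proof (cases "max a a' < min b b'")
      case True
      have "F \<in> sets (\<F> (max a a'))" "F' \<in> sets (\<F> (max a a'))"
        using *(3,7) filtration_mono[of a "max a a'"] filtration_mono[of a' "max a a'"] by auto
      then show ?thesis using * True
        by (intro exI[of _ "F \<inter> F'"] exI[of _ "max a a'"] exI[of _ "min b b'"] exI[of _ "B \<inter> B'"]) auto
    next
      case False
      \<comment> \<open>A generating rectangle must have a < b, so the empty intersection is written
        with an arbitrary proper interval and empty sides.\<close>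
      then have "(F \<times> {a<..b} \<times> B) \<inter> (F' \<times> {a'<..b'} \<times> B') = {} \<times> {0<..1} \<times> {}" by auto
      then show ?thesis
        by (intro exI[of _ "{}"] exI[of _ 0] exI[of _ 1]) auto
    qed
  qed
  have pow: "?G \<subseteq> Pow (space M \<times> {0<..} \<times> UNIV)"
    using filtration_events sets.sets_into_space by fastforce
  show ?thesis
    using st pow A[unfolded sets_predictable]
  proof (induction rule: sigma_sets_induct_disjoint)
    case (basic A)
    then obtain F a b B where A: "A = F \<times> {a<..b} \<times> B" "0 \<le> a" "F \<in> sets (\<F> a)" "B \<in> sets borel" by blast
    have "F \<subseteq> space M" using A(3) sets.sets_into_space by fastforce
    then have "A \<inter> ?D = F \<times> {a<..min b T} \<times> (B \<inter> C)" unfolding A(1) using A(2) by auto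
    moreover have "B \<inter> C \<in> sets borel" "emeasure marks (B \<inter> C) < \<infinity>"
      using A(4) C(1) le_less_trans[OF emeasure_mono[OF Int_lower2, of C marks B, unfolded sets_marks, OF C(1)] C(2)] by auto
    ultimately show ?case using approximable_rectangle[OF A(2,3)] by simp
  next
    case empty
    show ?case using approximable_0 by (simp add: indicator_def)
  next
    case (compl A)
    have "indicator ((space M \<times> {0<..} \<times> UNIV - A) \<inter> ?D) = (\<lambda>z. indicator ?D z - indicator (A \<inter> ?D) z :: real)"
      by (auto simp: indicator_def fun_eq_iff)
    then show ?case using approximable_diff[OF ap_D compl(2)] by simp
  next
    case (union A)
    have AQ: "A i \<in> sets Q" for i
      using union(2) by (intro predictable_sets_Q) (auto simp: sets_predictable)
    have ap: "approximable T (indicator ((\<Union>i<n. A i) \<inter> ?D))" for n :: nat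
    proof (induction n)
      case 0
      show ?case using approximable_0 by (simp add: indicator_def)
    next
      case (Suc n)
      have "A n \<inter> A i = {}" if "i < n" for i using union(1) that by (auto simp: disjoint_family_on_def)
      then have "indicator ((\<Union>i<Suc n. A i) \<inter> ?D) = (\<lambda>z. indicator ((\<Union>i<n. A i) \<inter> ?D) z + indicator (A n \<inter> ?D) z :: real)"
        by (force simp: indicator_def fun_eq_iff lessThan_Suc)
      then show ?case using approximable_add[OF Suc union(3)[of n]] by simp
    qed
    have eq: "(\<Union>i. A i) \<inter> ?D = (\<Union>n. (\<Union>i<n. A i) \<inter> ?D)" by auto
    show ?case unfolding eq
    proof (rule approximable_incseq)
      show "(\<Union>i<n. A i) \<inter> ?D \<in> sets Q" for n using AQ D(1) by auto
      show "incseq (\<lambda>n. (\<Union>i<n. A i) \<inter> ?D)" by (fastforce simp: incseq_def)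
      have "emeasure Q (\<Union>n. (\<Union>i<n. A i) \<inter> ?D) \<le> emeasure Q ?D" by (rule emeasure_mono[OF _ D(1)]) auto
      then show "emeasure Q (\<Union>n. (\<Union>i<n. A i) \<inter> ?D) < \<infinity>" using D(2) by (rule le_less_trans)
    qed (rule ap)
  qed
qed

text \<open>The marks are exhausted by sets of finite measure, which removes the spatial cut;
  finiteness of the measure of A controls the limit.\<close>

lemma approximable_predictable_set:
  fixes A :: "('w \<times> real \<times> 'a \<times> 'a) set"
  assumes A: "A \<in> sets predictable" "A \<subseteq> space M \<times> {0<..T} \<times> UNIV" and fin: "emeasure Q A < \<infinity>"
  shows "approximable T (indicator A)"
proof -
  interpret sigma_finite_measure marks by (rule sigma_finite_marks)
  obtain C where C: "range C \<subseteq> sets marks" "(\<Union>i. C i) = space marks" "\<And>i. emeasure marks (C i) \<noteq> \<infinity>" "incseq C"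
    using sigma_finite_incseq by blast
  have C': "C i \<in> sets borel" "emeasure marks (C i) < \<infinity>" for i
    using C(1) C(3)[of i] unfolding sets_marks by (auto simp: less_top)
  have eq: "A = (\<Union>i::nat. A \<inter> (space M \<times> {0<..T} \<times> C i))"
  proof -
    have "space M \<times> {0<..T} \<times> UNIV = (\<Union>i::nat. space M \<times> {0<..T} \<times> C i)"
      using C(2) by auto
    then show ?thesis using A(2) by (metis Int_UN_distrib inf.orderE)
  qed
  show ?thesis
  proof (subst eq, rule approximable_incseq)
    show "A \<inter> (space M \<times> {0<..T} \<times> C n) \<in> sets Q" for n
      using predictable_sets_Q[OF A(1)] emeasure_Q_cylinder[OF C'] by auto
    show "incseq (\<lambda>n. A \<inter> (space M \<times> {0<..T} \<times> C n))" using C(4) by (fastforce simp: incseq_def)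
    show "emeasure Q (\<Union>i::nat. A \<inter> (space M \<times> {0<..T} \<times> C i)) < \<infinity>" using fin eq by simp
    show "approximable T (indicator (A \<inter> (space M \<times> {0<..T} \<times> C n)))" for n
      by (rule approximable_predictable_cylinder[OF A(1) C'])
  qed
qed

definition time_cut :: "real \<Rightarrow> ('w \<times> real \<times> 'a \<times> 'a \<Rightarrow> real) \<Rightarrow> 'w \<times> real \<times> 'a \<times> 'a \<Rightarrow> real" where
  "time_cut T X = (\<lambda>(\<omega>, s, x, h). indicator {0<..T} s * X (\<omega>, s, x, h))"

lemma time_cut_eq: "time_cut T X z = indicator {0<..T} (fst (snd z)) * X z"
  by (cases z) (simp add: time_cut_def)

lemma time_interval_predictable: "space M \<times> {0<..T} \<times> UNIV \<in> sets predictable"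
  by (rule predictable_rectangle[OF _ top_in_filtration]) auto

lemma time_cut_predictable:
  assumes [measurable]: "X \<in> borel_measurable predictable"
  shows "time_cut T X \<in> borel_measurable predictable"
proof -
  note [measurable] = borel_measurable_indicator[OF time_interval_predictable[of T], where 'b = real]
  have "(\<lambda>z. indicator (space M \<times> {0<..T} \<times> UNIV) z * X z) \<in> borel_measurable predictable" by measurable
  also have "?this \<longleftrightarrow> ?thesis"
    by (rule measurable_cong) (auto simp: time_cut_eq space_predictable indicator_def)
  finally show ?thesis .
qed

lemma time_cut_Q:
  assumes "X \<in> borel_measurable predictable"
  shows "time_cut T X \<in> borel_measurable Q"
  by (rule predictable_measurable_Q[OF time_cut_predictable[OF assms]]) (simp add: time_cut_def)

text \<open>A monotone class argument. For an increasing limit, dominated convergence with majorant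
  the square of \<open>time_cut T u\<close> gives mean square convergence, and closure of the
  approximable processes concludes.\<close>

lemma approximable_nonneg:
  assumes u: "u \<in> borel_measurable predictable" "\<And>z. 0 \<le> u z" and fin: "square_norm (time_cut T u) < \<infinity>"
  shows "approximable T (time_cut T u)"
  using u fin
proof (induction rule: borel_measurable_induct_real)
  case (set A)
  let ?D = "space M \<times> {0<..T} \<times> UNIV"
  have "A \<subseteq> space M \<times> {0<..} \<times> UNIV" using sets.sets_into_space[OF set.hyps] by (simp add: space_predictable)
  then have eq: "time_cut T (indicator A) = indicator (A \<inter> ?D)"
    by (auto simp: time_cut_eq fun_eq_iff indicator_def)
  have AD: "A \<inter> ?D \<in> sets predictable" using set.hyps time_interval_predictable by auto
  have "square_norm (time_cut T (indicator A)) = (\<integral>\<^sup>+z. indicator (A \<inter> ?D) z \<partial>Q)"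
    unfolding eq square_norm_def by (intro nn_integral_cong) (auto simp: indicator_def)
  also have "\<dots> = emeasure Q (A \<inter> ?D)" by (intro nn_integral_indicator predictable_sets_Q AD)
  finally have "emeasure Q (A \<inter> ?D) < \<infinity>" using set.prems by simp
  then show ?case unfolding eq by (intro approximable_predictable_set AD) auto
next
  case (mult u c)
  have eq: "time_cut T (\<lambda>z. c * u z) = (\<lambda>z. c * time_cut T u z)" by (auto simp: time_cut_eq)
  show ?case
  proof (cases "c = 0")
    case True
    then show ?thesis unfolding eq using approximable_0 by simp
  next
    case False
    have "square_norm (time_cut T (\<lambda>z. c * u z)) = ennreal (c\<^sup>2) * square_norm (time_cut T u)"
      unfolding eq by (rule square_norm_scale[OF time_cut_Q[OF mult.hyps(2)]])
    then have "square_norm (time_cut T u) < \<infinity>"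
      using mult.prems False by (auto simp: ennreal_mult_less_top)
    then show ?thesis unfolding eq by (intro approximable_scale mult.IH)
  qed
next
  case (add u v)
  have le: "square_norm (time_cut T w) \<le> square_norm (time_cut T (\<lambda>z. v z + u z))" if "w = u \<or> w = v" for w
    unfolding square_norm_def time_cut_eq using that add.hyps(2,4)
    by (intro nn_integral_mono ennreal_leI power_mono mult_left_mono) auto
  have "approximable T (time_cut T u)" "approximable T (time_cut T v)"
    using le[of u] le[of v] add.prems by (auto intro!: add.IH intro: le_less_trans)
  from approximable_add[OF this(2,1)] show ?case
    by (simp add: time_cut_eq[abs_def] distrib_left)
next
  case (seq U)
  have u: "u \<in> borel_measurable predictable"
    by (rule borel_measurable_LIMSEQ_real[OF seq.hyps(4)]) (use seq.hyps(1) in auto)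
  note [measurable] = time_cut_Q[OF seq.hyps(1), of T] time_cut_Q[OF u, of T]
  have lim: "(\<lambda>i. time_cut T (U i) z) \<longlonglongrightarrow> time_cut T u z" if "z \<in> space Q" for z
  proof (cases "z \<in> space predictable")
    case True
    then show ?thesis unfolding time_cut_eq by (intro tendsto_intros seq.hyps(4))
  next
    case False
    then have "fst (snd z) \<notin> {0<..T}" using that unfolding space_Q space_predictable by (cases z) auto
    then show ?thesis by (simp add: time_cut_eq)
  qed
  have le: "time_cut T (U i) z \<le> time_cut T u z" if "z \<in> space Q" for i z
  proof (rule incseq_le[OF _ lim[OF that]])
    show "incseq (\<lambda>i. time_cut T (U i) z)"
      by (auto simp: incseq_def time_cut_eq intro!: mult_left_mono incseqD[OF seq.hyps(3), THEN le_funD])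
  qed
  have nonneg: "0 \<le> time_cut T (U i) z" for i z using seq.hyps(2) by (simp add: time_cut_eq)
  have "(\<lambda>i. \<integral>\<^sup>+z. ennreal ((time_cut T u z - time_cut T (U i) z)\<^sup>2) \<partial>Q) \<longlonglongrightarrow> (\<integral>\<^sup>+z. 0 \<partial>Q)"
  proof (rule nn_integral_dominated_convergence)
    show "AE z in Q. ennreal ((time_cut T u z - time_cut T (U i) z)\<^sup>2) \<le> ennreal ((time_cut T u z)\<^sup>2)" for i
    proof (rule AE_I2)
      fix z assume "z \<in> space Q"
      from le[OF this, of i] nonneg[of i z] show "ennreal ((time_cut T u z - time_cut T (U i) z)\<^sup>2) \<le> ennreal ((time_cut T u z)\<^sup>2)"
        by (intro ennreal_leI power_mono) auto
    qed
    show "AE z in Q. (\<lambda>i. ennreal ((time_cut T u z - time_cut T (U i) z)\<^sup>2)) \<longlonglongrightarrow> 0"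
    proof (rule AE_I2)
      fix z assume "z \<in> space Q"
      from lim[OF this] have "(\<lambda>i. ennreal ((time_cut T u z - time_cut T (U i) z)\<^sup>2)) \<longlonglongrightarrow> ennreal ((time_cut T u z - time_cut T u z)\<^sup>2)"
        by (intro tendsto_intros)
      then show "(\<lambda>i. ennreal ((time_cut T u z - time_cut T (U i) z)\<^sup>2)) \<longlonglongrightarrow> 0" by simp
    qed
  qed (use seq.prems in \<open>auto simp: square_norm_def\<close>)
  then have D: "(\<lambda>i. square_norm (\<lambda>z. time_cut T u z - time_cut T (U i) z)) \<longlonglongrightarrow> 0"
    by (simp add: square_norm_def)
  show ?case
  proof (rule approximable_closure)
    fix e :: real assume "0 < e"
    have "\<forall>\<^sub>F i in sequentially. square_norm (\<lambda>z. time_cut T u z - time_cut T (U i) z) < ennreal e"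
      using D by (rule order_tendstoD) (use \<open>0 < e\<close> in simp)
    then obtain i where i: "square_norm (\<lambda>z. time_cut T u z - time_cut T (U i) z) < ennreal e"
      by (auto simp: eventually_sequentially)
    have "square_norm (time_cut T (U i)) \<le> square_norm (time_cut T u)"
      unfolding square_norm_def using le nonneg by (intro nn_integral_mono ennreal_leI power_mono) auto
    then have "approximable T (time_cut T (U i))" using seq.prems by (intro seq.IH) auto
    then show "\<exists>X'. approximable T X' \<and> square_norm (\<lambda>z. time_cut T u z - X' z) \<le> ennreal e"
      using i by (intro exI[of _ "time_cut T (U i)"]) auto
  qed measurable
qed

lemma approximable_predictable:
  assumes X: "X \<in> borel_measurable predictable" and fin: "square_norm (time_cut T X) < \<infinity>"
  shows "approximable T (time_cut T X)"
proof -
  note [measurable] = X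
  have le: "square_norm (time_cut T (\<lambda>z. max 0 (c * X z))) \<le> square_norm (time_cut T X)" if "c = 1 \<or> c = -1" for c
    unfolding square_norm_def time_cut_eq
  proof (intro nn_integral_mono ennreal_leI)
    fix z
    have "(max 0 (c * X z))\<^sup>2 \<le> (X z)\<^sup>2" using that by (auto simp: max_def)
    then show "(indicator {0<..T} (fst (snd z)) * max 0 (c * X z))\<^sup>2 \<le> (indicator {0<..T} (fst (snd z)) * X z)\<^sup>2"
      by (simp add: power_mult_distrib mult_left_mono)
  qed
  have ap: "approximable T (time_cut T (\<lambda>z. max 0 (c * X z)))" if "c = 1 \<or> c = -1" for c
    using le[OF that] fin by (intro approximable_nonneg) (auto intro: le_less_trans)
  have "(\<lambda>z. time_cut T (\<lambda>z. max 0 (1 * X z)) z - time_cut T (\<lambda>z. max 0 ((-1) * X z)) z) = time_cut T X"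
    by (auto simp: time_cut_eq fun_eq_iff max_def algebra_simps)
  then show ?thesis using approximable_diff[OF ap[of 1] ap[of "-1"]] by simp
qed

subsection \<open>The mean square integral\<close>

definition square_integral :: "('w \<times> real \<times> 'a \<times> 'a \<Rightarrow> real) \<Rightarrow> ('w \<Rightarrow> real) \<Rightarrow> bool" where
  "square_integral X I \<longleftrightarrow> I \<in> borel_measurable M \<and> (\<exists>es. (\<forall>n. elementary M \<mu> N (es n)) \<and>
     (\<lambda>n. square_norm (\<lambda>z. X z - eprocess (es n) z)) \<longlonglongrightarrow> 0 \<and>
     (\<lambda>n. \<integral>\<^sup>+\<omega>. ennreal ((I \<omega> - elementary_integral \<mu> N (es n) \<omega>)\<^sup>2) \<partial>M) \<longlonglongrightarrow> 0)"

lemma elementary_isometry_diff: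
  assumes "elementary M \<mu> N es" "elementary M \<mu> N es'"
  shows "square_dist M (elementary_integral \<mu> N es) (elementary_integral \<mu> N es')
     = square_norm (\<lambda>z. eprocess es z - eprocess es' z)"
proof -
  have "elementary M \<mu> N (es @ elementary_scale (-1) es')"
    using assms by (intro elementary_append elementary_elementary_scale)
  from elementary_isometry[OF this] show ?thesis
    unfolding square_norm_def eprocess_def
    by (simp add: elementary_integral_append elementary_integral_scale elementary_process_append elementary_process_scale case_prod_unfold)
qed

text \<open>The elementary isometry is passed to the limit along two unrelated approximating
  sequences. For X = X' this shows that the integral is unique almost surely.\<close>

lemma square_integral_le:
  assumes I: "square_integral X I" and I': "square_integral X' I'"
    and [measurable]: "X \<in> borel_measurable Q" "X' \<in> borel_measurable Q"
  shows "square_dist M I I' \<le> 16 * square_norm (\<lambda>z. X z - X' z)"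
proof -
  obtain es where es: "\<And>n. elementary M \<mu> N (es n)"
     "(\<lambda>n. square_norm (\<lambda>z. X z - eprocess (es n) z)) \<longlonglongrightarrow> 0"
     "(\<lambda>n. \<integral>\<^sup>+\<omega>. ennreal ((I \<omega> - elementary_integral \<mu> N (es n) \<omega>)\<^sup>2) \<partial>M) \<longlonglongrightarrow> 0"
    using I unfolding square_integral_def by blast
  obtain es' where es': "\<And>n. elementary M \<mu> N (es' n)"
     "(\<lambda>n. square_norm (\<lambda>z. X' z - eprocess (es' n) z)) \<longlonglongrightarrow> 0"
     "(\<lambda>n. \<integral>\<^sup>+\<omega>. ennreal ((I' \<omega> - elementary_integral \<mu> N (es' n) \<omega>)\<^sup>2) \<partial>M) \<longlonglongrightarrow> 0"
    using I' unfolding square_integral_def by blast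
  have [measurable]: "I \<in> borel_measurable M" "I' \<in> borel_measurable M"
    using I I' by (auto simp: square_integral_def)
  note [measurable] = elementary_integral_measurable_M[OF es(1)] elementary_integral_measurable_M[OF es'(1)]
    eprocess_measurable[OF es(1)] eprocess_measurable[OF es'(1)]
  let ?E = "\<lambda>n. elementary_integral \<mu> N (es n)" and ?E' = "\<lambda>n. elementary_integral \<mu> N (es' n)"
  show ?thesis
  proof (rule nn_integral_square_limit_le)
    fix n
    have "square_dist M (?E n) I' \<le> 2 * square_dist M (?E n) (?E' n) + 2 * square_dist M (?E' n) I'"
      by (rule nn_integral_square_triangle) measurable
    also have "\<dots> = 2 * square_norm (\<lambda>z. eprocess (es n) z - eprocess (es' n) z) + 2 * square_dist M I' (?E' n)"
      by (simp only: elementary_isometry_diff[OF es(1) es'(1)] nn_integral_square_commute[where f = I'])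
    finally have *: "square_dist M (?E n) I' \<le> \<dots>" .
    have "square_dist M I I' \<le> 2 * square_dist M I (?E n) + 2 * square_dist M (?E n) I'"
      by (rule nn_integral_square_triangle) measurable
    also have "\<dots> \<le> 2 * square_dist M I (?E n) + 2 * (2 * square_norm (\<lambda>z. eprocess (es n) z - eprocess (es' n) z) + 2 * square_dist M I' (?E' n))"
      by (rule add_left_mono, rule mult_left_mono[OF *]) simp
    finally show "square_dist M I I' \<le> \<dots>" .
    have **: "square_norm (\<lambda>z. X z - eprocess (es' n) z) \<le> 2 * square_norm (\<lambda>z. X z - X' z) + 2 * square_norm (\<lambda>z. X' z - eprocess (es' n) z)"
      by (rule square_norm_triangle) measurable
    have "square_norm (\<lambda>z. eprocess (es n) z - eprocess (es' n) z) \<le> 2 * square_norm (\<lambda>z. eprocess (es n) z - X z) + 2 * square_norm (\<lambda>z. X z - eprocess (es' n) z)"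
      by (rule square_norm_triangle) measurable
    also have "square_norm (\<lambda>z. eprocess (es n) z - X z) = square_norm (\<lambda>z. X z - eprocess (es n) z)"
      by (rule square_norm_commute)
    also have "2 * square_norm (\<lambda>z. X z - eprocess (es n) z) + 2 * square_norm (\<lambda>z. X z - eprocess (es' n) z)
       \<le> 2 * square_norm (\<lambda>z. X z - eprocess (es n) z) + 2 * (2 * square_norm (\<lambda>z. X z - X' z) + 2 * square_norm (\<lambda>z. X' z - eprocess (es' n) z))"
      by (rule add_left_mono, rule mult_left_mono[OF **]) simp
    finally show "square_norm (\<lambda>z. eprocess (es n) z - eprocess (es' n) z) \<le> \<dots>" .
  qed (rule es es')+
qed

text \<open>Approximation at rate \<open>(1/16)^n\<close> makes the elementary integrals converge
  almost surely and not only in mean square. Their pointwise \<open>lim\<close> is therefore a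
  version of the integral, and it is \<open>\<F> T\<close>-measurable although the filtration is not
  completed.\<close>

lemma ex_square_integral:
  assumes X: "X \<in> borel_measurable predictable" and fin: "square_norm (time_cut T X) < \<infinity>"
  obtains I where "I \<in> borel_measurable (\<F> T)" "square_integral (time_cut T X) I"
proof -
  note [measurable] = time_cut_Q[OF X, of T]
  note ap = approximable_predictable[OF X fin]
  have "\<forall>n. \<exists>es. elementary M \<mu> N es \<and> (\<forall>(Y, a, b, B)\<in>set es. b \<le> T) \<and>
     square_norm (\<lambda>z. time_cut T X z - eprocess es z) \<le> ennreal ((1/16)^n)"
    using ap unfolding approximable_def by simp
  from choice[OF this] obtain es where es: "\<And>n. elementary M \<mu> N (es n)" "\<And>n. \<forall>(Y, a, b, B)\<in>set (es n). b \<le> T"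
     "\<And>n. square_norm (\<lambda>z. time_cut T X z - eprocess (es n) z) \<le> ennreal ((1/16)^n)"
    by blast
  note [measurable] = eprocess_measurable[OF es(1)]
  let ?E = "\<lambda>n. elementary_integral \<mu> N (es n)"
  have EF: "?E n \<in> borel_measurable (\<F> T)" for n by (rule elementary_integral_measurable[OF es(1,2)])
  have EM [measurable]: "?E n \<in> borel_measurable M" for n by (rule elementary_integral_measurable_M[OF es(1)])
  define I where "I = (\<lambda>\<omega>. lim (\<lambda>n. ?E n \<omega>))"
  have IF: "I \<in> borel_measurable (\<F> T)" unfolding I_def by (rule borel_measurable_lim_metric[OF EF])
  have step: "square_dist M (?E (Suc n)) (?E n) \<le> ennreal (4 * (1/16)^n)" for n
  proof -
    have "square_dist M (?E (Suc n)) (?E n) = square_norm (\<lambda>z. eprocess (es (Suc n)) z - eprocess (es n) z)"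
      by (rule elementary_isometry_diff[OF es(1) es(1)])
    also have "\<dots> \<le> 2 * square_norm (\<lambda>z. eprocess (es (Suc n)) z - time_cut T X z) + 2 * square_norm (\<lambda>z. time_cut T X z - eprocess (es n) z)"
      by (rule square_norm_triangle) measurable
    also have "square_norm (\<lambda>z. eprocess (es (Suc n)) z - time_cut T X z) = square_norm (\<lambda>z. time_cut T X z - eprocess (es (Suc n)) z)"
      by (rule square_norm_commute)
    also have "2 * square_norm (\<lambda>z. time_cut T X z - eprocess (es (Suc n)) z) + 2 * square_norm (\<lambda>z. time_cut T X z - eprocess (es n) z)
        \<le> 2 * ennreal ((1/16)^n) + 2 * ennreal ((1/16)^n)"
    proof (intro add_mono mult_left_mono es(3))
      show "square_norm (\<lambda>z. time_cut T X z - eprocess (es (Suc n)) z) \<le> ennreal ((1/16)^n)"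
        by (rule order_trans[OF es(3)]) (intro ennreal_leI power_decreasing, auto)
    qed auto
    also have "\<dots> = ennreal (2 * (1/16)^n + 2 * (1/16)^n)"
      by (subst ennreal_plus) (auto simp: ennreal_mult)
    also have "\<dots> = ennreal (4 * (1/16)^n)" by simp
    finally show ?thesis .
  qed
  have lim: "square_dist M I (?E n) \<le> ennreal (4 * 4 * (1/16)^n)" for n
    unfolding I_def by (rule geometric_square_limit(2)[OF EM step]) simp
  have geo: "(\<lambda>n. ennreal (c * (1/16)^n)) \<longlonglongrightarrow> 0" for c :: real
  proof -
    have "(\<lambda>n. ennreal (c * (1/16)^n)) \<longlonglongrightarrow> ennreal (c * 0)"
      by (intro tendsto_intros LIMSEQ_realpow_zero) auto
    then show ?thesis by simp
  qed
  have "square_integral (time_cut T X) I"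
    unfolding square_integral_def
  proof (intro conjI exI[of _ es] allI es(1) measurable_filtration[OF IF])
    show "(\<lambda>n. square_norm (\<lambda>z. time_cut T X z - eprocess (es n) z)) \<longlonglongrightarrow> 0"
      by (rule tendsto_sandwich[OF _ _ tendsto_const geo[of 1]]) (auto intro!: always_eventually es(3))
    show "(\<lambda>n. \<integral>\<^sup>+\<omega>. ennreal ((I \<omega> - ?E n \<omega>)\<^sup>2) \<partial>M) \<longlonglongrightarrow> 0"
      by (rule tendsto_sandwich[OF _ _ tendsto_const geo[of "4 * 4"]]) (auto intro!: always_eventually lim[simplified])
  qed
  with IF show thesis by (rule that)
qed

lemma iterated_square_norm:
  assumes "f \<in> borel_measurable Q"
  shows "(\<integral>\<^sup>+(s, x, h). (\<integral>\<^sup>+\<omega>. ennreal ((f (\<omega>, s, x, h))\<^sup>2) \<partial>M) \<partial>\<Lambda>) = square_norm f"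
proof -
  interpret pair_sigma_finite M \<Lambda> by (rule pair_sigma_finite_Q)
  have "(\<lambda>z. ennreal ((f z)\<^sup>2)) \<in> borel_measurable Q" using assms by measurable
  from nn_integral_snd[OF this] show ?thesis by (simp add: square_norm_def case_prod_unfold)
qed

text \<open>The definition integrates over \<omega> inside and over (s, x, h) outside; for a
  predictable integrand Tonelli identifies this with the norm over Q. Without predictability both
  sides are false.\<close>

lemma has_compensated_integral_iff:
  "has_compensated_integral M \<mu> N T X I \<longleftrightarrow>
     (let Z = time_cut T (\<lambda>(\<omega>, s, x, h). X s x h \<omega>) in
      Z \<in> borel_measurable predictable \<and> square_norm Z < \<infinity> \<and> square_integral Z I)"
proof -
  define Z where "Z = time_cut T (\<lambda>(\<omega>, s, x, h). X s x h \<omega>)"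
  have Z: "Z = (\<lambda>(\<omega>, s, x, h). indicator {0<..T} s * X s x h \<omega>)"
    by (auto simp: Z_def time_cut_def)
  have "has_compensated_integral M \<mu> N T X I \<longleftrightarrow> Z \<in> borel_measurable predictable \<and>
     (\<integral>\<^sup>+(s, x, h). (\<integral>\<^sup>+\<omega>. ennreal ((Z (\<omega>, s, x, h))\<^sup>2) \<partial>M) \<partial>\<Lambda>) < \<infinity> \<and> I \<in> borel_measurable M \<and>
     (\<exists>es. (\<forall>n. elementary M \<mu> N (es n)) \<and>
         (\<lambda>n. \<integral>\<^sup>+(s, x, h). (\<integral>\<^sup>+\<omega>. ennreal (((\<lambda>z. Z z - eprocess (es n) z) (\<omega>, s, x, h))\<^sup>2) \<partial>M) \<partial>\<Lambda>) \<longlonglongrightarrow> 0 \<and>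
         (\<lambda>n. \<integral>\<^sup>+\<omega>. ennreal ((I \<omega> - elementary_integral \<mu> N (es n) \<omega>)\<^sup>2) \<partial>M) \<longlonglongrightarrow> 0)"
    unfolding has_compensated_integral_def Let_def Z eprocess_def by simp
  also have "\<dots> \<longleftrightarrow> Z \<in> borel_measurable predictable \<and> square_norm Z < \<infinity> \<and> square_integral Z I"
  proof (cases "Z \<in> borel_measurable predictable")
    case True
    then have ZQ: "Z \<in> borel_measurable Q"
      by (rule predictable_measurable_Q) (simp add: Z)
    have "(\<integral>\<^sup>+(s, x, h). (\<integral>\<^sup>+\<omega>. ennreal (((\<lambda>z. Z z - eprocess es z) (\<omega>, s, x, h))\<^sup>2) \<partial>M) \<partial>\<Lambda>) = square_norm (\<lambda>z. Z z - eprocess es z)"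
      if "elementary M \<mu> N es" for es
      by (rule iterated_square_norm) (use ZQ eprocess_measurable[OF that] in measurable)
    then show ?thesis
      unfolding square_integral_def iterated_square_norm[OF ZQ] by (metis (no_types, lifting) ext)
  qed simp
  finally show ?thesis by (simp add: Z_def Let_def)
qed

end

section \<open>Predictable versions\<close>

text \<open>The left end point of the cell of t among the half-open cells from i / m (excluded) to
  (i + 1) / m (included). The ceiling minus 1 puts it strictly before t even when t is a grid point,
  and the shape of the cells is that of predictable rectangles.\<close>

definition grid_time :: "real \<Rightarrow> real \<Rightarrow> real" where
  "grid_time m t = (of_int \<lceil>t * m\<rceil> - 1) / m"

definition grid_point :: "real \<Rightarrow> 'a::euclidean_space \<Rightarrow> 'a" where
  "grid_point m x = (\<Sum>b\<in>Basis. (of_int \<lfloor>m * (x \<bullet> b)\<rfloor> / m) *\<^sub>R b)"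

lemma grid_time_bounds:
  assumes "0 < m" "0 < t"
  shows "0 \<le> grid_time m t" "grid_time m t < t" "t - grid_time m t \<le> 1 / m"
proof -
  have "1 \<le> \<lceil>t * m\<rceil>" using assms by (simp add: ceiling_le_iff less_ceiling_iff one_le_ceiling)
  then show "0 \<le> grid_time m t" using assms by (simp add: grid_time_def)
  have "of_int \<lceil>t * m\<rceil> - 1 < t * m" by linarith
  then show "grid_time m t < t" using assms by (simp add: grid_time_def field_simps)
  have "t * m \<le> of_int \<lceil>t * m\<rceil>" by linarith
  then show "t - grid_time m t \<le> 1 / m" using assms by (simp add: grid_time_def field_simps)
qed

lemma grid_time_eq:
  assumes m: "0 < m" and t: "real i / m < t" "t \<le> (real i + 1) / m"
  shows "grid_time m t = real i / m"
proof -
  have "\<lceil>t * m\<rceil> = int i + 1"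
    using t m by (intro ceiling_unique) (auto simp: field_simps)
  then show ?thesis by (simp add: grid_time_def)
qed

lemma grid_time_cell:
  assumes m: "0 < m" and t: "0 < t"
  obtains i :: nat where "real i / m < t" "t \<le> (real i + 1) / m"
proof
  define i where "i = nat (\<lceil>t * m\<rceil> - 1)"
  have "1 \<le> \<lceil>t * m\<rceil>" using assms by (simp add: one_le_ceiling)
  then have i: "real i = of_int \<lceil>t * m\<rceil> - 1" by (simp add: i_def)
  have "of_int \<lceil>t * m\<rceil> - 1 < t * m" by linarith
  then show "real i / m < t" using m i by (simp add: field_simps)
  have "t * m \<le> of_int \<lceil>t * m\<rceil>" by linarith
  then show "t \<le> (real i + 1) / m" using m i by (simp add: field_simps)
qed

lemma grid_point_dist:
  fixes x :: "'a::euclidean_space"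
  assumes "0 < m"
  shows "norm (x - grid_point m x) \<le> real DIM('a) / m"
proof -
  have "x - grid_point m x = (\<Sum>b\<in>Basis. (x \<bullet> b - of_int \<lfloor>m * (x \<bullet> b)\<rfloor> / m) *\<^sub>R b)"
    unfolding grid_point_def by (subst euclidean_representation[of x, symmetric]) (simp add: scaleR_left_diff_distrib sum_subtractf)
  also have "norm \<dots> \<le> (\<Sum>b\<in>(Basis :: 'a set). 1 / m)"
  proof (intro order_trans[OF norm_sum] sum_mono)
    fix b :: 'a assume b: "b \<in> Basis"
    have "x \<bullet> b - of_int \<lfloor>m * (x \<bullet> b)\<rfloor> / m = (m * (x \<bullet> b) - of_int \<lfloor>m * (x \<bullet> b)\<rfloor>) / m"
      using assms by (simp add: field_simps)
    moreover have "\<bar>m * (x \<bullet> b) - of_int \<lfloor>m * (x \<bullet> b)\<rfloor>\<bar> \<le> 1" by linarith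
    ultimately have "\<bar>x \<bullet> b - of_int \<lfloor>m * (x \<bullet> b)\<rfloor> / m\<bar> \<le> 1 / m"
      using assms by (simp add: divide_right_mono)
    then show "norm ((x \<bullet> b - of_int \<lfloor>m * (x \<bullet> b)\<rfloor> / m) *\<^sub>R b) \<le> 1 / m" using b by simp
  qed
  finally show ?thesis by simp
qed

lemma grid_point_measurable [measurable]: "grid_point m \<in> borel_measurable borel"
  unfolding grid_point_def[abs_def] by measurable

lemma countable_range_grid_point: "countable (range (grid_point m :: 'a::euclidean_space \<Rightarrow> 'a))"
proof (rule countable_subset)
  show "range (grid_point m :: 'a \<Rightarrow> 'a) \<subseteq> (\<lambda>f. \<Sum>b\<in>Basis. (of_int (f b) / m) *\<^sub>R b) ` (Basis \<rightarrow>\<^sub>E (UNIV :: int set))"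
  proof safe
    fix x :: 'a
    have "grid_point m x = (\<Sum>b\<in>Basis. (of_int (restrict (\<lambda>b. \<lfloor>m * (x \<bullet> b)\<rfloor>) Basis b) / m) *\<^sub>R b)"
      unfolding grid_point_def by (intro sum.cong) auto
    then show "grid_point m x \<in> (\<lambda>f. \<Sum>b\<in>Basis. (of_int (f b) / m) *\<^sub>R b) ` (Basis \<rightarrow>\<^sub>E (UNIV :: int set))"
      by (intro image_eqI[where x = "restrict (\<lambda>b. \<lfloor>m * (x \<bullet> b)\<rfloor>) Basis"]) auto
  qed
  show "countable ((\<lambda>f. \<Sum>b\<in>(Basis :: 'a set). (of_int (f b) / m) *\<^sub>R b) ` (Basis \<rightarrow>\<^sub>E (UNIV :: int set)))"
    by (intro countable_image countable_PiE) auto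
qed

context poisson_noise
begin

lemma predictable_cylinder:
  "B \<in> sets borel \<Longrightarrow> space M \<times> {0<..T} \<times> B \<in> sets predictable"
  by (rule predictable_rectangle[OF _ top_in_filtration]) auto

lemma time_predictable [measurable]: "(\<lambda>z :: 'w \<times> real \<times> 'e::topological_space. fst (snd z)) \<in> borel_measurable predictable"
  unfolding borel_measurable_iff_le
proof
  fix c :: real
  have "{z \<in> space (predictable :: ('w \<times> real \<times> 'e) measure). fst (snd z) \<le> c} = space M \<times> {0<..c} \<times> UNIV"
    unfolding space_predictable by auto
  then show "{z \<in> space (predictable :: ('w \<times> real \<times> 'e) measure). fst (snd z) \<le> c} \<in> sets predictable"
    using predictable_cylinder[of UNIV c] by simp
qed

lemma position_predictable [measurable]: "(\<lambda>z :: 'w \<times> real \<times> 'e::topological_space. snd (snd z)) \<in> borel_measurable predictable"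
proof (rule measurableI)
  fix B :: "'e set" assume B: "B \<in> sets borel"
  have "(\<lambda>z. snd (snd z)) -` B \<inter> space (predictable :: ('w \<times> real \<times> 'e) measure) = (\<Union>n::nat. space M \<times> {0<..real n} \<times> B)"
    unfolding space_predictable using real_arch_simple by auto
  then show "(\<lambda>z. snd (snd z)) -` B \<inter> space (predictable :: ('w \<times> real \<times> 'e) measure) \<in> sets predictable"
    using predictable_cylinder[OF B] by auto
qed auto

lemma deterministic_predictable:
  fixes f :: "real \<times> 'e::second_countable_topology \<Rightarrow> real"
  assumes [measurable]: "f \<in> borel_measurable borel"
  shows "(\<lambda>z. f (snd z)) \<in> borel_measurable predictable"
proof -
  have "(\<lambda>z :: 'w \<times> real \<times> 'e. (fst (snd z), snd (snd z))) \<in> borel_measurable predictable"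
    by (rule borel_measurable_Pair) measurable
  then show ?thesis using assms by (simp add: measurable_compose)
qed

text \<open>Lifts predictability from random fields to integrands with a jump variable: the preimage
  of a rectangle over B is the rectangle over \<open>B \<times> UNIV\<close>.\<close>

lemma drop_jump_measurable:
  "(\<lambda>z. (fst z, fst (snd z), fst (snd (snd z)))) \<in> measurable (predictable :: ('w \<times> real \<times> 'a \<times> 'a) measure) (predictable :: ('w \<times> real \<times> 'a) measure)"
  (is "?f \<in> _")
proof -
  let ?G = "{F \<times> {a<..b} \<times> B | F a b (B :: 'a set). 0 \<le> a \<and> a < b \<and> F \<in> sets (\<F> a) \<and> B \<in> sets borel}"
  have "?f \<in> measurable predictable (sigma (space M \<times> {0<..} \<times> UNIV) ?G)"
  proof (rule measurable_measure_of)
    show "?G \<subseteq> Pow (space M \<times> {0<..} \<times> UNIV)"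
      using filtration_events sets.sets_into_space by fastforce
    show "?f \<in> space predictable \<rightarrow> space M \<times> {0<..} \<times> UNIV"
      unfolding space_predictable by auto
    fix A assume "A \<in> ?G"
    then obtain F a b B where A: "A = F \<times> {a<..b} \<times> B" "0 \<le> a" "F \<in> sets (\<F> a)" "B \<in> sets borel" by blast
    have "F \<subseteq> space M" using A(3) sets.sets_into_space by fastforce
    then have "?f -` A \<inter> space predictable = F \<times> {a<..b} \<times> (B \<times> UNIV)"
      using A(2) unfolding A(1) space_predictable by auto
    moreover have "B \<times> UNIV \<in> sets (borel :: ('a \<times> 'a) measure)"
      using A(4) by (intro borel_Times) auto
    ultimately show "?f -` A \<inter> space predictable \<in> sets predictable"
      using predictable_rectangle[OF A(2,3), of "B \<times> UNIV" b] by simp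
  qed
  then show ?thesis unfolding predictable_sigma_def .
qed

text \<open>On each cell the value does not depend on (t, x) and is known at the left end of the
  time interval. As there are countably many cells, preimages are countable unions of predictable
  rectangles.\<close>

lemma grid_version_predictable:
  fixes I :: "real \<Rightarrow> 'a \<Rightarrow> 'w \<Rightarrow> real"
  assumes I: "\<And>t x. 0 \<le> t \<Longrightarrow> I t x \<in> borel_measurable (\<F> t)" and m: "0 < m"
  shows "(\<lambda>(\<omega>, t, x). I (grid_time m t) (grid_point m x) \<omega>) \<in> borel_measurable predictable"
proof (rule measurableI)
  fix B :: "real set" assume B: "B \<in> sets borel"
  let ?V = "\<lambda>i z. (I (real i / m) z -` B \<inter> space M) \<times> {real i / m<..(real i + 1) / m} \<times> (grid_point m -` {z} :: 'a set)"
  have "(\<lambda>(\<omega>, t, x). I (grid_time m t) (grid_point m x) \<omega>) -` B \<inter> space predictable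
     = (\<Union>i::nat. \<Union>z\<in>range (grid_point m :: 'a \<Rightarrow> 'a). ?V i z)"
  proof (intro set_eqI iffI)
    fix p assume p: "p \<in> (\<lambda>(\<omega>, t, x). I (grid_time m t) (grid_point m x) \<omega>) -` B \<inter> space predictable"
    obtain \<omega> t x where [simp]: "p = (\<omega>, t, x)" by (rule prod_cases3)
    have w: "\<omega> \<in> space M" "0 < t" "I (grid_time m t) (grid_point m x) \<omega> \<in> B"
      using p unfolding space_predictable by auto
    obtain i :: nat where i: "real i / m < t" "t \<le> (real i + 1) / m" using grid_time_cell[OF m w(2)] .
    then have "p \<in> ?V i (grid_point m x)" using w grid_time_eq[OF m i] by auto
    then show "p \<in> (\<Union>i::nat. \<Union>z\<in>range (grid_point m :: 'a \<Rightarrow> 'a). ?V i z)" by blast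
  next
    fix p assume "p \<in> (\<Union>i::nat. \<Union>z\<in>range (grid_point m :: 'a \<Rightarrow> 'a). ?V i z)"
    then obtain i :: nat and z where p: "p \<in> ?V i z" by blast
    obtain \<omega> t x where [simp]: "p = (\<omega>, t, x)" by (rule prod_cases3)
    have i: "real i / m < t" "t \<le> (real i + 1) / m" using p by auto
    moreover have "0 < t" using i(1) m by (smt (verit) divide_nonneg_pos of_nat_0_le_iff)
    ultimately show "p \<in> (\<lambda>(\<omega>, t, x). I (grid_time m t) (grid_point m x) \<omega>) -` B \<inter> space predictable"
      using p grid_time_eq[OF m i] unfolding space_predictable by auto
  qed
  also have "\<dots> \<in> sets predictable"
  proof (intro sets.countable_UN'' countable_range_grid_point predictable_rectangle countableI_type)
    fix i :: nat and z :: 'a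
    show "0 \<le> real i / m" using m by simp
    then show "I (real i / m) z -` B \<inter> space M \<in> sets (\<F> (real i / m))"
      using measurable_sets[OF I B, of "real i / m" z] by simp
    show "(grid_point m -` {z} :: 'a set) \<in> sets borel"
      using measurable_sets[OF grid_point_measurable, of "{z}" m] by simp
  qed
  finally show "(\<lambda>(\<omega>, t, x). I (grid_time m t) (grid_point m x) \<omega>) -` B \<inter> space predictable \<in> sets predictable" .
qed auto

text \<open>Evaluating at the left end point of the time cell keeps the grid approximation adapted;
  refining the grid along the modulus of continuity makes it converge almost surely at every point.\<close>

lemma ex_predictable_version:
  fixes I :: "real \<Rightarrow> 'a \<Rightarrow> 'w \<Rightarrow> real"
  assumes I: "\<And>t x. 0 \<le> t \<Longrightarrow> I t x \<in> borel_measurable (\<F> t)"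
    and cont: "\<And>T e. 0 < T \<Longrightarrow> 0 < e \<Longrightarrow> \<exists>\<eta>>0. \<forall>t\<in>{0..T}. \<forall>t'\<in>{0..T}. \<forall>x x'.
       \<bar>t - t'\<bar> + norm (x - x') < \<eta> \<longrightarrow> square_dist M (I t x) (I t' x') \<le> ennreal e"
  obtains v where "(\<lambda>(\<omega>, t, x). v t x \<omega>) \<in> borel_measurable predictable"
    "\<And>t x. 0 < t \<Longrightarrow> AE \<omega> in M. v t x \<omega> = I t x \<omega>"
proof -
  \<comment> \<open>The horizon \<open>Suc n\<close> grows with the index, so each fixed t is
    covered from some n on.\<close>
  have "\<exists>m>0. \<forall>t\<in>{0<..real (Suc n)}. \<forall>x::'a.
    square_dist M (I (grid_time m t) (grid_point m x)) (I t x) \<le> ennreal ((1/16)^n)" for n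
  proof -
    obtain \<eta> where \<eta>: "0 < \<eta>" "\<And>t t' x x'. t \<in> {0..real (Suc n)} \<Longrightarrow> t' \<in> {0..real (Suc n)} \<Longrightarrow> \<bar>t - t'\<bar> + norm (x - x') < \<eta> \<Longrightarrow>
       square_dist M (I t x) (I t' x') \<le> ennreal ((1/16)^n)"
      using cont[of "real (Suc n)" "(1/16)^n"] by force
    \<comment> \<open>The grid moves time by at most 1 / m and space by at most
      \<open>DIM('a) / m\<close>; the 2 in place of 1 makes the sum strictly smaller than
      \<eta>.\<close>
    define m where "m = (2 + real DIM('a)) / \<eta>"
    have m: "0 < m" using \<eta>(1) by (simp add: m_def)
    have me: "(1 + real DIM('a)) / m < \<eta>"
      using \<eta>(1) by (simp add: m_def field_simps)
    show ?thesis
    proof (intro exI[of _ m] conjI m ballI allI)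
      fix t :: real and x :: 'a assume t: "t \<in> {0<..real (Suc n)}"
      then have "0 < t" by simp
      note g = grid_time_bounds[OF m this]
      have "\<bar>grid_time m t - t\<bar> + norm (grid_point m x - x) \<le> 1 / m + real DIM('a) / m"
        using g grid_point_dist[OF m, of x] by (intro add_mono) (auto simp: norm_minus_commute)
      also have "\<dots> < \<eta>" using me by (simp add: add_divide_distrib)
      finally show "square_dist M (I (grid_time m t) (grid_point m x)) (I t x) \<le> ennreal ((1/16)^n)"
        using g t by (intro \<eta>(2)) auto
    qed
  qed
  then have "\<exists>m. \<forall>n. 0 < m n \<and> (\<forall>t\<in>{0<..real (Suc n)}. \<forall>x::'a.
    square_dist M (I (grid_time (m n) t) (grid_point (m n) x)) (I t x) \<le> ennreal ((1/16)^n))"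
    by (intro choice) blast
  then obtain m :: "nat \<Rightarrow> real" where m: "\<And>n. 0 < m n" and mle: "\<And>n t x. t \<in> {0<..real (Suc n)} \<Longrightarrow>
    square_dist M (I (grid_time (m n) t) (grid_point (m n) x)) (I t x) \<le> ennreal ((1/16)^n)"
    by blast
  define w where "w n t x \<omega> = I (grid_time (m n) t) (grid_point (m n) x) \<omega>" for n t x \<omega>
  define v where "v t x \<omega> = lim (\<lambda>n. w n t x \<omega>)" for t x \<omega>
  show thesis
  proof
    have wm: "(\<lambda>(\<omega>, t, x). w n t x \<omega>) \<in> borel_measurable predictable" for n
      unfolding w_def by (rule grid_version_predictable[OF I m])
    have "(\<lambda>(\<omega>, t, x). v t x \<omega>) = (\<lambda>z. lim (\<lambda>n. (\<lambda>(\<omega>, t, x). w n t x \<omega>) z))"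
      by (auto simp: v_def)
    also have "\<dots> \<in> borel_measurable predictable" by (rule borel_measurable_lim_metric[OF wm])
    finally show "(\<lambda>(\<omega>, t, x). v t x \<omega>) \<in> borel_measurable predictable" .
  next
    fix t :: real and x :: 'a assume t: "0 < t"
    obtain n0 :: nat where n0: "t \<le> real n0" using real_arch_simple by blast
    have "AE \<omega> in M. (\<lambda>n. w n t x \<omega>) \<longlonglongrightarrow> I t x \<omega>"
    proof (rule AE_tendsto_of_geometric)
      show "(\<lambda>\<omega>. w n t x \<omega>) \<in> borel_measurable M" for n
        unfolding w_def using measurable_filtration[OF I[OF grid_time_bounds(1)[OF m t]]] .
      show "(\<lambda>\<omega>. I t x \<omega>) \<in> borel_measurable M" using measurable_filtration[OF I] t by simp
      show "square_dist M (w n t x) (I t x) \<le> ennreal ((1/16)^n)" if "n \<ge> n0" for n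
        unfolding w_def using t n0 that by (intro mle) auto
    qed
    then show "AE \<omega> in M. v t x \<omega> = I t x \<omega>"
      by eventually_elim (simp add: v_def limI)
  qed
qed

end

section \<open>The mild equation\<close>

locale mild_equation = poisson_noise M \<mu> N
  for M :: "'w measure" and \<mu> :: "'a::euclidean_space measure"
    and N :: "'w \<Rightarrow> (real \<times> 'a \<times> 'a) measure" +
  fixes G :: "real \<Rightarrow> 'a \<Rightarrow> real" and \<sigma> :: "real \<Rightarrow> 'a \<Rightarrow> real" and u0 J :: "'a \<Rightarrow> real" and Lip K :: real
  assumes G_measurable: "(\<lambda>(t, x). G t x) \<in> borel_measurable borel"
    and G_nonneg: "\<And>t x. 0 \<le> G t x"
    and G_past: "\<And>t x. t \<le> 0 \<Longrightarrow> G t x = 0"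
    and G_mass: "\<And>t. (\<integral>\<^sup>+x. ennreal (G t x) \<partial>lborel) \<le> 1"
    and G_square: "\<And>e. 0 < e \<Longrightarrow> \<exists>l>0. (\<integral>\<^sup>+(t, x). ennreal (exp (- l * t) * (G t x)\<^sup>2) \<partial>lborel) \<le> ennreal e"
    and u0_measurable [measurable]: "u0 \<in> borel_measurable borel" and u0_bounded: "bounded (range u0)"
    and \<sigma>_measurable: "(\<lambda>(x, h). \<sigma> x h) \<in> borel_measurable borel"
    and \<sigma>_0: "\<And>h. \<sigma> 0 h = 0"
    and J_measurable [measurable]: "J \<in> borel_measurable borel" and J_nonneg: "\<And>h. 0 \<le> J h"
    and Lip_pos: "0 < Lip" and K_pos: "0 < K"
    and \<sigma>_Lipschitz: "\<And>x y h. \<bar>\<sigma> x h - \<sigma> y h\<bar> \<le> J h * Lip * \<bar>x - y\<bar>"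
    and J_square: "(\<integral>\<^sup>+h. ennreal ((J h)\<^sup>2) \<partial>\<mu>) \<le> ennreal K"
begin

definition kernel_weight :: "real \<Rightarrow> ennreal" where
  "kernel_weight l = (\<integral>\<^sup>+(t, x). ennreal (exp (- l * t) * (G t x)\<^sup>2) \<partial>(lborel :: (real \<times> 'a) measure))"

definition field_predictable :: "(real \<Rightarrow> 'a \<Rightarrow> 'w \<Rightarrow> real) \<Rightarrow> bool" where
  "field_predictable v \<longleftrightarrow> (\<lambda>(\<omega>, t, x). v t x \<omega>) \<in> borel_measurable predictable"

definition noise_integrand :: "(real \<Rightarrow> 'a \<Rightarrow> 'w \<Rightarrow> real) \<Rightarrow> real \<Rightarrow> 'a \<Rightarrow> 'w \<times> real \<times> 'a \<times> 'a \<Rightarrow> real" where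
  "noise_integrand v t x = (\<lambda>(\<omega>, s, y, h). G (t - s) (x - y) * \<sigma> (v s y \<omega>) h)"

definition initial_term :: "real \<Rightarrow> 'a \<Rightarrow> real" where
  "initial_term t x = (LINT y|lborel. G t (x - y) * u0 y)"

text \<open>A relation and not a function, since each stochastic integral is determined only up to a
  null set depending on (t, x). A mild solution is a field related to itself.\<close>

definition mild_image :: "(real \<Rightarrow> 'a \<Rightarrow> 'w \<Rightarrow> real) \<Rightarrow> (real \<Rightarrow> 'a \<Rightarrow> 'w \<Rightarrow> real) \<Rightarrow> bool" where
  "mild_image v w \<longleftrightarrow> field_predictable w \<and> (\<forall>t>0. \<forall>x. \<exists>I.
     time_cut t (noise_integrand v t x) \<in> borel_measurable predictable \<and>
     square_norm (time_cut t (noise_integrand v t x)) < \<infinity> \<and>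
     square_integral (time_cut t (noise_integrand v t x)) I \<and>
     (AE \<omega> in M. w t x \<omega> = initial_term t x + I \<omega>))"

lemma mild_solution_iff: "mild_solution M \<mu> N G \<sigma> u0 u \<longleftrightarrow> mild_image u u"
  unfolding mild_solution_def mild_image_def field_predictable_def has_compensated_integral_iff
    Let_def noise_integrand_def initial_term_def by blast

lemma G_measurable_compose [measurable]:
  assumes [measurable]: "f \<in> borel_measurable L" "g \<in> borel_measurable L"
  shows "(\<lambda>z. G (f z) (g z)) \<in> borel_measurable L"
proof -
  have "(\<lambda>z. (f z, g z)) \<in> borel_measurable L" by (rule borel_measurable_Pair) measurable
  from measurable_compose[OF this G_measurable] show ?thesis by simp
qed

lemma \<sigma>_measurable_compose [measurable]:
  assumes [measurable]: "f \<in> borel_measurable L" "g \<in> borel_measurable L"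
  shows "(\<lambda>z. \<sigma> (f z) (g z)) \<in> borel_measurable L"
proof -
  have "(\<lambda>z. (f z, g z)) \<in> borel_measurable L" by (rule borel_measurable_Pair) measurable
  from measurable_compose[OF this \<sigma>_measurable] show ?thesis by simp
qed

lemma field_section_measurable:
  assumes v: "field_predictable v" and t: "0 < t"
  shows "v t x \<in> borel_measurable M"
proof -
  let ?G = "{F \<times> {a<..b} \<times> B | F a b (B :: 'a set). 0 \<le> a \<and> a < b \<and> F \<in> sets (\<F> a) \<and> B \<in> sets borel}"
  have "(\<lambda>\<omega>. (\<omega>, t, x)) \<in> measurable M (sigma (space M \<times> {0<..} \<times> UNIV) ?G)"
  proof (rule measurable_measure_of)
    show "?G \<subseteq> Pow (space M \<times> {0<..} \<times> UNIV)"
      using filtration_events sets.sets_into_space by fastforce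
    show "(\<lambda>\<omega>. (\<omega>, t, x)) \<in> space M \<rightarrow> space M \<times> {0<..} \<times> UNIV" using t by auto
    fix A assume "A \<in> ?G"
    then obtain F a b B where A: "A = F \<times> {a<..b} \<times> B" "F \<in> sets (\<F> a)" by blast
    have F: "F \<in> events" using A(2) filtration_events by auto
    have "(\<lambda>\<omega>. (\<omega>, t, x)) -` A \<inter> space M = (if t \<in> {a<..b} \<and> x \<in> B then F \<inter> space M else {})"
      unfolding A(1) by auto
    then show "(\<lambda>\<omega>. (\<omega>, t, x)) -` A \<inter> space M \<in> events" using F by auto
  qed
  then have "(\<lambda>\<omega>. (\<omega>, t, x)) \<in> measurable M predictable" unfolding predictable_sigma_def .
  from measurable_compose[OF this v[unfolded field_predictable_def]] show ?thesis by simp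
qed

lemma noise_integrand_predictable:
  assumes v: "field_predictable v"
  shows "noise_integrand v t x \<in> borel_measurable predictable"
proof -
  have "(\<lambda>z. (\<lambda>(\<omega>, t, x). v t x \<omega>) (fst z, fst (snd z), fst (snd (snd z)))) \<in> borel_measurable (predictable :: ('w \<times> real \<times> 'a \<times> 'a) measure)"
    by (rule measurable_compose[OF drop_jump_measurable v[unfolded field_predictable_def]])
  then have [measurable]: "(\<lambda>z. v (fst (snd z)) (fst (snd (snd z))) (fst z)) \<in> borel_measurable (predictable :: ('w \<times> real \<times> 'a \<times> 'a) measure)"
    by simp
  have f: "fst \<in> borel_measurable (borel :: ('a \<times> 'a) measure)" and s: "snd \<in> borel_measurable (borel :: ('a \<times> 'a) measure)"
    by (auto intro!: borel_measurable_continuous_onI continuous_intros)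
  note [measurable] = measurable_compose[OF position_predictable f] measurable_compose[OF position_predictable s]
  have "noise_integrand v t x = (\<lambda>z. G (t - fst (snd z)) (x - fst (snd (snd z))) * \<sigma> (v (fst (snd z)) (fst (snd (snd z))) (fst z)) (snd (snd (snd z))))"
    by (auto simp: noise_integrand_def)
  also have "\<dots> \<in> borel_measurable predictable" by measurable
  finally show ?thesis .
qed

section \<open>Mean square estimates for the integrand\<close>

lemma intensity_measurable:
  assumes f: "f \<in> borel_measurable borel"
  shows "f \<in> borel_measurable \<Lambda>"
proof -
  have 1: "fst \<in> measurable \<Lambda> (restrict_space lborel {0..})" "snd \<in> measurable \<Lambda> marks"
    unfolding intensity_def by measurable
  have 2: "(\<lambda>s. s) \<in> measurable (restrict_space lborel {0::real..}) borel"
    by (intro measurable_restrict_space1) simp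
  have 3: "(\<lambda>z. z) \<in> measurable marks borel" by (simp add: measurable_ident_sets)
  have "(\<lambda>z. (fst z, snd z)) \<in> borel_measurable \<Lambda>"
    using measurable_compose[OF 1(1) 2] measurable_compose[OF 1(2) 3] by (intro borel_measurable_Pair)
  from measurable_compose[OF this[simplified] f] show ?thesis .
qed

text \<open>The jump variable is integrated out first, J contributing at most K. The time domain is
  then enlarged from \<open>{0..}\<close> to the whole line, where reflections of space-time are
  available.\<close>

lemma intensity_integral_le:
  fixes f :: "real \<times> 'a \<Rightarrow> ennreal"
  assumes f: "f \<in> borel_measurable borel"
  shows "(\<integral>\<^sup>+(s, y, h). f (s, y) * ennreal ((J h)\<^sup>2) \<partial>\<Lambda>) \<le> ennreal K * (\<integral>\<^sup>+z. f z \<partial>lborel)"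
proof -
  interpret m: sigma_finite_measure marks by (rule sigma_finite_marks)
  interpret u: sigma_finite_measure \<mu> by (rule sigma_finite_mu)
  have "(\<lambda>z::real \<times> 'a \<times> 'a. (fst z, fst (snd z))) \<in> borel_measurable borel" "(\<lambda>z::real \<times> 'a \<times> 'a. snd (snd z)) \<in> borel_measurable borel"
    by (auto intro!: borel_measurable_continuous_onI continuous_intros)
  from measurable_compose[OF this(1) f] measurable_compose[OF this(2) J_measurable]
  have "(\<lambda>z. f (fst z, fst (snd z)) * ennreal ((J (snd (snd z)))\<^sup>2)) \<in> borel_measurable (borel :: (real \<times> 'a \<times> 'a) measure)"
    by measurable
  then have g: "(\<lambda>(s, y, h). f (s, y) * ennreal ((J h)\<^sup>2)) \<in> borel_measurable \<Lambda>"
    by (intro intensity_measurable) (simp add: case_prod_unfold)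
  have gs: "(\<lambda>(y, h). f (s, y) * ennreal ((J h)\<^sup>2)) \<in> borel_measurable marks" for s
  proof -
    have "(\<lambda>z::'a \<times> 'a. (s, fst z)) \<in> borel_measurable borel" "(\<lambda>z::'a \<times> 'a. snd z) \<in> borel_measurable borel"
      by (auto intro!: borel_measurable_continuous_onI continuous_intros)
    from measurable_compose[OF this(1) f] measurable_compose[OF this(2) J_measurable]
    have "(\<lambda>z. f (s, fst z) * ennreal ((J (snd z))\<^sup>2)) \<in> borel_measurable (borel :: ('a \<times> 'a) measure)"
      by measurable
    then show ?thesis by (simp add: case_prod_unfold measurable_cong_sets[OF sets_marks refl])
  qed
  have fs: "(\<lambda>y. f (s, y)) \<in> borel_measurable borel" for s
    by (rule measurable_compose[OF _ f]) (auto intro!: borel_measurable_continuous_onI continuous_intros)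
  have "(\<integral>\<^sup>+(s, y, h). f (s, y) * ennreal ((J h)\<^sup>2) \<partial>\<Lambda>)
      = (\<integral>\<^sup>+s. (\<integral>\<^sup>+(y, h). f (s, y) * ennreal ((J h)\<^sup>2) \<partial>marks) \<partial>restrict_space lborel {0..})"
    using m.nn_integral_fst[OF g[unfolded intensity_def], symmetric] by (simp add: intensity_def case_prod_unfold)
  also have "\<dots> = (\<integral>\<^sup>+s. (\<integral>\<^sup>+y. (\<integral>\<^sup>+h. f (s, y) * ennreal ((J h)\<^sup>2) \<partial>\<mu>) \<partial>lborel) \<partial>restrict_space lborel {0..})"
  proof (intro nn_integral_cong)
    fix s
    show "(\<integral>\<^sup>+(y, h). f (s, y) * ennreal ((J h)\<^sup>2) \<partial>marks) = (\<integral>\<^sup>+y. (\<integral>\<^sup>+h. f (s, y) * ennreal ((J h)\<^sup>2) \<partial>\<mu>) \<partial>lborel)"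
      using u.nn_integral_fst[OF gs[of s], symmetric] by (simp add: case_prod_unfold)
  qed
  also have "\<dots> \<le> (\<integral>\<^sup>+s. (\<integral>\<^sup>+y. ennreal K * f (s, y) \<partial>lborel) \<partial>restrict_space lborel {0..})"
  proof (intro nn_integral_mono)
    fix s y
    have "(\<integral>\<^sup>+h. f (s, y) * ennreal ((J h)\<^sup>2) \<partial>\<mu>) = f (s, y) * (\<integral>\<^sup>+h. ennreal ((J h)\<^sup>2) \<partial>\<mu>)"
      by (rule nn_integral_cmult) measurable
    also have "\<dots> \<le> f (s, y) * ennreal K" by (intro mult_left_mono J_square) auto
    finally show "(\<integral>\<^sup>+h. f (s, y) * ennreal ((J h)\<^sup>2) \<partial>\<mu>) \<le> ennreal K * f (s, y)" by (simp add: mult.commute)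
  qed
  also have "\<dots> = (\<integral>\<^sup>+s. (\<integral>\<^sup>+y. ennreal K * f (s, y) \<partial>lborel) * indicator {0..} s \<partial>lborel)"
    by (rule nn_integral_restrict_space) simp
  also have "\<dots> \<le> (\<integral>\<^sup>+s. (\<integral>\<^sup>+y. ennreal K * f (s, y) \<partial>lborel) \<partial>lborel)"
    by (intro nn_integral_mono) (auto simp: indicator_def)
  also have "\<dots> = (\<integral>\<^sup>+z. ennreal K * f z \<partial>(lborel \<Otimes>\<^sub>M lborel))"
    by (rule lborel.nn_integral_fst) (use f in \<open>simp add: borel_prod lborel_prod\<close>)
  also have "\<dots> = ennreal K * (\<integral>\<^sup>+z. f z \<partial>lborel)"
    unfolding lborel_prod by (rule nn_integral_cmult) (use f in simp)
  finally show ?thesis .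
qed

text \<open>One estimate for two uses: k the kernel and V a difference of fields for the
  contraction, k a difference of shifted kernels and V the field itself for mean square continuity.
  The bound \<open>D * exp (l * s)\<close> places V in a ball of the weighted norm.\<close>

lemma square_norm_le:
  fixes k :: "real \<times> 'a \<Rightarrow> real"
  assumes F: "F \<in> borel_measurable Q"
    and 0: "\<And>\<omega> s y h. \<not> (0 < s \<and> s \<le> T) \<Longrightarrow> F (\<omega>, s, y, h) = 0"
    and le: "\<And>\<omega> s y h. 0 < s \<Longrightarrow> s \<le> T \<Longrightarrow> \<bar>F (\<omega>, s, y, h)\<bar> \<le> \<bar>k (s, y)\<bar> * (J h * Lip * \<bar>V s y \<omega>\<bar>)"
    and k: "k \<in> borel_measurable borel"
    and V: "\<And>s y. 0 < s \<Longrightarrow> V s y \<in> borel_measurable M"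
    and bound: "\<And>s y. 0 < s \<Longrightarrow> s \<le> T \<Longrightarrow> (\<integral>\<^sup>+\<omega>. ennreal ((V s y \<omega>)\<^sup>2) \<partial>M) \<le> ennreal (D * exp (l * s))"
    and D: "0 \<le> D"
  shows "square_norm F \<le> ennreal (Lip\<^sup>2 * K * D) * (\<integral>\<^sup>+z. ennreal (exp (l * fst z) * (k z)\<^sup>2) \<partial>lborel)"
proof -
  note [measurable] = k
  have fm: "(\<lambda>z. ennreal (Lip\<^sup>2 * D * (exp (l * fst z) * (k z)\<^sup>2))) \<in> borel_measurable borel" by measurable
  have "square_norm F = (\<integral>\<^sup>+(s, y, h). (\<integral>\<^sup>+\<omega>. ennreal ((F (\<omega>, s, y, h))\<^sup>2) \<partial>M) \<partial>\<Lambda>)"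
    by (rule iterated_square_norm[OF F, symmetric])
  also have "\<dots> \<le> (\<integral>\<^sup>+(s, y, h). ennreal (Lip\<^sup>2 * D * (exp (l * fst (s, y)) * (k (s, y))\<^sup>2)) * ennreal ((J h)\<^sup>2) \<partial>\<Lambda>)"
  proof (intro nn_integral_mono, clarify)
    fix s :: real and y h :: 'a
    show "(\<integral>\<^sup>+\<omega>. ennreal ((F (\<omega>, s, y, h))\<^sup>2) \<partial>M) \<le> ennreal (Lip\<^sup>2 * D * (exp (l * fst (s, y)) * (k (s, y))\<^sup>2)) * ennreal ((J h)\<^sup>2)"
    proof (cases "0 < s \<and> s \<le> T")
      case False
      then show ?thesis by (simp add: 0)
    next
      case True
      have [measurable]: "V s y \<in> borel_measurable M" using V True by blast
      let ?c = "(k (s, y))\<^sup>2 * (J h)\<^sup>2 * Lip\<^sup>2"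
      have "(\<integral>\<^sup>+\<omega>. ennreal ((F (\<omega>, s, y, h))\<^sup>2) \<partial>M) \<le> (\<integral>\<^sup>+\<omega>. ennreal ?c * ennreal ((V s y \<omega>)\<^sup>2) \<partial>M)"
      proof (intro nn_integral_mono)
        fix \<omega>
        have "\<bar>F (\<omega>, s, y, h)\<bar>\<^sup>2 \<le> (\<bar>k (s, y)\<bar> * (J h * Lip * \<bar>V s y \<omega>\<bar>))\<^sup>2"
          using le True by (intro power_mono) auto
        then have "(F (\<omega>, s, y, h))\<^sup>2 \<le> ?c * (V s y \<omega>)\<^sup>2" by (simp add: power_mult_distrib mult_ac)
        then show "ennreal ((F (\<omega>, s, y, h))\<^sup>2) \<le> ennreal ?c * ennreal ((V s y \<omega>)\<^sup>2)"
          by (simp add: ennreal_mult[symmetric] ennreal_leI)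
      qed
      also have "\<dots> = ennreal ?c * (\<integral>\<^sup>+\<omega>. ennreal ((V s y \<omega>)\<^sup>2) \<partial>M)"
        by (rule nn_integral_cmult) measurable
      also have "\<dots> \<le> ennreal ?c * ennreal (D * exp (l * s))"
        using bound True by (intro mult_left_mono) auto
      also have "\<dots> = ennreal (Lip\<^sup>2 * D * (exp (l * fst (s, y)) * (k (s, y))\<^sup>2)) * ennreal ((J h)\<^sup>2)"
        using D by (simp add: ennreal_mult[symmetric] mult_ac)
      finally show ?thesis .
    qed
  qed
  also have "\<dots> \<le> ennreal K * (\<integral>\<^sup>+z. ennreal (Lip\<^sup>2 * D * (exp (l * fst z) * (k z)\<^sup>2)) \<partial>lborel)"
    using intensity_integral_le[OF fm] .
  also have "(\<integral>\<^sup>+z. ennreal (Lip\<^sup>2 * D * (exp (l * fst z) * (k z)\<^sup>2)) \<partial>lborel) = ennreal (Lip\<^sup>2 * D) * (\<integral>\<^sup>+z. ennreal (exp (l * fst z) * (k z)\<^sup>2) \<partial>(lborel :: (real \<times> 'a) measure))"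
    using D by (subst nn_integral_cmult[symmetric]) (auto simp: ennreal_mult)
  also have "ennreal K * (ennreal (Lip\<^sup>2 * D) * (\<integral>\<^sup>+z. ennreal (exp (l * fst z) * (k z)\<^sup>2) \<partial>(lborel :: (real \<times> 'a) measure))) =
     ennreal (Lip\<^sup>2 * K * D) * (\<integral>\<^sup>+z. ennreal (exp (l * fst z) * (k z)\<^sup>2) \<partial>(lborel :: (real \<times> 'a) measure))"
  proof -
    have "ennreal K * ennreal (Lip\<^sup>2 * D) = ennreal (Lip\<^sup>2 * K * D)"
      using D K_pos by (simp add: ennreal_mult[symmetric])
    then show ?thesis by (simp only: mult.assoc[symmetric])
  qed
  finally show ?thesis .
qed

text \<open>The reflection of z into (t, x) - z turns the convolution into
  \<open>kernel_weight l\<close>. The factor \<open>exp (l * t)\<close> is again the growth that the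
  weighted norm allows, so the estimates close on themselves.\<close>

lemma kernel_weight_shift:
  "(\<integral>\<^sup>+z. ennreal (exp (l * fst z) * (G (t - fst z) (x - snd z))\<^sup>2) \<partial>lborel) = ennreal (exp (l * t)) * kernel_weight l"
proof -
  let ?f = "\<lambda>z::real \<times> 'a. ennreal (exp (- l * fst z) * (G (fst z) (snd z))\<^sup>2)"
  have f: "?f \<in> borel_measurable borel" by measurable
  have "(\<integral>\<^sup>+z. ennreal (exp (l * fst z) * (G (t - fst z) (x - snd z))\<^sup>2) \<partial>lborel) = (\<integral>\<^sup>+z. ennreal (exp (l * t)) * ?f ((t, x) - z) \<partial>lborel)"
    by (intro nn_integral_cong) (simp add: ennreal_mult[symmetric] mult.assoc[symmetric] exp_add[symmetric] algebra_simps)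
  also have "\<dots> = ennreal (exp (l * t)) * (\<integral>\<^sup>+z. ?f ((t, x) - z) \<partial>lborel)"
    by (rule nn_integral_cmult) measurable
  also have "(\<integral>\<^sup>+z. ?f ((t, x) - z) \<partial>lborel) = (\<integral>\<^sup>+z. ?f z \<partial>lborel)"
    by (rule reflect_nn_integral[OF f])
  finally show ?thesis by (simp add: kernel_weight_def case_prod_unfold)
qed

lemma noise_integrand_diff_le:
  assumes v: "field_predictable v" and w: "field_predictable w"
    and bound: "\<And>s y. 0 < s \<Longrightarrow> s \<le> t \<Longrightarrow> square_dist M (v s y) (w s y) \<le> ennreal (D * exp (l * s))"
    and D: "0 \<le> D"
  shows "square_norm (\<lambda>z. time_cut t (noise_integrand v t x) z - time_cut t (noise_integrand w t x) z)
     \<le> ennreal (Lip\<^sup>2 * K * D) * (ennreal (exp (l * t)) * kernel_weight l)"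
proof -
  note [measurable] = time_cut_Q[OF noise_integrand_predictable[OF v]] time_cut_Q[OF noise_integrand_predictable[OF w]]
  have "square_norm (\<lambda>z. time_cut t (noise_integrand v t x) z - time_cut t (noise_integrand w t x) z)
     \<le> ennreal (Lip\<^sup>2 * K * D) * (\<integral>\<^sup>+z. ennreal (exp (l * fst z) * ((\<lambda>z. G (t - fst z) (x - snd z)) z)\<^sup>2) \<partial>lborel)"
  proof (rule square_norm_le[where V = "\<lambda>s y \<omega>. v s y \<omega> - w s y \<omega>", OF _ _ _ _ _ bound D])
    fix \<omega> s y h assume s: "0 < s" "s \<le> t"
    have "\<bar>G (t - s) (x - y) * (\<sigma> (v s y \<omega>) h - \<sigma> (w s y \<omega>) h)\<bar> \<le> \<bar>G (t - s) (x - y)\<bar> * (J h * Lip * \<bar>v s y \<omega> - w s y \<omega>\<bar>)"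
      unfolding abs_mult by (intro mult_left_mono \<sigma>_Lipschitz) auto
    then show "\<bar>time_cut t (noise_integrand v t x) (\<omega>, s, y, h) - time_cut t (noise_integrand w t x) (\<omega>, s, y, h)\<bar>
         \<le> \<bar>G (t - fst (s, y)) (x - snd (s, y))\<bar> * (J h * Lip * \<bar>v s y \<omega> - w s y \<omega>\<bar>)"
      using s by (simp add: time_cut_def noise_integrand_def right_diff_distrib)
  next
    show "(\<lambda>\<omega>. v s y \<omega> - w s y \<omega>) \<in> borel_measurable M" if "0 < s" for s y
      using field_section_measurable[OF v that] field_section_measurable[OF w that] by measurable
    show "(\<lambda>z. G (t - fst z) (x - snd z)) \<in> borel_measurable borel" by measurable
    show "(\<lambda>z. time_cut t (noise_integrand v t x) z - time_cut t (noise_integrand w t x) z) \<in> borel_measurable Q" by measurable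
  qed (auto simp: time_cut_def)
  then show ?thesis unfolding kernel_weight_shift .
qed

lemma field_predictable_0: "field_predictable (\<lambda>t x \<omega>. 0)"
  by (simp add: field_predictable_def case_prod_unfold)

lemma noise_integrand_0: "time_cut t (noise_integrand (\<lambda>t x \<omega>. 0) t x) = (\<lambda>z. 0)"
  by (auto simp: time_cut_def noise_integrand_def \<sigma>_0)

text \<open>Comparison with the zero field, whose integrand vanishes because
  \<open>\<sigma> 0 h = 0\<close>.\<close>

lemma noise_integrand_le:
  assumes v: "field_predictable v"
    and bound: "\<And>s y. 0 < s \<Longrightarrow> s \<le> t \<Longrightarrow> (\<integral>\<^sup>+\<omega>. ennreal ((v s y \<omega>)\<^sup>2) \<partial>M) \<le> ennreal (D * exp (l * s))"
    and D: "0 \<le> D"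
  shows "square_norm (time_cut t (noise_integrand v t x)) \<le> ennreal (Lip\<^sup>2 * K * D) * (ennreal (exp (l * t)) * kernel_weight l)"
  using noise_integrand_diff_le[OF v field_predictable_0 _ D, of t l x] bound by (simp add: noise_integrand_0)

section \<open>Mean square continuity of the stochastic convolution\<close>

definition cut_kernel :: "real \<Rightarrow> real \<times> 'a \<Rightarrow> real" where
  "cut_kernel T z = (if fst z \<le> T then G (fst z) (snd z) else 0)"

lemma cut_kernel_measurable [measurable]: "cut_kernel T \<in> borel_measurable borel"
proof -
  show ?thesis unfolding cut_kernel_def[abs_def] by measurable
qed

text \<open>Up to time T the weight \<open>exp (- l * t)\<close> is at least
  \<open>exp (- l * T)\<close>, so the truncated kernel is square integrable without a weight, as
  continuity of translations requires.\<close>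

lemma cut_kernel_square:
  assumes "0 < l"
  shows "(\<integral>\<^sup>+z. ennreal ((cut_kernel T z)\<^sup>2) \<partial>lborel) \<le> ennreal (exp (l * T)) * kernel_weight l"
proof -
  have "(\<integral>\<^sup>+z. ennreal ((cut_kernel T z)\<^sup>2) \<partial>lborel) \<le> (\<integral>\<^sup>+z. ennreal (exp (l * T)) * ennreal (exp (- l * fst z) * (G (fst z) (snd z))\<^sup>2) \<partial>lborel)"
  proof (rule nn_integral_mono)
    fix z
    show "ennreal ((cut_kernel T z)\<^sup>2) \<le> ennreal (exp (l * T)) * ennreal (exp (- l * fst z) * (G (fst z) (snd z))\<^sup>2)"
    proof (cases "fst z \<le> T")
      case True
      then have "1 \<le> exp (l * T) * exp (- l * fst z)" using assms by (simp add: exp_add[symmetric] mult_left_mono)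
      then have "1 * (G (fst z) (snd z))\<^sup>2 \<le> (exp (l * T) * exp (- l * fst z)) * (G (fst z) (snd z))\<^sup>2" by (rule mult_right_mono) simp
      then show ?thesis using True by (simp add: cut_kernel_def ennreal_mult[symmetric] mult.assoc ennreal_leI)
    qed (simp add: cut_kernel_def)
  qed
  also have "\<dots> = ennreal (exp (l * T)) * kernel_weight l"
    unfolding kernel_weight_def case_prod_unfold by (rule nn_integral_cmult) measurable
  finally show ?thesis .
qed

text \<open>Causality lets both integrands be read as the single function
  \<open>cut_kernel T\<close>, taken at (t, x) - z and at (t', x') - z, even when t and t' differ.
  After a reflection their difference is a translation error.\<close>

lemma noise_integrand_translate_le:
  assumes v: "field_predictable v" and l: "0 < l"
    and bound: "\<And>s y. 0 < s \<Longrightarrow> (\<integral>\<^sup>+\<omega>. ennreal ((v s y \<omega>)\<^sup>2) \<partial>M) \<le> ennreal (D * exp (l * s))"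
    and D: "0 \<le> D" and t: "0 \<le> t" "t \<le> T" "0 \<le> t'" "t' \<le> T"
  shows "square_norm (\<lambda>z. time_cut t (noise_integrand v t x) z - time_cut t' (noise_integrand v t' x') z)
     \<le> ennreal (Lip\<^sup>2 * K * D) * (ennreal (exp (l * T)) * translation_error (cut_kernel T) (t' - t, x' - x))"
proof -
  let ?k = "\<lambda>z. cut_kernel T ((t, x) - z) - cut_kernel T ((t', x') - z)"
  note [measurable] = time_cut_Q[OF noise_integrand_predictable[OF v]]
  \<comment> \<open>For s \<ge> r the kernel vanishes by causality, which makes the time cut
    automatic; for s > 0 the truncation at T is inactive because r - s \<le> T.\<close>
  have cut: "time_cut r (noise_integrand v r z) (\<omega>, s, y, h) = cut_kernel T ((r, z) - (s, y)) * \<sigma> (v s y \<omega>) h"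
    if "0 < s" "r \<le> T" for r z \<omega> s y h
    using that G_past[of "r - s"] by (auto simp: time_cut_def noise_integrand_def cut_kernel_def indicator_def)
  have "square_norm (\<lambda>z. time_cut t (noise_integrand v t x) z - time_cut t' (noise_integrand v t' x') z)
     \<le> ennreal (Lip\<^sup>2 * K * D) * (\<integral>\<^sup>+z. ennreal (exp (l * fst z) * (?k z)\<^sup>2) \<partial>lborel)"
  proof (rule square_norm_le[where V = v and T = T, OF _ _ _ _ _ _ D])
    fix \<omega> s y h assume s: "0 < s" "s \<le> T"
    have "\<bar>\<sigma> (v s y \<omega>) h\<bar> \<le> J h * Lip * \<bar>v s y \<omega>\<bar>" using \<sigma>_Lipschitz[of "v s y \<omega>" h 0] by (simp add: \<sigma>_0)
    then have "\<bar>?k (s, y) * \<sigma> (v s y \<omega>) h\<bar> \<le> \<bar>?k (s, y)\<bar> * (J h * Lip * \<bar>v s y \<omega>\<bar>)"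
      unfolding abs_mult by (intro mult_left_mono) auto
    then show "\<bar>time_cut t (noise_integrand v t x) (\<omega>, s, y, h) - time_cut t' (noise_integrand v t' x') (\<omega>, s, y, h)\<bar>
         \<le> \<bar>?k (s, y)\<bar> * (J h * Lip * \<bar>v s y \<omega>\<bar>)"
      unfolding cut[OF s(1) t(2)] cut[OF s(1) t(4)] by (simp add: left_diff_distrib)
  next
    show "v s y \<in> borel_measurable M" if "0 < s" for s y
      using field_section_measurable[OF v that] .
    show "?k \<in> borel_measurable borel" by measurable
    show "(\<lambda>z. time_cut t (noise_integrand v t x) z - time_cut t' (noise_integrand v t' x') z) \<in> borel_measurable Q" by measurable
  qed (use t bound in \<open>auto simp: time_cut_def\<close>)
  also have "\<dots> \<le> ennreal (Lip\<^sup>2 * K * D) * (\<integral>\<^sup>+z. ennreal (exp (l * T)) * ennreal ((?k z)\<^sup>2) \<partial>lborel)"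
  proof (intro mult_left_mono nn_integral_mono)
    fix z :: "real \<times> 'a"
    show "ennreal (exp (l * fst z) * (?k z)\<^sup>2) \<le> ennreal (exp (l * T)) * ennreal ((?k z)\<^sup>2)"
    proof (cases "fst z \<le> T")
      case True
      then have "exp (l * fst z) \<le> exp (l * T)" using l by simp
      then show ?thesis by (simp add: ennreal_mult[symmetric] mult_right_mono ennreal_leI)
    next
      \<comment> \<open>Beyond T both t - fst z and t' - fst z are negative, so the growing weight
        is never evaluated past T.\<close>
      case False
      then have "?k z = 0" using t by (simp add: cut_kernel_def G_past)
      then show ?thesis by simp
    qed
  qed simp
  also have "(\<integral>\<^sup>+z. ennreal (exp (l * T)) * ennreal ((?k z)\<^sup>2) \<partial>lborel) = ennreal (exp (l * T)) * (\<integral>\<^sup>+z. ennreal ((?k z)\<^sup>2) \<partial>lborel)"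
    by (rule nn_integral_cmult) measurable
  also have "(\<integral>\<^sup>+z. ennreal ((?k z)\<^sup>2) \<partial>lborel) = (\<integral>\<^sup>+z. (\<lambda>w. ennreal ((cut_kernel T w - cut_kernel T (w + (t' - t, x' - x)))\<^sup>2)) ((t, x) - z) \<partial>lborel)"
    by (intro nn_integral_cong) (simp add: algebra_simps prod_eq_iff split: prod.splits)
  also have "\<dots> = (\<integral>\<^sup>+w. ennreal ((cut_kernel T w - cut_kernel T (w + (t' - t, x' - x)))\<^sup>2) \<partial>lborel)"
    by (rule reflect_nn_integral) measurable
  also have "\<dots> = translation_error (cut_kernel T) (t' - t, x' - x)"
    unfolding translation_error_def by (rule nn_integral_square_commute)
  finally show ?thesis .
qed

lemma cut_kernel_translation:
  assumes l: "0 < l" "kernel_weight l < \<infinity>" and e: "0 < e"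
  obtains \<eta> where "0 < \<eta>" "\<And>d. norm d < \<eta> \<Longrightarrow> translation_error (cut_kernel T) d \<le> ennreal e"
proof -
  have "(translation_error (cut_kernel T) \<longlongrightarrow> 0) (at 0)"
  proof (rule translation_error_tendsto_0)
    show "0 \<le> cut_kernel T z" for z by (simp add: cut_kernel_def G_nonneg)
    show "(\<integral>\<^sup>+z. ennreal ((cut_kernel T z)\<^sup>2) \<partial>lborel) < \<infinity>"
      using cut_kernel_square[OF l(1), of T] l(2) by (auto intro: le_less_trans simp: ennreal_mult_less_top)
  qed measurable
  then have "\<forall>\<^sub>F d in at 0. translation_error (cut_kernel T) d < ennreal e"
    by (rule order_tendstoD) (use e in simp)
  then obtain \<eta> where \<eta>: "0 < \<eta>" "\<And>d. d \<noteq> 0 \<Longrightarrow> norm d < \<eta> \<Longrightarrow> translation_error (cut_kernel T) d < ennreal e"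
    unfolding eventually_at by auto
  show thesis
  proof
    show "translation_error (cut_kernel T) d \<le> ennreal e" if "norm d < \<eta>" for d
      \<comment> \<open>The filter \<open>at 0\<close> says nothing about d = 0, where the error is
        0.\<close>
      using \<eta>(2)[of d] that by (cases "d = 0") (auto simp: translation_error_def)
  qed (rule \<eta>)
qed

section \<open>The mild map: bounds, contraction and fixed point\<close>

lemma initial_term_measurable: "(\<lambda>z. initial_term (fst z) (snd z)) \<in> borel_measurable borel"
proof -
  have "(\<lambda>z. LINT y|lborel. G (fst z) (snd z - y) * u0 y) \<in> borel_measurable (borel \<Otimes>\<^sub>M borel)"
    by measurable
  then show ?thesis by (simp add: initial_term_def borel_prod)
qed

text \<open>G has mass at most 1, so the convolution inherits the bound on u0; where it is not
  integrable its value is 0 by convention.\<close>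

lemma initial_term_bound: obtains c where "0 \<le> c" "\<And>t x. \<bar>initial_term t x\<bar> \<le> c"
proof -
  obtain c where c: "\<And>y. \<bar>u0 y\<bar> \<le> c" using u0_bounded unfolding bounded_iff by auto
  have c0: "0 \<le> c" using c[of 0] by simp
  have "\<bar>initial_term t x\<bar> \<le> c" for t x
  proof (cases "integrable lborel (\<lambda>y. G t (x - y) * u0 y)")
    case True
    have "ennreal (norm (initial_term t x)) \<le> (\<integral>\<^sup>+y. ennreal (norm (G t (x - y) * u0 y)) \<partial>lborel)"
      unfolding initial_term_def by (rule integral_norm_bound_ennreal[OF True])
    also have "\<dots> \<le> (\<integral>\<^sup>+y. ennreal c * ennreal (G t (x - y)) \<partial>lborel)"
    proof (rule nn_integral_mono)
      fix y
      have "\<bar>G t (x - y)\<bar> * \<bar>u0 y\<bar> \<le> \<bar>G t (x - y)\<bar> * c" by (intro mult_left_mono c) auto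
      then show "ennreal (norm (G t (x - y) * u0 y)) \<le> ennreal c * ennreal (G t (x - y))"
        using c0 G_nonneg[of t "x - y"] by (simp add: abs_mult ennreal_mult[symmetric] mult.commute ennreal_leI)
    qed
    also have "\<dots> = ennreal c * (\<integral>\<^sup>+y. ennreal (G t (x - y)) \<partial>lborel)" by (rule nn_integral_cmult) measurable
    also have "(\<integral>\<^sup>+y. ennreal (G t (x - y)) \<partial>lborel) = (\<integral>\<^sup>+y. ennreal (G t y) \<partial>lborel)"
      by (rule reflect_nn_integral) measurable
    also have "ennreal c * (\<integral>\<^sup>+y. ennreal (G t y) \<partial>lborel) \<le> ennreal c * 1" by (intro mult_left_mono G_mass) auto
    finally show ?thesis using c0 by simp
  next
    case False
    then show ?thesis using c0 by (simp add: initial_term_def not_integrable_integral_eq)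
  qed
  with c0 show thesis by (rule that)
qed

text \<open>The integrals \<open>I t x\<close> are chosen separately for each (t, x), so nothing is
  known of their joint measurability. Continuity of translations makes the family mean square
  continuous, uniformly in x and on bounded time intervals, and this yields a predictable
  version.\<close>

lemma ex_mild_image:
  assumes v: "field_predictable v" and l: "0 < l" "kernel_weight l < \<infinity>"
    and bound: "\<And>s y. 0 < s \<Longrightarrow> (\<integral>\<^sup>+\<omega>. ennreal ((v s y \<omega>)\<^sup>2) \<partial>M) \<le> ennreal (D * exp (l * s))"
    and D: "0 \<le> D"
  shows "\<exists>w. mild_image v w"
proof -
  let ?X = "\<lambda>t x. time_cut t (noise_integrand v t x)"
  have Xfin: "square_norm (?X t x) < \<infinity>" for t x
    using noise_integrand_le[OF v bound D, of t x] l(2) by (auto intro: le_less_trans simp: ennreal_mult_less_top)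
  note [measurable] = time_cut_Q[OF noise_integrand_predictable[OF v]]
  have "\<exists>I. I \<in> borel_measurable (\<F> t) \<and> square_integral (?X t x) I" for t x
    using ex_square_integral[OF noise_integrand_predictable[OF v] Xfin] by blast
  then obtain I where I: "\<And>t x. I t x \<in> borel_measurable (\<F> t)" "\<And>t x. square_integral (?X t x) (I t x)"
    by metis
  have cont: "\<exists>\<eta>>0. \<forall>t\<in>{0..T}. \<forall>t'\<in>{0..T}. \<forall>x x'. \<bar>t - t'\<bar> + norm (x - x') < \<eta> \<longrightarrow>
       square_dist M (I t x) (I t' x') \<le> ennreal e" if T: "0 < T" "0 < e" for T e :: real
  proof -
    \<comment> \<open>The 16 comes from \<open>square_integral_le\<close>; the added 1 keeps C
      positive when D = 0.\<close>
    define C where "C = 16 * (Lip\<^sup>2 * K * D * exp (l * T)) + 1"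
    have C: "0 < C" using D K_pos by (auto simp: C_def intro!: add_nonneg_pos mult_nonneg_nonneg)
    obtain \<eta> where \<eta>: "0 < \<eta>" "\<And>d. norm d < \<eta> \<Longrightarrow> translation_error (cut_kernel T) d \<le> ennreal (e / C)"
      using cut_kernel_translation[OF l, of "e / C"] T C by auto
    show ?thesis
    proof (intro exI[of _ \<eta>] conjI \<eta>(1) ballI allI impI)
      fix t t' :: real and x x' :: 'a
      assume t: "t \<in> {0..T}" "t' \<in> {0..T}" and d: "\<bar>t - t'\<bar> + norm (x - x') < \<eta>"
      have "norm (t' - t, x' - x) \<le> norm (t' - t) + norm (x' - x)" by (rule norm_Pair_le)
      also have "\<dots> < \<eta>" using d by (simp add: norm_minus_commute abs_minus_commute)
      finally have te: "translation_error (cut_kernel T) (t' - t, x' - x) \<le> ennreal (e / C)" by (rule \<eta>(2))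
      have "square_dist M (I t x) (I t' x') \<le> 16 * square_norm (\<lambda>z. ?X t x z - ?X t' x' z)"
        by (rule square_integral_le[OF I(2) I(2)]) measurable
      also have "\<dots> \<le> 16 * (ennreal (Lip\<^sup>2 * K * D) * (ennreal (exp (l * T)) * ennreal (e / C)))"
      proof (rule mult_left_mono)
        have "square_norm (\<lambda>z. ?X t x z - ?X t' x' z)
           \<le> ennreal (Lip\<^sup>2 * K * D) * (ennreal (exp (l * T)) * translation_error (cut_kernel T) (t' - t, x' - x))"
          using t by (intro noise_integrand_translate_le[OF v l(1) bound D]) auto
        also have "\<dots> \<le> ennreal (Lip\<^sup>2 * K * D) * (ennreal (exp (l * T)) * ennreal (e / C))"
          by (intro mult_left_mono te) auto
        finally show "square_norm (\<lambda>z. ?X t x z - ?X t' x' z) \<le> \<dots>" .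
      qed simp
      also have "\<dots> = ennreal ((C - 1) * (e / C))"
        using D K_pos T C by (simp add: ennreal_mult[symmetric] C_def mult.assoc flip: ennreal_numeral)
      also have "\<dots> \<le> ennreal e" using C T by (intro ennreal_leI) (simp add: field_simps)
      finally show "square_dist M (I t x) (I t' x') \<le> ennreal e" .
    qed
  qed
  obtain V where V: "(\<lambda>(\<omega>, t, x). V t x \<omega>) \<in> borel_measurable predictable" "\<And>t x. 0 < t \<Longrightarrow> AE \<omega> in M. V t x \<omega> = I t x \<omega>"
    using ex_predictable_version[OF I(1) cont] by blast
  define w where "w t x \<omega> = initial_term t x + V t x \<omega>" for t x \<omega>
  have "field_predictable w"
  proof -
    note [measurable] = V(1) deterministic_predictable[OF initial_term_measurable]
    have "(\<lambda>z. initial_term (fst (snd z)) (snd (snd z)) + (\<lambda>(\<omega>, t, x). V t x \<omega>) z) \<in> borel_measurable predictable"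
      by measurable
    then show ?thesis by (simp add: field_predictable_def w_def case_prod_unfold)
  qed
  then have "mild_image v w"
    unfolding mild_image_def
  proof (intro conjI allI impI)
    fix t :: real and x :: 'a assume t: "0 < t"
    show "\<exists>I. ?X t x \<in> borel_measurable predictable \<and> square_norm (?X t x) < \<infinity> \<and> square_integral (?X t x) I \<and>
       (AE \<omega> in M. w t x \<omega> = initial_term t x + I \<omega>)"
    proof (intro exI[of _ "I t x"] conjI Xfin I)
      show "?X t x \<in> borel_measurable predictable"
        by (rule time_cut_predictable[OF noise_integrand_predictable[OF v]])
      show "AE \<omega> in M. w t x \<omega> = initial_term t x + I t x \<omega>"
        using V(2)[OF t, of x] by eventually_elim (simp add: w_def)
    qed
  qed
  then show ?thesis by blast
qed

text \<open>Of the 256 in the bound on the kernel weight, one factor 16 pays for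
  \<open>square_integral_le\<close> and the other is the gain. Only times up to t enter the
  hypothesis, so the estimate can be iterated on a bounded interval.\<close>

lemma mild_image_contraction:
  assumes v: "field_predictable v" and v': "field_predictable v'"
    and w: "mild_image v w" and w': "mild_image v' w'"
    and l: "kernel_weight l \<le> ennreal (1 / (256 * Lip\<^sup>2 * K))"
    and bound: "\<And>s y. 0 < s \<Longrightarrow> s \<le> t \<Longrightarrow> square_dist M (v s y) (v' s y) \<le> ennreal (D * exp (l * s))"
    and D: "0 \<le> D" and t: "0 < t"
  shows "square_dist M (w t x) (w' t x) \<le> ennreal (D / 16 * exp (l * t))"
proof -
  note [measurable] = time_cut_Q[OF noise_integrand_predictable[OF v]] time_cut_Q[OF noise_integrand_predictable[OF v']]
  obtain I where I: "square_integral (time_cut t (noise_integrand v t x)) I" "AE \<omega> in M. w t x \<omega> = initial_term t x + I \<omega>"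
    using w t unfolding mild_image_def by blast
  obtain I' where I': "square_integral (time_cut t (noise_integrand v' t x)) I'" "AE \<omega> in M. w' t x \<omega> = initial_term t x + I' \<omega>"
    using w' t unfolding mild_image_def by blast
  have "square_dist M (w t x) (w' t x) = square_dist M I I'"
  proof (rule nn_integral_cong_AE)
    show "AE \<omega> in M. ennreal ((w t x \<omega> - w' t x \<omega>)\<^sup>2) = ennreal ((I \<omega> - I' \<omega>)\<^sup>2)"
      using I(2) I'(2) by eventually_elim simp
  qed
  also have "\<dots> \<le> 16 * square_norm (\<lambda>z. time_cut t (noise_integrand v t x) z - time_cut t (noise_integrand v' t x) z)"
    by (rule square_integral_le[OF I(1) I'(1)]) measurable
  also have "\<dots> \<le> 16 * (ennreal (Lip\<^sup>2 * K * D) * (ennreal (exp (l * t)) * kernel_weight l))"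
    by (intro mult_left_mono noise_integrand_diff_le[OF v v' bound D]) auto
  also have "\<dots> \<le> 16 * (ennreal (Lip\<^sup>2 * K * D) * (ennreal (exp (l * t)) * ennreal (1 / (256 * Lip\<^sup>2 * K))))"
    by (intro mult_left_mono l) auto
  also have "\<dots> = ennreal (16 * (Lip\<^sup>2 * K * D * (exp (l * t) * (1 / (256 * Lip\<^sup>2 * K)))))"
    using D K_pos by (simp add: ennreal_mult[symmetric] flip: ennreal_numeral)
  also have "16 * (Lip\<^sup>2 * K * D * (exp (l * t) * (1 / (256 * Lip\<^sup>2 * K)))) = D / 16 * exp (l * t)"
    using K_pos Lip_pos by (simp add: field_simps)
  finally show ?thesis .
qed

text \<open>Because the deterministic term is itself an image, the contraction estimate also bounds
  the noise part of any other image.\<close>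

lemma mild_image_0: "mild_image (\<lambda>t x \<omega>. 0) (\<lambda>t x \<omega>. initial_term t x)"
proof -
  have "square_integral (\<lambda>z. 0) (\<lambda>\<omega>. 0)"
    unfolding square_integral_def
    by (intro conjI exI[of _ "\<lambda>n. []"])
       (auto simp: elementary_Nil eprocess_def elementary_process_def elementary_integral_def square_norm_def case_prod_unfold)
  moreover have "field_predictable (\<lambda>t x \<omega>. initial_term t x)"
    using deterministic_predictable[OF initial_term_measurable] by (simp add: field_predictable_def case_prod_unfold)
  ultimately show ?thesis
    unfolding mild_image_def noise_integrand_0 by (auto intro!: exI[of _ "\<lambda>\<omega>. 0"] simp: square_norm_def)
qed

lemma mild_image_cong_AE:
  assumes w: "mild_image v w" and u: "field_predictable u" and eq: "\<And>t x. 0 < t \<Longrightarrow> AE \<omega> in M. w t x \<omega> = u t x \<omega>"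
  shows "mild_image v u"
  unfolding mild_image_def
proof (intro conjI allI impI u)
  fix t :: real and x :: 'a assume t: "0 < t"
  obtain I where I: "time_cut t (noise_integrand v t x) \<in> borel_measurable predictable"
     "square_norm (time_cut t (noise_integrand v t x)) < \<infinity>"
     "square_integral (time_cut t (noise_integrand v t x)) I"
     "AE \<omega> in M. w t x \<omega> = initial_term t x + I \<omega>"
    using w t unfolding mild_image_def by blast
  have "AE \<omega> in M. u t x \<omega> = initial_term t x + I \<omega>"
    using I(4) eq[OF t, of x] by eventually_elim simp
  with I show "\<exists>I. time_cut t (noise_integrand v t x) \<in> borel_measurable predictable \<and>
     square_norm (time_cut t (noise_integrand v t x)) < \<infinity> \<and>
     square_integral (time_cut t (noise_integrand v t x)) I \<and> (AE \<omega> in M. u t x \<omega> = initial_term t x + I \<omega>)"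
    by blast
qed

lemma ex_contraction_weight:
  obtains l where "0 < l" "kernel_weight l \<le> ennreal (1 / (256 * Lip\<^sup>2 * K))" "kernel_weight l < \<infinity>"
proof -
  have "0 < 1 / (256 * Lip\<^sup>2 * K)" using Lip_pos K_pos by simp
  from G_square[OF this] obtain l where l: "0 < l" "kernel_weight l \<le> ennreal (1 / (256 * Lip\<^sup>2 * K))"
    unfolding kernel_weight_def by blast
  moreover have "kernel_weight l < \<infinity>" using l(2) by (rule le_less_trans) simp
  ultimately show thesis by (rule that)
qed

text \<open>Picard iteration from the zero field inside the invariant ball \<open>good\<close>. The
  iterates approach their limit u at rate \<open>(1/16)^n\<close>; an image w of u is equally close
  to them, so w and u agree almost surely and u is an image of itself.\<close>

lemma ex_random_field_solution: "\<exists>u. random_field_solution M \<mu> N G \<sigma> u0 u"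
proof -
  obtain l where l: "0 < l" "kernel_weight l \<le> ennreal (1 / (256 * Lip\<^sup>2 * K))" "kernel_weight l < \<infinity>"
    by (rule ex_contraction_weight)
  obtain c where c: "0 \<le> c" "\<And>t x. \<bar>initial_term t x\<bar> \<le> c" using initial_term_bound by blast
  \<comment> \<open>With c bounding the initial term, \<open>D / 4 = c\<^sup>2\<close>, and the ball
    is invariant since 2 * D/16 + 2 * D/4 = 5 * D/8 \<le> D.\<close>
  define D where "D = 4 * c\<^sup>2"
  have D: "0 \<le> D" by (simp add: D_def)
  define good where "good v \<longleftrightarrow> field_predictable v \<and> (\<forall>s>0. \<forall>y. (\<integral>\<^sup>+\<omega>. ennreal ((v s y \<omega>)\<^sup>2) \<partial>M) \<le> ennreal (D * exp (l * s)))" for v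
  have good_0: "good (\<lambda>t x \<omega>. 0)" using D by (simp add: good_def field_predictable_0)
  have step: "\<exists>w. good w \<and> mild_image v w" if v: "good v" for v
  proof -
    obtain w where w: "mild_image v w"
      using ex_mild_image[OF _ l(1,3) _ D, of v] v unfolding good_def by blast
    have wp: "field_predictable w" using w by (simp add: mild_image_def)
    have "(\<integral>\<^sup>+\<omega>. ennreal ((w s y \<omega>)\<^sup>2) \<partial>M) \<le> ennreal (D * exp (l * s))" if s: "0 < s" for s y
    proof -
      have wm [measurable]: "w s y \<in> borel_measurable M" by (rule field_section_measurable[OF wp s])
      have 1: "square_dist M (w s y) (\<lambda>_. initial_term s y) \<le> ennreal (D / 16 * exp (l * s))"
        by (rule mild_image_contraction[OF _ field_predictable_0 w mild_image_0 l(2) _ D s]) (use v in \<open>auto simp: good_def\<close>)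
      have 2: "square_dist M (\<lambda>_. initial_term s y) (\<lambda>_. 0) \<le> ennreal (D / 4)"
      proof -
        have "(initial_term s y)\<^sup>2 \<le> c\<^sup>2" using c by (metis abs_ge_zero power2_abs power_mono)
        then show ?thesis by (simp add: emeasure_space_1 D_def ennreal_leI)
      qed
      have "square_dist M (w s y) (\<lambda>_. 0) \<le> 2 * square_dist M (w s y) (\<lambda>_. initial_term s y) + 2 * square_dist M (\<lambda>_. initial_term s y) (\<lambda>_. 0)"
        by (rule nn_integral_square_triangle) auto
      also have "\<dots> \<le> 2 * ennreal (D / 16 * exp (l * s)) + 2 * ennreal (D / 4)"
        by (intro add_mono mult_left_mono 1 2) auto
      also have "\<dots> = ennreal (2 * (D / 16 * exp (l * s)) + 2 * (D / 4))"
        using D by (subst ennreal_plus) (auto simp: ennreal_mult[symmetric] simp flip: ennreal_numeral)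
      also have "\<dots> \<le> ennreal (D * exp (l * s))"
      proof (rule ennreal_leI)
        have "1 \<le> exp (l * s)" using l(1) s by simp
        then have "D * 1 \<le> D * exp (l * s)" by (rule mult_left_mono[OF _ D])
        then show "2 * (D / 16 * exp (l * s)) + 2 * (D / 4) \<le> D * exp (l * s)" using D by simp
      qed
      finally show ?thesis by simp
    qed
    then show ?thesis using w wp by (auto simp: good_def)
  qed
  \<comment> \<open>The mild map is a relation, so the iterates are picked by dependent
    choice.\<close>
  have "\<exists>U. \<forall>n. (good (U n) \<and> (n = 0 \<longrightarrow> U n = (\<lambda>t x \<omega>. 0))) \<and> mild_image (U n) (U (Suc n))"
    by (rule dependent_nat_choice) (use good_0 step in auto)
  then obtain U where U: "\<And>n. good (U n)" "U 0 = (\<lambda>t x \<omega>. 0)" "\<And>n. mild_image (U n) (U (Suc n))"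
    by blast
  have Up: "field_predictable (U n)" for n using U(1) by (simp add: good_def)
  have Um [measurable]: "U n t x \<in> borel_measurable M" if "0 < t" for n t x
    by (rule field_section_measurable[OF Up that])
  have diff: "square_dist M (U (Suc n) t x) (U n t x) \<le> ennreal (D * (1/16)^n * exp (l * t))" if "0 < t" for n t x
    using that
  proof (induction n arbitrary: t x)
    case 0
    \<comment> \<open>As \<open>U 0\<close> is the zero field, the base case is the membership of
      \<open>U 1\<close> in the ball.\<close>
    then show ?case using U(1)[of 1] by (simp add: good_def U(2))
  next
    case (Suc n)
    have "square_dist M (U (Suc (Suc n)) t x) (U (Suc n) t x) \<le> ennreal (D * (1/16)^n / 16 * exp (l * t))"
      using D by (intro mild_image_contraction[OF Up Up U(3) U(3) l(2) Suc.IH _ Suc.prems]) auto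
    then show ?case by simp
  qed
  \<comment> \<open>A pointwise \<open>lim\<close> keeps the field predictable, while convergence is
    needed only at each (t, x) separately, up to a null set.\<close>
  define u where "u t x \<omega> = lim (\<lambda>n. U n t x \<omega>)" for t x \<omega>
  have up: "field_predictable u"
  proof -
    have "(\<lambda>(\<omega>, t, x). u t x \<omega>) = (\<lambda>z. lim (\<lambda>n. (\<lambda>(\<omega>, t, x). U n t x \<omega>) z))"
      by (auto simp: u_def)
    also have "\<dots> \<in> borel_measurable predictable"
      by (rule borel_measurable_lim_metric[OF Up[unfolded field_predictable_def]])
    finally show ?thesis unfolding field_predictable_def .
  qed
  have um [measurable]: "u t x \<in> borel_measurable M" if "0 < t" for t x
    by (rule field_section_measurable[OF up that])
  have lim: "square_dist M (u t x) (U n t x) \<le> ennreal (4 * D * (1/16)^n * exp (l * t))" if t: "0 < t" for n t x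
  proof -
    have "square_dist M (\<lambda>\<omega>. lim (\<lambda>n. U n t x \<omega>)) (U n t x) \<le> ennreal (4 * (D * exp (l * t)) * (1/16)^n)"
      by (rule geometric_square_limit(2)[OF Um[OF t]]) (use diff[OF t] D in \<open>auto simp: mult_ac\<close>)
    then show ?thesis by (simp add: u_def mult_ac)
  qed
  have ubound: "(\<integral>\<^sup>+\<omega>. ennreal ((u s y \<omega>)\<^sup>2) \<partial>M) \<le> ennreal (4 * D * exp (l * s))" if "0 < s" for s y
    using lim[OF that, of y 0] by (simp add: U(2))
  \<comment> \<open>So far u is only a limit of iterates; an image of it is constructed first and
    compared with u afterwards.\<close>
  obtain w where w: "mild_image u w"
    using ex_mild_image[OF up l(1,3) ubound] D by auto
  have wp: "field_predictable w" using w by (simp add: mild_image_def)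
  have "AE \<omega> in M. w t x \<omega> = u t x \<omega>" if t: "0 < t" for t x
  proof (rule AE_eq_of_square_le_geometric)
    show wm [measurable]: "w t x \<in> borel_measurable M" by (rule field_section_measurable[OF wp t])
    show "u t x \<in> borel_measurable M" by (rule um[OF t])
    note [measurable] = um[OF t] Um[OF t]
    fix n
    let ?b = "4 * D * (1/16)^n * exp (l * t)"
    \<comment> \<open>u is within \<open>4 * D * (1/16)^n * exp (l * t)\<close> of
      \<open>U n\<close>, and passing to the images gains another 16.\<close>
    have 1: "square_dist M (w t x) (U (Suc n) t x) \<le> ennreal (4 * D * (1/16)^n / 16 * exp (l * t))"
      using D by (intro mild_image_contraction[OF up Up w U(3) l(2) lim _ t]) auto
    have 2: "square_dist M (U (Suc n) t x) (u t x) \<le> ennreal (?b / 16)"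
      using lim[OF t, of x "Suc n"] by (simp add: nn_integral_square_commute[where f = "U (Suc n) t x"] mult.commute mult.left_commute)
    have "square_dist M (w t x) (u t x) \<le> 2 * square_dist M (w t x) (U (Suc n) t x) + 2 * square_dist M (U (Suc n) t x) (u t x)"
      by (rule nn_integral_square_triangle) measurable
    also have "\<dots> \<le> 2 * ennreal (4 * D * (1/16)^n / 16 * exp (l * t)) + 2 * ennreal (?b / 16)"
      by (intro add_mono mult_left_mono 1 2) auto
    also have "\<dots> = ennreal (2 * (4 * D * (1/16)^n / 16 * exp (l * t)) + 2 * (?b / 16))"
      using D by (subst ennreal_plus) (auto simp: ennreal_mult[symmetric] simp flip: ennreal_numeral)
    also have "\<dots> \<le> ennreal (4 * D * exp (l * t) * (1/16)^n)"
      using D by (intro ennreal_leI) (simp add: field_simps)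
    finally show "square_dist M (w t x) (u t x) \<le> ennreal (4 * D * exp (l * t) * (1/16)^n)" .
  qed
  then have "mild_image u u" by (rule mild_image_cong_AE[OF w up])
  moreover have "(SUP t\<in>{0<..T}. SUP x. \<integral>\<^sup>+\<omega>. ennreal ((u t x \<omega>)\<^sup>2) \<partial>M) < \<infinity>" for T
  proof -
    have "(SUP t\<in>{0<..T}. SUP x. \<integral>\<^sup>+\<omega>. ennreal ((u t x \<omega>)\<^sup>2) \<partial>M) \<le> ennreal (4 * D * exp (l * T))"
    proof (intro SUP_least)
      fix t x assume t: "t \<in> {0<..T}"
      have "(\<integral>\<^sup>+\<omega>. ennreal ((u t x \<omega>)\<^sup>2) \<partial>M) \<le> ennreal (4 * D * exp (l * t))" using t by (intro ubound) auto
      also have "\<dots> \<le> ennreal (4 * D * exp (l * T))" using t l(1) D by (intro ennreal_leI mult_left_mono) auto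
      finally show "(\<integral>\<^sup>+\<omega>. ennreal ((u t x \<omega>)\<^sup>2) \<partial>M) \<le> ennreal (4 * D * exp (l * T))" .
    qed
    then show ?thesis by (rule le_less_trans) simp
  qed
  ultimately have "random_field_solution M \<mu> N G \<sigma> u0 u"
    unfolding random_field_solution_def mild_solution_iff by blast
  then show ?thesis by blast
qed

text \<open>Each solution is its own image, so the contraction can be applied to the same pair again
  and again: the a priori bound D on their distance over \<open>{0<..T}\<close> shrinks by 1/16 in
  every round. A constant bound is an admissible start because
  \<open>exp (l * t) \<ge> 1\<close>.\<close>

lemma random_field_solution_unique:
  assumes u: "random_field_solution M \<mu> N G \<sigma> u0 u" and v: "random_field_solution M \<mu> N G \<sigma> u0 v"
  shows "modification M v u"
  unfolding modification_def
proof (intro allI impI)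
  fix T :: real and X :: 'a assume T: "0 < T"
  obtain l where l: "0 < l" "kernel_weight l \<le> ennreal (1 / (256 * Lip\<^sup>2 * K))" "kernel_weight l < \<infinity>"
    by (rule ex_contraction_weight)
  have im: "mild_image u u" "mild_image v v" using u v by (auto simp: random_field_solution_def mild_solution_iff)
  have p: "field_predictable u" "field_predictable v" using im by (auto simp: mild_image_def)
  note m = field_section_measurable[OF p(1)] field_section_measurable[OF p(2)]
  have sup: "\<exists>B\<ge>0. \<forall>t\<in>{0<..T}. \<forall>x. (\<integral>\<^sup>+\<omega>. ennreal ((w t x \<omega>)\<^sup>2) \<partial>M) \<le> ennreal B"
    if w: "random_field_solution M \<mu> N G \<sigma> u0 w" for w
  proof -
    let ?S = "SUP t\<in>{0<..T}. SUP x. \<integral>\<^sup>+\<omega>. ennreal ((w t x \<omega>)\<^sup>2) \<partial>M"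
    have "?S < \<infinity>" using w T unfolding random_field_solution_def by blast
    then obtain B where B: "0 \<le> B" "?S = ennreal B" by (cases ?S rule: ennreal_cases) auto
    have "(\<integral>\<^sup>+\<omega>. ennreal ((w t x \<omega>)\<^sup>2) \<partial>M) \<le> ?S" if "t \<in> {0<..T}" for t x
      using that by (intro SUP_upper2[of t] SUP_upper) auto
    with B show ?thesis by auto
  qed
  obtain A where A: "0 \<le> A" "\<And>t x. t \<in> {0<..T} \<Longrightarrow> (\<integral>\<^sup>+\<omega>. ennreal ((u t x \<omega>)\<^sup>2) \<partial>M) \<le> ennreal A"
    using sup[OF u] by blast
  obtain B where B: "0 \<le> B" "\<And>t x. t \<in> {0<..T} \<Longrightarrow> (\<integral>\<^sup>+\<omega>. ennreal ((v t x \<omega>)\<^sup>2) \<partial>M) \<le> ennreal B"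
    using sup[OF v] by blast
  define D where "D = 2 * B + 2 * A"
  have D: "0 \<le> D" using A B by (simp add: D_def)
  have le: "square_dist M (v t x) (u t x) \<le> ennreal (D * (1/16)^n * exp (l * t))" if "0 < t" "t \<le> T" for n t x
    using that
  proof (induction n arbitrary: t x)
    case 0
    note [measurable] = m[OF 0(1)]
    have "square_dist M (v t x) (u t x) \<le> 2 * square_dist M (v t x) (\<lambda>_. 0) + 2 * square_dist M (\<lambda>_. 0) (u t x)"
      by (rule nn_integral_square_triangle) measurable
    also have "\<dots> \<le> 2 * ennreal B + 2 * ennreal A"
      using A(2)[of t x] B(2)[of t x] 0 by (intro add_mono mult_left_mono) auto
    also have "\<dots> = ennreal D"
      using A B unfolding D_def by (subst ennreal_plus) (auto simp: ennreal_mult[symmetric] simp flip: ennreal_numeral)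
    also have "\<dots> \<le> ennreal (D * exp (l * t))"
    proof (rule ennreal_leI)
      have "1 \<le> exp (l * t)" using l(1) 0 by simp
      from mult_left_mono[OF this D] show "D \<le> D * exp (l * t)" by simp
    qed
    finally show ?case by simp
  next
    case (Suc n)
    have "square_dist M (v t x) (u t x) \<le> ennreal (D * (1/16)^n / 16 * exp (l * t))"
      using D Suc.prems by (intro mild_image_contraction[OF p(2,1) im(2,1) l(2) Suc.IH]) auto
    then show ?case by simp
  qed
  show "AE \<omega> in M. v T X \<omega> = u T X \<omega>"
    by (rule AE_eq_of_square_le_geometric[where C = "D * exp (l * T)", OF m(2)[OF T] m(1)[OF T]])
       (use le[OF T order_refl] in \<open>simp add: mult_ac\<close>)
qed

end

theorem theorem2p1:
  fixes \<alpha> \<beta> \<nu> Lip K :: real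
    and M :: "'w measure"
    and \<mu> :: "'a::euclidean_space measure"
    and N :: "'w \<Rightarrow> (real \<times> 'a \<times> 'a) measure"
    and p :: "real \<Rightarrow> 'a \<Rightarrow> real"
    and g :: "real \<Rightarrow> real"
    and u0 J :: "'a \<Rightarrow> real"
    and \<sigma> :: "real \<Rightarrow> 'a \<Rightarrow> real"
  assumes "0 < \<alpha>" and "\<alpha> \<le> 2" and "0 < \<beta>" and "\<beta> < 1" and "0 < \<nu>"
    and "real DIM('a) < min 2 (1 / \<beta>) * \<alpha>"
    and "u0 \<in> borel_measurable borel" and "bounded (range u0)"
    and "prob_space M"
    and "levy_measure \<mu>"
    and "poisson_random_measure M (intensity \<mu>) N"
    and "isotropic_stable_density \<alpha> \<nu> p"
    and "stable_subordinator_density \<beta> g"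
    and "(\<lambda>(x, h). \<sigma> x h) \<in> borel_measurable (borel \<Otimes>\<^sub>M borel)"
    and "\<And>h. \<sigma> 0 h = 0"
    and "J \<in> borel_measurable borel" and "\<And>h. 0 \<le> J h"
    and "0 < Lip" and "0 < K"
    and "\<And>x y h. \<bar>\<sigma> x h - \<sigma> y h\<bar> \<le> J h * Lip * \<bar>x - y\<bar>"
    and "(\<integral>\<^sup>+h. ennreal ((J h)\<^sup>2) \<partial>\<mu>) \<le> ennreal K"
  shows "\<exists>u. random_field_solution M \<mu> N (fundamental_solution \<beta> g p) \<sigma> u0 u \<and>
           (\<forall>v. random_field_solution M \<mu> N (fundamental_solution \<beta> g p) \<sigma> u0 v \<longrightarrow> modification M v u)"
proof -
  interpret prob_space M by fact
  interpret kern: subordinated_kernel \<alpha> \<beta> \<nu> p g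
    by unfold_locales (use assms in auto)
  interpret mild_equation M \<mu> N "fundamental_solution \<beta> g p" \<sigma> u0 J Lip K
  proof
    show "(\<lambda>(x, h). \<sigma> x h) \<in> borel_measurable borel"
      using assms(14) by (simp add: borel_prod)
  qed (fact assms kern.G_measurable kern.G_nonneg kern.G_past kern.G_mass kern.G_square)+
  obtain u where u: "random_field_solution M \<mu> N (fundamental_solution \<beta> g p) \<sigma> u0 u"
    using ex_random_field_solution by blast
  then show ?thesis using random_field_solution_unique by blast
qed

end
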